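(* Let $W$ be one of $W_H$, $W_L$, $W_J$, with $W=T\widetilde WT^*$ as in the context, and let $D=T(x)\big(\partial^2\rho(x)+\partial\,(\widetilde W(x)\rho(x))'\widetilde W(x)^{-1}+\widetilde K\big)T(x)^{-1}$, where $K=\sum_{j=1}^{\lfloor N/2\rfloor}E_{2j,2j}$ and $\widetilde K=2K$, $K$, $(\alpha_1+\beta_1)K$ in the Hermite, Laguerre, Jacobi case respectively. Then $D$ is a second-order operator in $\mathcal D(W)$ and $\mathcal D(W)=\mathbb C[D]$, i.e. every operator in $\mathcal D(W)$ is a polynomial in $D$.
   Context: Classical scalar weights: Hermite $w_b(x)=e^{-x^2+2bx}$ on $\mathbb R$; Laguerre $w_\alpha(x)=e^{-x}x^\alpha$ on $(0,\infty)$, $\alpha>-1$; Jacobi $w_{\alpha,\beta}(x)=(1-x)^\alpha(1+x)^\beta$ on $(-1,1)$, $\alpha,\beta>-1$; $\rho(x)=1$, $x$, $1-x^2$ in the Hermite, Laguerre, Jacobi cases. Let $N\ge2$, $A=\sum_{j=1}^{\lfloor N/2\rfloor}a_{2j-1}E_{2j-1,2j}+\sum_{j=1}^{\lfloor (N-1)/2\rfloor}a_{2j}E_{2j+1,2j}$ ($E_{s,t}$ matrix units, all $a_j\in\mathbb R\setminus\{0\}$), $T(x)=I+Ax$. $W_H=T\widetilde W_HT^*$ with $\widetilde W_H=\mathrm{diag}(w_{b_1},\dots,w_{b_N})$, $b_i$ pairwise distinct reals; $W_L=T\widetilde W_LT^*$ with $\widetilde W_L=\mathrm{diag}(w_{\alpha_1},\dots,w_{\alpha_N})$,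 $\alpha_i-\alpha_j\notin\mathbb Z$ for $i\ne j$; $W_J=T\widetilde W_JT^*$ with $\widetilde W_J=\mathrm{diag}(w_{\alpha_1,\beta_1},\dots,w_{\alpha_N,\beta_N})$, where for $i\ne j$, $\alpha_i-\alpha_j\notin\mathbb Z$ or $\beta_i-\beta_j\notin\mathbb Z$, and $\alpha_1+\beta_1=\alpha_j+\beta_j+1+(-1)^j$ for all $j$. Differential operators act on the right: $P\cdot\sum_j\partial^jF_j=\sum_j\partial^j(P)F_j$; $T\mathcal BT^{-1}$ denotes composition with multiplication operators. For a weight matrix $W$ with monic orthogonal polynomials $P_n$ (w.r.t. $\langle P,Q\rangle=\int PWQ^*dx$), $\mathcal D(W)$ is the algebra of differential operators with matrix polynomial coefficients such that $P_n\cdot D=\Lambda_n(D)P_n$ for all $n\ge0$ with constant matrices $\Lambda_n(D)$. *)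

theory Defs
  imports "HOL-Analysis.Analysis" "HOL-Computational_Algebra.Polynomial"
    "Jordan_Normal_Form.Schur_Decomposition" "Jordan_Normal_Form.Gauss_Jordan_Elimination"
begin

(* Matrix indices in JNF are 0-based; the paper's index i corresponds to i-1. *)

type_synonym pmat = "complex poly mat"

definition eval_pmat :: "pmat \<Rightarrow> real \<Rightarrow> complex mat" where
  "eval_pmat P x = map_mat (\<lambda>p. poly p (complex_of_real x)) P"

definition pderiv_mat :: "nat \<Rightarrow> pmat \<Rightarrow> pmat" where
  "pderiv_mat j P = map_mat (pderiv ^^ j) P"

definition coeff_mat :: "pmat \<Rightarrow> nat \<Rightarrow> complex mat" where
  "coeff_mat P k = mat (dim_row P) (dim_col P) (\<lambda>(i,j). coeff (P $$ (i,j)) k)"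

definition const_pmat :: "complex mat \<Rightarrow> pmat" where
  "const_pmat C = map_mat (\<lambda>c. [:c:]) C"

definition monic_deg :: "nat \<Rightarrow> nat \<Rightarrow> pmat \<Rightarrow> bool" where
  "monic_deg N n P \<longleftrightarrow> P \<in> carrier_mat N N \<and>
     (\<forall>i<N. \<forall>j<N. degree (P $$ (i,j)) \<le> n) \<and> coeff_mat P n = 1\<^sub>m N"

definition mip :: "nat \<Rightarrow> (real \<Rightarrow> complex mat) \<Rightarrow> real set \<Rightarrow> pmat \<Rightarrow> pmat \<Rightarrow> complex mat" where
  "mip N W S P Q = mat N N (\<lambda>(i,j).
     integral S (\<lambda>x. (eval_pmat P x * W x * mat_adjoint (eval_pmat Q x)) $$ (i,j)))"

definition monic_OPS :: "nat \<Rightarrow> (real \<Rightarrow> complex mat) \<Rightarrow> real set \<Rightarrow> (nat \<Rightarrow> pmat) \<Rightarrow> bool" where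
  "monic_OPS N W S Ps \<longleftrightarrow> (\<forall>n. monic_deg N n (Ps n)) \<and>
     (\<forall>n m. n \<noteq> m \<longrightarrow> mip N W S (Ps n) (Ps m) = 0\<^sub>m N N)"

(* Differential operators  D = sum_j d^j F_j  with matrix polynomial          *)
(* coefficients, represented by the list [F_0, F_1, ..., F_k], acting on the  *)
(* right:  P . D = sum_j P^(j) F_j.                                            *)

type_synonym dop = "pmat list"

definition wf_dop :: "nat \<Rightarrow> dop \<Rightarrow> bool" where
  "wf_dop N D \<longleftrightarrow> (\<forall>F\<in>set D. F \<in> carrier_mat N N)"

definition dop_act :: "dop \<Rightarrow> pmat \<Rightarrow> pmat" where
  "dop_act D P = foldr (\<lambda>j acc. pderiv_mat j P * D ! j + acc) [0..<length D]
                    (0\<^sub>m (dim_row P) (dim_col P))"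

definition poly_dop_act :: "complex poly \<Rightarrow> dop \<Rightarrow> pmat \<Rightarrow> pmat" where
  "poly_dop_act q D P = foldr (\<lambda>k acc. [:coeff q k:] \<cdot>\<^sub>m ((dop_act D ^^ k) P) + acc)
                          [0..<Suc (degree q)] (0\<^sub>m (dim_row P) (dim_col P))"

definition DW :: "nat \<Rightarrow> (real \<Rightarrow> complex mat) \<Rightarrow> real set \<Rightarrow> dop set" where
  "DW N W S = {D. wf_dop N D \<and> (\<forall>Ps. monic_OPS N W S Ps \<longrightarrow>
      (\<forall>n. \<exists>\<Lambda>\<in>carrier_mat N N. dop_act D (Ps n) = const_pmat \<Lambda> * Ps n))}"

definition poly_algebra :: "nat \<Rightarrow> dop \<Rightarrow> dop set" where
  "poly_algebra N D = {E. wf_dop N E \<and>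
      (\<exists>q. \<forall>P\<in>carrier_mat N N. dop_act E P = poly_dop_act q D P)}"

(* The classical families.  Parameters are 1-based functions: p i, q i for   *)
(* i = 1..N  (Hermite: p = b; Laguerre: p = alpha; Jacobi: p = alpha,q = beta)*)

datatype family = Hermite | Laguerre | Jacobi

fun scalar_weight :: "family \<Rightarrow> real \<Rightarrow> real \<Rightarrow> real \<Rightarrow> real" where
  "scalar_weight Hermite b _ x = exp (- x\<^sup>2 + 2 * b * x)"
| "scalar_weight Laguerre \<alpha> _ x = exp (- x) * x powr \<alpha>"
| "scalar_weight Jacobi \<alpha> \<beta> x = (1 - x) powr \<alpha> * (1 + x) powr \<beta>"

fun support :: "family \<Rightarrow> real set" where
  "support Hermite = UNIV"
| "support Laguerre = {0<..}"
| "support Jacobi = {-1<..<1}"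

fun rho :: "family \<Rightarrow> real \<Rightarrow> real" where
  "rho Hermite x = 1"
| "rho Laguerre x = x"
| "rho Jacobi x = 1 - x\<^sup>2"

fun admissible :: "family \<Rightarrow> nat \<Rightarrow> (nat \<Rightarrow> real) \<Rightarrow> (nat \<Rightarrow> real) \<Rightarrow> bool" where
  "admissible Hermite N b _ \<longleftrightarrow> (\<forall>i\<in>{1..N}. \<forall>j\<in>{1..N}. i \<noteq> j \<longrightarrow> b i \<noteq> b j)"
| "admissible Laguerre N \<alpha> _ \<longleftrightarrow> (\<forall>i\<in>{1..N}. \<alpha> i > -1) \<and>
     (\<forall>i\<in>{1..N}. \<forall>j\<in>{1..N}. i \<noteq> j \<longrightarrow> \<alpha> i - \<alpha> j \<notin> \<int>)"
| "admissible Jacobi N \<alpha> \<beta> \<longleftrightarrow> (\<forall>i\<in>{1..N}. \<alpha> i > -1 \<and> \<beta> i > -1) \<and>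
     (\<forall>i\<in>{1..N}. \<forall>j\<in>{1..N}. i \<noteq> j \<longrightarrow> \<alpha> i - \<alpha> j \<notin> \<int> \<or> \<beta> i - \<beta> j \<notin> \<int>) \<and>
     (\<forall>j\<in>{1..N}. \<alpha> 1 + \<beta> 1 = \<alpha> j + \<beta> j + 1 + (-1) ^ j)"

definition Wtilde :: "family \<Rightarrow> nat \<Rightarrow> (nat \<Rightarrow> real) \<Rightarrow> (nat \<Rightarrow> real) \<Rightarrow> real \<Rightarrow> complex mat" where
  "Wtilde fam N p q x = mat N N (\<lambda>(i,j). if i = j
       then complex_of_real (scalar_weight fam (p (i+1)) (q (i+1)) x) else 0)"

text \<open>A = sum_j a_(2j-1) E_(2j-1,2j) + sum_j a_(2j) E_(2j+1,2j) (1-based), written entrywise: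
  the (r,c) entry (1-based) is a_r if r odd and c = r+1, a_c if c even and r = c+1, else 0.\<close>
definition Amat :: "nat \<Rightarrow> (nat \<Rightarrow> real) \<Rightarrow> complex mat" where
  "Amat N a = mat N N (\<lambda>(i,j). let r = i + 1; c = j + 1 in
      if odd r \<and> c = r + 1 then complex_of_real (a r)
      else if even c \<and> r = c + 1 then complex_of_real (a c) else 0)"

definition Tpoly :: "nat \<Rightarrow> (nat \<Rightarrow> real) \<Rightarrow> pmat" where
  "Tpoly N a = 1\<^sub>m N + map_mat (\<lambda>c. [:0, c:]) (Amat N a)"

definition Kmat :: "nat \<Rightarrow> complex mat" where
  "Kmat N = mat N N (\<lambda>(i,j). if i = j \<and> even (i + 1) then 1 else 0)"

fun Ktilde :: "family \<Rightarrow> nat \<Rightarrow> (nat \<Rightarrow> real) \<Rightarrow> (nat \<Rightarrow> real) \<Rightarrow> complex mat" where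
  "Ktilde Hermite N _ _ = 2 \<cdot>\<^sub>m Kmat N"
| "Ktilde Laguerre N _ _ = Kmat N"
| "Ktilde Jacobi N \<alpha> \<beta> = complex_of_real (\<alpha> 1 + \<beta> 1) \<cdot>\<^sub>m Kmat N"

definition Wmat :: "family \<Rightarrow> nat \<Rightarrow> (nat \<Rightarrow> real) \<Rightarrow> (nat \<Rightarrow> real) \<Rightarrow> (nat \<Rightarrow> real) \<Rightarrow> real \<Rightarrow> complex mat" where
  "Wmat fam N a p q x = eval_pmat (Tpoly N a) x * Wtilde fam N p q x * mat_adjoint (eval_pmat (Tpoly N a) x)"

definition minv :: "complex mat \<Rightarrow> complex mat" where
  "minv M = the (mat_inverse M)"

definition mat_vderiv :: "nat \<Rightarrow> (real \<Rightarrow> complex mat) \<Rightarrow> real \<Rightarrow> complex mat" where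
  "mat_vderiv N F x = mat N N (\<lambda>(i,j). vector_derivative (\<lambda>t. F t $$ (i,j)) (at x))"

text \<open>Value at x of P . (T B T^-1), where B = d^2 rho + d (Wtilde rho)' Wtilde^-1 + Ktilde and
  operators act on the right, so P . (T B T^-1) = ((P T) . B) T^-1.\<close>
definition paper_D_action :: "family \<Rightarrow> nat \<Rightarrow> (nat \<Rightarrow> real) \<Rightarrow> (nat \<Rightarrow> real) \<Rightarrow> (nat \<Rightarrow> real)
    \<Rightarrow> pmat \<Rightarrow> real \<Rightarrow> complex mat" where
  "paper_D_action fam N a p q P x =
     (let PT = P * Tpoly N a;
          Phi = mat_vderiv N (\<lambda>t. complex_of_real (rho fam t) \<cdot>\<^sub>m Wtilde fam N p q t) x
                * minv (Wtilde fam N p q x)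
      in (complex_of_real (rho fam x) \<cdot>\<^sub>m eval_pmat (pderiv_mat 2 PT) x
          + eval_pmat (pderiv_mat 1 PT) x * Phi
          + eval_pmat PT x * Ktilde fam N p q)
         * minv (eval_pmat (Tpoly N a) x))"

end

theory Submission
  imports Defs "HOL-Probability.Distributions" "HOL-Library.Function_Algebras"
    "HOL-Real_Asymp.Real_Asymp"
begin

text \<open>
  Write \<open>u\<^sub>k\<close> for integration against the \<open>k\<close>-th scalar weight. An operator \<open>E\<close> lies in \<open>D(W)\<close> iff,
  acting on rows of polynomials, it preserves degrees and has a degree preserving adjoint. As \<open>T\<close> is
  unimodular, \<open>B = T\<inverse> E T\<close> then still has an adjoint with polynomial values, now with respect to the
  diagonal weight. For \<open>i \<noteq> j\<close> the adjoint relation for the entry \<open>B\<^sub>i\<^sub>j\<close>, together with the Pearson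
  equation \<open>(\<rho> u)' = v u\<close>, makes polynomial multiples of \<open>u\<^sub>i\<close> and \<open>u\<^sub>j\<close> coincide, so that a rational
  function would have the logarithmic derivative of \<open>w\<^sub>j / w\<^sub>i\<close>; the hypotheses on the parameters
  exclude this, and \<open>B\<close> is diagonal.

  A diagonal entry preserves degrees and has a degree preserving adjoint, so it is determined by its
  eigenvalues, which are polynomial in \<open>n\<close>. That \<open>E\<close> itself preserves degrees makes the eigenvalues
  of neighbouring entries shifts of each other by one, exactly as for \<open>D\<close>. It remains to see that
  the first eigenvalue sequence is a polynomial in that of Bochner's operator \<open>\<rho> \<partial>\<^sup>2 + v \<partial>\<close>. For Hermite
  and Laguerre the latter is linear in \<open>n\<close>. For Jacobi, subtracting a polynomial in Bochner's
  operator leaves an operator whose eigenvalues are odd under the reflection fixing those of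
  Bochner's operator; its square is a polynomial of odd degree in Bochner's operator, so its
  principal symbol would be a square root of a constant times an odd power of \<open>1 - x\<^sup>2\<close>.
\<close>

hide_const (open) Module.smult Module.module LinearCombinations.module_hom

section \<open>Operators adjointable along a flag\<close>

definition poly_op :: "('k::comm_ring_1 \<Rightarrow> 'v::ab_group_add \<Rightarrow> 'v) \<Rightarrow> 'k poly \<Rightarrow> ('v \<Rightarrow> 'v) \<Rightarrow> 'v \<Rightarrow> 'v" where
  "poly_op s Q L x = (\<Sum>k\<le>degree Q. s (coeff Q k) ((L ^^ k) x))"

locale flagged_module = Modules.module scale
  for scale :: "'k::field \<Rightarrow> 'v::ab_group_add \<Rightarrow> 'v" (infixr "*s" 75) +
  fixes V :: "nat \<Rightarrow> 'v set" and B :: "'v \<Rightarrow> 'v \<Rightarrow> 'k"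
  assumes subspace_V: "subspace (V n)"
    and linear_left: "module_hom scale (*) (\<lambda>x. B x y)"
    and linear_right: "module_hom scale (*) (B x)"
begin

lemmas left_scale = module_hom.scale[OF linear_left]
  and left_add = module_hom.add[OF linear_left]
  and right_scale = module_hom.scale[OF linear_right]
  and right_add = module_hom.add[OF linear_right]

definition adjointable :: "('v \<Rightarrow> 'v) \<Rightarrow> bool" where
  "adjointable L \<longleftrightarrow> module_hom scale scale L \<and> (\<forall>n. \<forall>x\<in>V n. L x \<in> V n) \<and>
     (\<forall>n. \<forall>y\<in>V n. \<exists>z\<in>V n. \<forall>m. \<forall>x\<in>V m. B (L x) y = B x z)"

lemma adjointableI:
  assumes "module_hom scale scale L" and "\<And>n x. x \<in> V n \<Longrightarrow> L x \<in> V n"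
    and "\<And>n y. y \<in> V n \<Longrightarrow> \<exists>z\<in>V n. \<forall>m. \<forall>x\<in>V m. B (L x) y = B x z"
  shows "adjointable L"
  using assms by (simp add: adjointable_def)

lemma adjointable_linear: "adjointable L \<Longrightarrow> module_hom scale scale L"
  and adjointable_flag: "adjointable L \<Longrightarrow> x \<in> V n \<Longrightarrow> L x \<in> V n"
  by (auto simp: adjointable_def)

lemma adjointable_adjointE:
  assumes "adjointable L" "y \<in> V n"
  obtains z where "z \<in> V n" "\<And>m x. x \<in> V m \<Longrightarrow> B (L x) y = B x z"
  using assms unfolding adjointable_def by blast

lemma adjointable_symmetric:
  assumes "module_hom scale scale L" and "\<And>n x. x \<in> V n \<Longrightarrow> L x \<in> V n"
    and "\<And>x y. B (L x) y = B x (L y)"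
  shows "adjointable L"
  using assms by (intro adjointableI) auto

lemma adjointable_cong:
  assumes L: "adjointable L" and M: "module_hom scale scale M"
    and eq: "\<And>n x. x \<in> V n \<Longrightarrow> L x = M x"
  shows "adjointable M"
proof (rule adjointableI[OF M])
  show "M x \<in> V n" if "x \<in> V n" for n x
    using adjointable_flag[OF L that] eq[OF that] by simp
  show "\<exists>z\<in>V n. \<forall>m. \<forall>x\<in>V m. B (M x) y = B x z" if y: "y \<in> V n" for n y
    using adjointable_adjointE[OF L y] eq by metis
qed

lemma adjointable_id: "adjointable (\<lambda>x. x)"
  by (rule adjointable_symmetric) (simp_all add: module_hom_iff module_axioms)

lemma adjointable_scale:
  assumes L: "adjointable L"
  shows "adjointable (\<lambda>x. c *s L x)"
proof (rule adjointableI)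
  interpret L: module_hom scale scale L using L by (rule adjointable_linear)
  show "module_hom scale scale (\<lambda>x. c *s L x)"
    by (simp add: module_hom_iff module_axioms L.add L.scale scale_right_distrib mult.commute)
  show "c *s L x \<in> V n" if "x \<in> V n" for n x
    using adjointable_flag[OF L that] by (rule subspace_scale[OF subspace_V])
  show "\<exists>z\<in>V n. \<forall>m. \<forall>x\<in>V m. B (c *s L x) y = B x z" if y: "y \<in> V n" for n y
  proof -
    obtain z where z: "z \<in> V n" "\<And>m x. x \<in> V m \<Longrightarrow> B (L x) y = B x z"
      using adjointable_adjointE[OF L y] by blast
    have "c *s z \<in> V n" using z(1) by (rule subspace_scale[OF subspace_V])
    with z(2) show ?thesis
      by (intro bexI[of _ "c *s z"]) (auto simp: left_scale right_scale)
  qed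
qed

lemma adjointable_add:
  assumes L: "adjointable L" and M: "adjointable M"
  shows "adjointable (\<lambda>x. L x + M x)"
proof (rule adjointableI)
  interpret L: module_hom scale scale L using L by (rule adjointable_linear)
  interpret M: module_hom scale scale M using M by (rule adjointable_linear)
  show "module_hom scale scale (\<lambda>x. L x + M x)"
    by (simp add: module_hom_iff module_axioms L.add L.scale M.add M.scale scale_right_distrib)
  show "L x + M x \<in> V n" if "x \<in> V n" for n x
    using adjointable_flag[OF L that] adjointable_flag[OF M that] by (rule subspace_add[OF subspace_V])
  show "\<exists>z\<in>V n. \<forall>m. \<forall>x\<in>V m. B (L x + M x) y = B x z" if y: "y \<in> V n" for n y
  proof -
    obtain z where z: "z \<in> V n" "\<And>m x. x \<in> V m \<Longrightarrow> B (L x) y = B x z"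
      using adjointable_adjointE[OF L y] by blast
    obtain z' where z': "z' \<in> V n" "\<And>m x. x \<in> V m \<Longrightarrow> B (M x) y = B x z'"
      using adjointable_adjointE[OF M y] by blast
    have "z + z' \<in> V n" using z(1) z'(1) by (rule subspace_add[OF subspace_V])
    with z(2) z'(2) show ?thesis
      by (intro bexI[of _ "z + z'"]) (auto simp: left_add right_add)
  qed
qed

lemma adjointable_comp:
  assumes L: "adjointable L" and M: "adjointable M"
  shows "adjointable (\<lambda>x. L (M x))"
proof (rule adjointableI)
  show "module_hom scale scale (\<lambda>x. L (M x))"
    using module_hom_compose[OF adjointable_linear[OF M] adjointable_linear[OF L]] by (simp add: o_def)
  show "L (M x) \<in> V n" if "x \<in> V n" for n x
    by (rule adjointable_flag[OF L adjointable_flag[OF M that]])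
  show "\<exists>z\<in>V n. \<forall>m. \<forall>x\<in>V m. B (L (M x)) y = B x z" if y: "y \<in> V n" for n y
  proof -
    obtain z where z: "z \<in> V n" "\<And>m x. x \<in> V m \<Longrightarrow> B (L x) y = B x z"
      using adjointable_adjointE[OF L y] by blast
    show ?thesis
      using adjointable_adjointE[OF M z(1)] z(2) adjointable_flag[OF M] by metis
  qed
qed

lemma adjointable_funpow: "adjointable L \<Longrightarrow> adjointable (L ^^ k)"
proof (induction k)
  case 0
  then show ?case using adjointable_id by (simp add: id_def)
next
  case (Suc k)
  then show ?case using adjointable_comp[of L "L ^^ k"] by (simp add: o_def)
qed

lemma adjointable_sum:
  assumes "\<And>i. i \<in> I \<Longrightarrow> adjointable (L i)"
  shows "adjointable (\<lambda>x. \<Sum>i\<in>I. L i x)"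
proof -
  have zero: "adjointable (\<lambda>x. 0)"
    using adjointable_scale[OF adjointable_id, of 0] by simp
  show ?thesis
    using assms
    by (induction I rule: infinite_finite_induct) (simp_all add: zero adjointable_add)
qed

lemma adjointable_poly_op: "adjointable L \<Longrightarrow> adjointable (poly_op scale Q L)"
  unfolding poly_op_def[abs_def]
  by (intro adjointable_sum adjointable_scale adjointable_funpow)

end

section \<open>Degree preserving operators on polynomials\<close>

interpretation poly_module: Modules.module "smult :: 'a::field \<Rightarrow> 'a poly \<Rightarrow> 'a poly"
  by unfold_locales (auto simp: smult_add_right smult_add_left)

abbreviation poly_linear :: "('a::field poly \<Rightarrow> 'a poly) \<Rightarrow> bool" where
  "poly_linear \<equiv> module_hom smult smult"

abbreviation poly_functional :: "('a::field poly \<Rightarrow> 'a) \<Rightarrow> bool" where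
  "poly_functional \<equiv> module_hom smult (*)"

lemma poly_linearI:
  "(\<And>f g. L (f + g) = L f + L g) \<Longrightarrow> (\<And>c f. L (smult c f) = smult c (L f)) \<Longrightarrow> poly_linear L"
  by (simp add: module_hom_iff poly_module.module_axioms)

lemma poly_functionalI:
  "(\<And>f g. u (f + g) = u f + u g) \<Longrightarrow> (\<And>c f. u (smult c f) = c * u f) \<Longrightarrow> poly_functional u"
  by (simp add: module_hom_iff poly_module.module_axioms vector_space_over_itself.module_axioms)

definition poly_below :: "nat \<Rightarrow> 'a::zero poly set" where
  "poly_below n = {f. \<forall>i\<ge>n. coeff f i = 0}"

lemma poly_belowD: "f \<in> poly_below n \<Longrightarrow> n \<le> i \<Longrightarrow> coeff f i = 0"
  by (simp add: poly_below_def)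

lemma poly_below_0 [simp]: "poly_below 0 = {0}"
  by (auto simp: poly_below_def poly_eq_iff)

lemma subspace_poly_below: "poly_module.subspace (poly_below n)"
  by (rule poly_module.subspaceI) (auto simp: poly_below_def)

lemmas zero_in_poly_below [simp] = poly_module.subspace_0[OF subspace_poly_below]
  and poly_below_add = poly_module.subspace_add[OF subspace_poly_below]
  and poly_below_diff = poly_module.subspace_diff[OF subspace_poly_below]
  and poly_below_smult = poly_module.subspace_scale[OF subspace_poly_below]
  and poly_below_sum = poly_module.subspace_sum[OF subspace_poly_below]

lemma poly_below_Suc_iff: "f \<in> poly_below (Suc n) \<longleftrightarrow> degree f \<le> n"
  by (auto simp: poly_below_def Suc_le_eq coeff_eq_0 intro!: degree_le)

lemma poly_below_SucD: "f \<in> poly_below (Suc n) \<Longrightarrow> coeff f n = 0 \<Longrightarrow> f \<in> poly_below n"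
  by (auto simp: poly_below_def) (metis Suc_leI le_neq_implies_less)

lemma poly_below_mono: "m \<le> n \<Longrightarrow> poly_below m \<subseteq> poly_below n"
  by (auto simp: poly_below_def)

lemma ex_poly_below: "\<exists>n. f \<in> poly_below n"
  using poly_below_Suc_iff[of f "degree f"] by blast

lemma monom_in_poly_below: "n < m \<Longrightarrow> monom c n \<in> poly_below m"
  by (auto simp: poly_below_def)

lemma pCons_in_poly_below: "f \<in> poly_below n \<Longrightarrow> pCons c f \<in> poly_below (Suc n)"
  by (auto simp: poly_below_def coeff_pCons split: nat.split)

definition diag_coeff :: "('a::comm_ring_1 poly \<Rightarrow> 'a poly) \<Rightarrow> nat \<Rightarrow> 'a" where
  "diag_coeff L n = coeff (L (monom 1 n)) n"

lemma coeff_degree_preserving: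
  assumes "poly_linear L" and pres: "\<And>f n. f \<in> poly_below n \<Longrightarrow> L f \<in> poly_below n"
    and f: "f \<in> poly_below (Suc n)"
  shows "coeff (L f) n = diag_coeff L n * coeff f n"
proof -
  interpret L: module_hom smult smult L by fact
  define g where "g = f - smult (coeff f n) (monom 1 n)"
  have "g \<in> poly_below n"
    unfolding g_def using f
    by (intro poly_below_SucD[OF poly_below_diff] poly_below_smult monom_in_poly_below) simp_all
  then have "coeff (L g) n = 0" using pres by (auto simp: poly_below_def)
  moreover have "L f = L g + smult (coeff f n) (L (monom 1 n))"
    by (simp add: g_def L.diff L.scale del: smult_monom)
  ultimately show ?thesis by (simp add: diag_coeff_def)
qed

abbreviation poly_adjointable :: "('a::field poly \<Rightarrow> 'a) \<Rightarrow> ('a poly \<Rightarrow> 'a poly) \<Rightarrow> bool" where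
  "poly_adjointable u \<equiv> flagged_module.adjointable smult poly_below (\<lambda>f g. u (f * g))"

locale functional =
  fixes u :: "'a::field poly \<Rightarrow> 'a"
  assumes linear: "poly_functional u"
begin

lemmas zero [simp] = module_hom.zero[OF linear]
  and add = module_hom.add[OF linear]
  and diff = module_hom.diff[OF linear]
  and scale = module_hom.scale[OF linear]
  and sum = module_hom.sum[OF linear]

sublocale flag: flagged_module smult poly_below "\<lambda>f g. u (f * g)"
  by unfold_locales (simp_all add: subspace_poly_below distrib_left distrib_right add scale)

lemma coeff_adjointable:
  assumes "poly_adjointable u L" "f \<in> poly_below (Suc n)"
  shows "coeff (L f) n = diag_coeff L n * coeff f n"
  using flag.adjointable_linear[OF assms(1)] flag.adjointable_flag[OF assms(1)] assms(2)
  by (rule coeff_degree_preserving)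

lemma adjoint_polyE:
  assumes "poly_adjointable u L" "g \<in> poly_below n"
  obtains h where "h \<in> poly_below n" "\<And>f. u (L f * g) = u (f * h)"
  using flag.adjointable_adjointE[OF assms] ex_poly_below by metis

lemma diag_coeff_comp:
  assumes "poly_adjointable u L" "poly_adjointable u M"
  shows "diag_coeff (\<lambda>f. L (M f)) n = diag_coeff L n * diag_coeff M n"
  using coeff_adjointable[OF assms(1) flag.adjointable_flag[OF assms(2) monom_in_poly_below]]
  by (simp add: diag_coeff_def)

lemma diag_coeff_funpow:
  assumes L: "poly_adjointable u L"
  shows "diag_coeff (L ^^ k) n = diag_coeff L n ^ k"
proof (induction k)
  case 0
  then show ?case by (simp add: diag_coeff_def)
next
  case (Suc k)
  then show ?case
    using diag_coeff_comp[OF L flag.adjointable_funpow[OF L], of k n] by (simp add: o_def)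
qed

lemma diag_coeff_poly_op:
  assumes "poly_adjointable u L"
  shows "diag_coeff (poly_op smult Q L) n = poly Q (diag_coeff L n)"
  using diag_coeff_funpow[OF assms]
  by (simp add: poly_op_def poly_altdef diag_coeff_def coeff_sum)

end

interpretation cnj_poly: map_poly_comm_ring_hom cnj
  by unfold_locales auto

abbreviation cnj_poly :: "complex poly \<Rightarrow> complex poly" where
  "cnj_poly \<equiv> map_poly cnj"

lemma cnj_poly_cnj_poly [simp]: "cnj_poly (cnj_poly f) = f"
  by (simp add: poly_eq_iff)

lemma cnj_poly_in_poly_below [simp]: "cnj_poly f \<in> poly_below n \<longleftrightarrow> f \<in> poly_below n"
  by (simp add: poly_below_def)

locale definite_functional = functional u
  for u :: "complex poly \<Rightarrow> complex" +
  assumes definite: "u (f * cnj_poly f) = 0 \<Longrightarrow> f = 0"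
begin

lemma eq_0_if_annihilates: "(\<And>f. u (f * g) = 0) \<Longrightarrow> g = 0"
  by (metis definite mult.commute)

lemma adjointable_eq_0:
  assumes L: "poly_adjointable u L" and diag: "\<And>n. diag_coeff L n = 0"
  shows "L f = 0"
proof -
  interpret L: module_hom smult smult L using L by (rule flag.adjointable_linear)
  have "L f = 0" if "f \<in> poly_below n" for n f
    using that
  proof (induction n arbitrary: f)
    case 0
    then show ?case by simp
  next
    case (Suc n)
    have "coeff (L f) n = 0" using coeff_adjointable[OF L Suc.prems] diag by simp
    with flag.adjointable_flag[OF L Suc.prems] have "L f \<in> poly_below n"
      by (rule poly_below_SucD)
    then obtain h where h: "h \<in> poly_below n" "\<And>g. u (L g * cnj_poly (L f)) = u (g * h)"
      using adjoint_polyE[OF L, of "cnj_poly (L f)" n] by auto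
    have "u (cnj_poly h * h) = u (L (cnj_poly h) * cnj_poly (L f))" using h by simp
    also have "L (cnj_poly h) = 0" using Suc.IH h by simp
    finally have "h = 0" using definite[of h] by (simp add: mult.commute)
    then have "u (L f * cnj_poly (L f)) = 0" using h by simp
    then show ?case by (rule definite)
  qed
  then show ?thesis using ex_poly_below by blast
qed

lemma adjointable_eqI:
  assumes L: "poly_adjointable u L" and M: "poly_adjointable u M"
    and diag: "\<And>n. diag_coeff L n = diag_coeff M n"
  shows "L = M"
proof
  fix f
  have "poly_adjointable u (\<lambda>f. L f + smult (- 1) (M f))"
    using L M by (intro flag.adjointable_add flag.adjointable_scale)
  then have "L f + smult (- 1) (M f) = 0"
    by (rule adjointable_eq_0) (use diag in \<open>simp add: diag_coeff_def\<close>)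
  then show "L f = M f" by simp
qed

end

section \<open>Differential operators and principal symbols\<close>

definition diffop :: "('a::field_char_0 poly \<Rightarrow> 'a poly) \<Rightarrow> bool" where
  "diffop L \<longleftrightarrow> (\<exists>k b. \<forall>f. L f = (\<Sum>j<k. b j * (pderiv ^^ j) f))"

lemma diffopI: "(\<And>f. L f = (\<Sum>j<k. b j * (pderiv ^^ j) f)) \<Longrightarrow> diffop L"
  unfolding diffop_def by blast

lemma diffopE:
  assumes "diffop L"
  obtains k b where "\<And>f. L f = (\<Sum>j<k. b j * (pderiv ^^ j) f)"
  using assms unfolding diffop_def by blast

lemma diffop_times: "diffop (\<lambda>f. c * f)"
  by (rule diffopI[of _ "\<lambda>_. c" 1]) simp

lemma diffop_0: "diffop (\<lambda>f. 0)"
  using diffop_times[of 0] by simp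

lemma diffop_add:
  assumes "diffop L" "diffop M"
  shows "diffop (\<lambda>f. L f + M f)"
proof -
  obtain k b where L: "\<And>f. L f = (\<Sum>j<k. b j * (pderiv ^^ j) f)"
    using diffopE[OF assms(1)] by blast
  obtain l c where M: "\<And>f. M f = (\<Sum>j<l. c j * (pderiv ^^ j) f)"
    using diffopE[OF assms(2)] by blast
  define m where "m = max k l"
  have "L f = (\<Sum>j<m. (if j < k then b j else 0) * (pderiv ^^ j) f)" for f
    unfolding L by (rule sum.mono_neutral_cong_left) (auto simp: m_def)
  moreover have "M f = (\<Sum>j<m. (if j < l then c j else 0) * (pderiv ^^ j) f)" for f
    unfolding M by (rule sum.mono_neutral_cong_left) (auto simp: m_def)
  ultimately have "L f + M f =
      (\<Sum>j<m. ((if j < k then b j else 0) + (if j < l then c j else 0)) * (pderiv ^^ j) f)" for f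
    by (simp only: sum.distrib distrib_right)
  then show ?thesis by (rule diffopI)
qed

lemma diffop_sum: "(\<And>i. i \<in> I \<Longrightarrow> diffop (L i)) \<Longrightarrow> diffop (\<lambda>f. \<Sum>i\<in>I. L i f)"
  by (induction I rule: infinite_finite_induct) (auto intro: diffop_0 diffop_add)

lemma diffop_mult:
  assumes "diffop L"
  shows "diffop (\<lambda>f. c * L f)"
proof -
  obtain k b where L: "\<And>f. L f = (\<Sum>j<k. b j * (pderiv ^^ j) f)"
    using diffopE[OF assms] by blast
  show ?thesis
    by (rule diffopI[of _ "\<lambda>j. c * b j" k]) (simp add: L sum_distrib_left mult.assoc)
qed

lemma diffop_smult: "diffop L \<Longrightarrow> diffop (\<lambda>f. smult c (L f))"
  using diffop_mult[of L "[:c:]"] by simp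

lemma diffop_higher_pderiv: "diffop (pderiv ^^ j)"
  by (rule diffopI[of _ "\<lambda>i. if i = j then 1 else 0" "Suc j"])
    (simp add: if_distrib[of "\<lambda>x. x * _"] cong: if_cong)

lemma diffop_pderiv:
  assumes "diffop L"
  shows "diffop (\<lambda>f. pderiv (L f))"
proof -
  obtain k b where L: "\<And>f. L f = (\<Sum>j<k. b j * (pderiv ^^ j) f)"
    using diffopE[OF assms] by blast
  have "pderiv (L f) = (\<Sum>j<k. pderiv (b j) * (pderiv ^^ j) f + b j * (pderiv ^^ Suc j) f)" for f
    unfolding L higher_pderiv_sum[of 1, simplified]
    by (rule sum.cong) (simp_all add: pderiv_mult algebra_simps)
  then show ?thesis
    by (simp only:) (intro diffop_sum diffop_add diffop_mult diffop_higher_pderiv)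
qed

lemma diffop_comp:
  assumes "diffop L" "diffop M"
  shows "diffop (\<lambda>f. L (M f))"
proof -
  obtain k b where L: "\<And>f. L f = (\<Sum>j<k. b j * (pderiv ^^ j) f)"
    using diffopE[OF assms(1)] by blast
  have "diffop (\<lambda>f. (pderiv ^^ j) (M f))" for j
    by (induction j) (auto intro: assms diffop_pderiv)
  then show ?thesis unfolding L by (intro diffop_sum diffop_mult)
qed

lemma diffop_funpow: "diffop L \<Longrightarrow> diffop (L ^^ k)"
proof (induction k)
  case 0
  then show ?case using diffop_times[of 1] by (simp add: id_def)
next
  case (Suc k)
  then show ?case using diffop_comp[of L "L ^^ k"] by (simp add: o_def)
qed

lemma diffop_poly_op: "diffop L \<Longrightarrow> diffop (poly_op smult Q L)"
  unfolding poly_op_def[abs_def] by (intro diffop_sum diffop_smult diffop_funpow)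

lemma diffop_linear: "diffop L \<Longrightarrow> poly_linear L"
  by (elim diffopE, intro poly_linearI)
    (auto simp: higher_pderiv_add higher_pderiv_smult distrib_left sum.distrib smult_sum2)

definition falling :: "nat \<Rightarrow> 'a::comm_ring_1 poly" where
  "falling j = (\<Prod>i<j. [:- of_nat i, 1:])"

lemma poly_falling_eq_0: "n < j \<Longrightarrow> poly (falling j) (of_nat n :: 'a::field_char_0) = 0"
  by (auto simp: falling_def poly_prod)

lemma higher_pderiv_monom_falling:
  "(pderiv ^^ j) (monom (1::'a::field_char_0) n) = monom (poly (falling j) (of_nat n)) (n - j)"
proof (induction j)
  case 0
  then show ?case by (simp add: falling_def)
next
  case (Suc j)
  have "poly (falling (Suc j)) (of_nat n :: 'a) = poly (falling j) (of_nat n) * (of_nat n - of_nat j)"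
    by (simp add: falling_def algebra_simps)
  then show ?case
    using poly_falling_eq_0[of n j, where 'a = 'a]
    by (cases "j \<le> n") (auto simp: Suc pderiv_monom mult.commute of_nat_diff)
qed

lemma diffop_diag_coeff:
  assumes "diffop L"
  obtains Q where "\<And>n. diag_coeff L n = poly Q (of_nat n)"
proof -
  obtain k b where L: "\<And>f. L f = (\<Sum>j<k. b j * (pderiv ^^ j) f)"
    using diffopE[OF assms] by blast
  have "coeff (b j * (pderiv ^^ j) (monom 1 n)) n = coeff (b j) j * poly (falling j) (of_nat n)" for j n
    by (cases "j \<le> n")
      (simp_all add: higher_pderiv_monom_falling poly_falling_eq_0 mult.commute[of "b j"]
          coeff_monom_mult)
  then have "diag_coeff L n = poly (\<Sum>j<k. smult (coeff (b j) j) (falling j)) (of_nat n)" for n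
    by (simp add: diag_coeff_def L coeff_sum poly_sum)
  then show ?thesis by (rule that)
qed

text \<open>The principal symbol is read off from the action on functions vanishing to high order at a point.\<close>

definition has_symbol :: "('a::field_char_0 poly \<Rightarrow> 'a poly) \<Rightarrow> nat \<Rightarrow> 'a poly \<Rightarrow> bool" where
  "has_symbol L k b \<longleftrightarrow> (\<forall>t n g. [:- t, 1:] ^ Suc n dvd
     L ([:- t, 1:] ^ (n + k) * g) - [:- t, 1:] ^ n * smult (fact (n + k) / fact n) (b * g))"

lemma has_symbolD:
  "has_symbol L k b \<Longrightarrow> [:- t, 1:] ^ Suc n dvd
     L ([:- t, 1:] ^ (n + k) * g) - [:- t, 1:] ^ n * smult (fact (n + k) / fact n) (b * g)"
  unfolding has_symbol_def by blast

lemma has_symbol_power_dvd: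
  assumes "has_symbol L k b" "[:- t, 1:] ^ (n + k) dvd f"
  shows "[:- t, 1:] ^ n dvd L f"
proof -
  obtain g where f: "f = [:- t, 1:] ^ (n + k) * g" using assms(2) by (elim dvdE)
  have "[:- t, 1:] ^ n dvd L f - [:- t, 1:] ^ n * smult (fact (n + k) / fact n) (b * g)"
    unfolding f using has_symbolD[OF assms(1)] by (rule power_le_dvd) simp
  then show ?thesis by (subst (asm) dvd_diff_left_iff) (rule dvd_triv_left)
qed

lemma has_symbol_raise:
  assumes "has_symbol L k b" "k < l"
  shows "has_symbol L l 0"
  unfolding has_symbol_def
proof (intro allI)
  fix t :: 'a and n and g :: "'a poly"
  have "[:- t, 1:] ^ (Suc n + k) dvd [:- t, 1:] ^ (n + l) * g"
    using assms(2) by (intro dvd_mult2 le_imp_power_dvd) simp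
  from has_symbol_power_dvd[OF assms(1) this]
  show "[:- t, 1:] ^ Suc n dvd L ([:- t, 1:] ^ (n + l) * g)
      - [:- t, 1:] ^ n * smult (fact (n + l) / fact n) (0 * g)" by simp
qed

lemma poly_eq_symbol:
  assumes "has_symbol L k b"
  shows "poly (L ([:- t, 1:] ^ k)) t = fact k * poly b t"
proof -
  have "[:- t, 1:] dvd L ([:- t, 1:] ^ k) - smult (fact k) b"
    using has_symbolD[OF assms, of t 0 1] by simp
  then have "poly (L ([:- t, 1:] ^ k) - smult (fact k) b) t = 0"
    by (simp only: poly_eq_0_iff_dvd)
  then show ?thesis by simp
qed

lemma has_symbol_same_order_unique:
  assumes "has_symbol L k b" "has_symbol L k c"
  shows "b = c"
proof -
  have "poly b t = poly c t" for t
    using poly_eq_symbol[OF assms(1), of t] poly_eq_symbol[OF assms(2), of t] by simp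
  then show ?thesis by (simp add: poly_eq_poly_eq_iff[symmetric] ext)
qed

lemma has_symbol_unique:
  assumes "has_symbol L k b" "has_symbol L l c" and "b \<noteq> 0" "c \<noteq> 0"
  shows "k = l" "b = c"
proof -
  show "k = l"
    using assms has_symbol_raise has_symbol_same_order_unique by (metis linorder_neqE_nat)
  then show "b = c" using assms has_symbol_same_order_unique by blast
qed

lemma has_symbol_times: "has_symbol (\<lambda>f. c * f) 0 c"
  by (simp add: has_symbol_def mult.left_commute)

lemma has_symbol_0: "has_symbol (\<lambda>f. 0) k 0"
  by (simp add: has_symbol_def)

lemma pderiv_linear_power_mult:
  "pderiv ([:- t, 1:] ^ Suc n * g) =
     [:- t, 1:] ^ Suc n * pderiv g + [:- t, 1:] ^ n * smult (of_nat (Suc n)) g"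
  for t :: "'a::field_char_0"
  using pderiv_power_Suc[of "[:- t, 1:]" n]
  by (simp only: pderiv_mult)
    (simp add: pderiv_pCons mult_ac flip: one_pCons del: mult_pCons_left mult_pCons_right power_Suc)

lemma has_symbol_pderiv: "has_symbol pderiv 1 1"
proof -
  have "[:- t, 1:] ^ Suc n dvd
      pderiv ([:- t, 1:] ^ (n + 1) * g) - [:- t, 1:] ^ n * smult (fact (n + 1) / fact n) (1 * g)"
    for t :: 'a and n g
  proof -
    have "fact (n + 1) / fact n = (of_nat (Suc n) :: 'a)" by simp
    then show ?thesis
      using pderiv_linear_power_mult[of t n g]
      by (simp del: power_Suc mult_pCons_left mult_pCons_right of_nat_Suc)
  qed
  then show ?thesis by (simp add: has_symbol_def)
qed

lemma has_symbol_add: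
  assumes "has_symbol L k b" "has_symbol M k c"
  shows "has_symbol (\<lambda>f. L f + M f) k (b + c)"
  unfolding has_symbol_def
proof (intro allI)
  fix t :: 'a and n and g :: "'a poly"
  show "[:- t, 1:] ^ Suc n dvd L ([:- t, 1:] ^ (n + k) * g) + M ([:- t, 1:] ^ (n + k) * g)
      - [:- t, 1:] ^ n * smult (fact (n + k) / fact n) ((b + c) * g)"
    using dvd_add[OF has_symbolD[OF assms(1), of t n g] has_symbolD[OF assms(2), of t n g]]
    by (simp add: algebra_simps smult_add_right del: mult_pCons_left mult_pCons_right power_Suc)
qed

lemma has_symbol_comp:
  assumes L: "has_symbol L k b" and M: "has_symbol M l c" and "poly_linear L"
  shows "has_symbol (\<lambda>f. L (M f)) (k + l) (b * c)"
  unfolding has_symbol_def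
proof (intro allI)
  fix t :: 'a and n and g :: "'a poly"
  interpret L: module_hom smult smult L by fact
  let ?x = "[:- t, 1:]"
  define h where "h = smult (fact (n + (k + l)) / fact (n + k)) (c * g)"
  have "?x ^ (Suc n + k) dvd M (?x ^ (n + (k + l)) * g) - ?x ^ (n + k) * h"
    unfolding h_def using has_symbolD[OF M, of t "n + k" g] by (simp add: add.assoc)
  then have "?x ^ Suc n dvd L (M (?x ^ (n + (k + l)) * g) - ?x ^ (n + k) * h)"
    by (rule has_symbol_power_dvd[OF L])
  then have "?x ^ Suc n dvd L (M (?x ^ (n + (k + l)) * g)) - L (?x ^ (n + k) * h)"
    by (simp only: L.diff)
  from dvd_add[OF this has_symbolD[OF L, of t n h]]
  have "?x ^ Suc n dvd L (M (?x ^ (n + (k + l)) * g)) - ?x ^ n * smult (fact (n + k) / fact n) (b * h)"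
    by (simp only: diff_add_cancel add_diff_eq)
  also have "smult (fact (n + k) / fact n) (b * h) = smult (fact (n + (k + l)) / fact n) (b * c * g)"
    by (simp add: h_def mult.assoc)
  finally show "?x ^ Suc n dvd L (M (?x ^ (n + (k + l)) * g))
      - ?x ^ n * smult (fact (n + (k + l)) / fact n) (b * c * g)" .
qed

lemma has_symbol_funpow:
  assumes "has_symbol L k b" "poly_linear L"
  shows "has_symbol (L ^^ n) (n * k) (b ^ n)"
proof (induction n)
  case 0
  then show ?case using has_symbol_times[of 1] by (simp add: id_def)
next
  case (Suc n)
  then show ?case using has_symbol_comp[OF assms(1) Suc assms(2)] by (simp add: o_def)
qed

lemma has_symbol_mult: "has_symbol L k b \<Longrightarrow> has_symbol (\<lambda>f. c * L f) k (c * b)"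
  using has_symbol_comp[OF has_symbol_times[of c], of L k b]
  by (simp add: poly_linearI algebra_simps)

lemma has_symbol_smult: "has_symbol L k b \<Longrightarrow> has_symbol (\<lambda>f. smult c (L f)) k (smult c b)"
  using has_symbol_mult[of L k b "[:c:]"] by simp

lemma has_symbol_higher_pderiv: "has_symbol (pderiv ^^ j) j 1"
  using has_symbol_funpow[OF has_symbol_pderiv, of j]
  by (simp add: poly_linearI pderiv_add pderiv_smult)

lemma has_symbol_sum_lead:
  fixes m :: nat
  assumes "\<And>j. j \<le> m \<Longrightarrow> has_symbol (L j) (d j) (b j)" "\<And>j. j < m \<Longrightarrow> d j < d m"
  shows "has_symbol (\<lambda>f. \<Sum>j\<le>m. L j f) (d m) (b m)"
proof -
  have "has_symbol (L j) (d m) 0" if "j < m" for j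
    using assms that by (intro has_symbol_raise[of "L j" "d j" "b j"]) auto
  then have "has_symbol (\<lambda>f. \<Sum>j<l. L j f) (d m) 0" if "l \<le> m" for l
    using that
  proof (induction l)
    case (Suc l)
    then show ?case
      using has_symbol_add[of "\<lambda>f. \<Sum>j<l. L j f" "d m" 0 "L l" 0] by simp
  qed (simp add: has_symbol_0)
  then have "has_symbol (\<lambda>f. (\<Sum>j<m. L j f) + L m f) (d m) (0 + b m)"
    using assms(1)[of m] by (intro has_symbol_add) auto
  then show ?thesis by (simp add: lessThan_Suc_atMost[symmetric])
qed

lemma has_symbol_poly_op:
  assumes "has_symbol L k b" "poly_linear L" "k > 0"
  shows "has_symbol (poly_op smult Q L) (degree Q * k) (smult (lead_coeff Q) (b ^ degree Q))"
  unfolding poly_op_def[abs_def]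
  by (rule has_symbol_sum_lead[where d = "\<lambda>j. j * k" and b = "\<lambda>j. smult (coeff Q j) (b ^ j)"])
    (use assms in \<open>auto intro!: has_symbol_smult has_symbol_funpow\<close>)

lemma diffop_has_symbol:
  assumes "diffop L" "L \<noteq> (\<lambda>f. 0)"
  obtains k b where "b \<noteq> 0" "has_symbol L k b"
proof -
  obtain k b where L: "\<And>f. L f = (\<Sum>j<k. b j * (pderiv ^^ j) f)"
    using diffopE[OF assms(1)] by blast
  define J where "J = {j. j < k \<and> b j \<noteq> 0}"
  have L_J: "L f = (\<Sum>j\<in>J. b j * (pderiv ^^ j) f)" for f
    unfolding L J_def by (rule sum.mono_neutral_right) auto
  have "finite J" by (simp add: J_def)
  moreover have "J \<noteq> {}"
    using assms(2) by (auto simp: L_J[abs_def])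
  ultimately have Max: "Max J \<in> J" "\<And>j. j \<in> J \<Longrightarrow> j \<le> Max J" by auto
  then have "L = (\<lambda>f. \<Sum>j\<le>Max J. b j * (pderiv ^^ j) f)"
    unfolding L_J by (intro ext sum.mono_neutral_left) (auto simp: J_def)
  moreover have "has_symbol (\<lambda>f. b j * (pderiv ^^ j) f) j (b j)" for j
    using has_symbol_mult[OF has_symbol_higher_pderiv, of "b j" j] by simp
  then have "has_symbol (\<lambda>f. \<Sum>j\<le>Max J. b j * (pderiv ^^ j) f) (Max J) (b (Max J))"
    by (rule has_symbol_sum_lead[where d = "\<lambda>j. j"]) auto
  ultimately show ?thesis using Max(1) by (intro that) (auto simp: J_def)
qed

lemma order_power: "f \<noteq> 0 \<Longrightarrow> Polynomial.order t (f ^ n) = n * Polynomial.order t f"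
  for f :: "'a::field poly"
  by (induction n) (auto simp: order_mult)

text \<open>The square of the symbol of \<open>C\<close> would have odd order at \<open>t\<close>.\<close>

lemma no_diffop_square_root:
  assumes C: "diffop C" and L: "has_symbol L k b" "poly_linear L" "k > 0"
    and b: "b \<noteq> 0" "odd (Polynomial.order t b)" and Q: "odd (degree Q)"
  shows "(\<lambda>f. C (C f)) \<noteq> poly_op smult Q L"
proof
  assume square: "(\<lambda>f. C (C f)) = poly_op smult Q L"
  let ?s = "smult (lead_coeff Q) (b ^ degree Q)"
  have symbol: "has_symbol (poly_op smult Q L) (degree Q * k) ?s"
    using L by (rule has_symbol_poly_op)
  have "Q \<noteq> 0" using Q by auto
  then have nz: "lead_coeff Q \<noteq> 0" "?s \<noteq> 0" using b by auto
  have "C \<noteq> (\<lambda>f. 0)"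
  proof
    assume "C = (\<lambda>f. 0)"
    then have "has_symbol (poly_op smult Q L) (degree Q * k) 0"
      using has_symbol_0 by (simp flip: square)
    with symbol have "?s = 0" by (rule has_symbol_same_order_unique)
    with nz(2) show False ..
  qed
  with C obtain l c where c: "c \<noteq> 0" "has_symbol C l c"
    by (rule diffop_has_symbol)
  have "has_symbol (poly_op smult Q L) (l + l) (c * c)"
    using has_symbol_comp[OF c(2) c(2) diffop_linear[OF C]] square by simp
  then have "c * c = ?s"
    using symbol by (rule has_symbol_unique(2)) (use c(1) nz(2) in simp_all)
  then have "2 * Polynomial.order t c = degree Q * Polynomial.order t b"
    using c(1) b nz by (metis mult_2 no_zero_divisors order_mult order_power order_smult)
  with b(2) Q show False by (metis dvd_triv_left even_mult_iff)
qed

section \<open>Pearson functionals\<close>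

definition bochner_eigenvalue :: "'a::comm_ring_1 poly \<Rightarrow> 'a poly \<Rightarrow> nat \<Rightarrow> 'a" where
  "bochner_eigenvalue \<rho> v n = coeff \<rho> 2 * of_nat n * (of_nat n - 1) + coeff v 1 * of_nat n"

locale pearson = definite_functional u
  for u :: "complex poly \<Rightarrow> complex" +
  fixes \<rho> v :: "complex poly"
  assumes pearson: "u (\<rho> * pderiv f + v * f) = 0"
    and degree_\<rho>: "degree \<rho> \<le> 2" and degree_v: "degree v \<le> 1"
begin

definition bochner :: "complex poly \<Rightarrow> complex poly" where
  "bochner f = \<rho> * pderiv (pderiv f) + v * pderiv f"

lemma integration_by_parts: "u (\<rho> * pderiv f * g) = - u (f * (v * g + \<rho> * pderiv g))"
proof -
  have "u (\<rho> * pderiv f * g) + u (f * (v * g + \<rho> * pderiv g)) = u (\<rho> * pderiv (f * g) + v * (f * g))"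
    by (simp add: add[symmetric] pderiv_mult algebra_simps)
  then show ?thesis using pearson by (simp add: eq_neg_iff_add_eq_0)
qed

lemma bochner_symmetric: "u (bochner f * g) = u (f * bochner g)"
proof -
  have "u (bochner f * g) = - u (\<rho> * pderiv f * pderiv g)" for f g
  proof -
    have "u (bochner f * g) = u (\<rho> * pderiv (pderiv f) * g) + u (pderiv f * (v * g))"
      by (simp add: bochner_def add[symmetric] algebra_simps)
    also have "\<dots> = - u (pderiv f * (\<rho> * pderiv g))"
      by (simp add: integration_by_parts distrib_left add)
    finally show ?thesis by (simp add: mult_ac)
  qed
  from this[of f g] this[of g f] show ?thesis by (simp add: mult_ac)
qed

lemma diffop_bochner: "diffop bochner"
  unfolding bochner_def[abs_def]
  by (intro diffop_add diffop_mult diffop_pderiv diffop_times[of 1, simplified])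

lemma coeff_bochner:
  assumes "f \<in> poly_below (Suc n)"
  shows "coeff (bochner f) n = bochner_eigenvalue \<rho> v n * coeff f n"
proof -
  have \<rho>: "\<rho> = [:coeff \<rho> 0, coeff \<rho> 1, coeff \<rho> 2:]"
    by (rule poly_eqI)
      (use degree_\<rho> in \<open>auto simp: coeff_pCons coeff_eq_0 numeral_2_eq_2 split: nat.split\<close>)
  have v: "v = [:coeff v 0, coeff v 1:]"
    by (rule poly_eqI) (use degree_v in \<open>auto simp: coeff_pCons coeff_eq_0 split: nat.split\<close>)
  have top: "coeff f (Suc n) = 0" "coeff f (Suc (Suc n)) = 0"
    using assms by (auto simp: poly_below_def)
  show ?thesis
  proof (cases n)
    case 0
    show ?thesis
      unfolding bochner_def bochner_eigenvalue_def
      by (subst \<rho>, subst v) (use top 0 in \<open>simp add: coeff_pderiv\<close>)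
  next
    case (Suc m)
    show ?thesis
      unfolding bochner_def bochner_eigenvalue_def
      by (subst \<rho>, subst v)
        (use top Suc in \<open>cases m; simp add: coeff_pderiv algebra_simps numeral_2_eq_2\<close>)
  qed
qed

lemma bochner_in_poly_below:
  assumes "f \<in> poly_below n"
  shows "bochner f \<in> poly_below n"
proof -
  have "coeff (bochner f) i = 0" if "n \<le> i" for i
  proof -
    have "f \<in> poly_below (Suc i)" using poly_below_mono[of n "Suc i"] that assms by auto
    moreover have "coeff f i = 0" using assms that by (auto simp: poly_below_def)
    ultimately show ?thesis using coeff_bochner by simp
  qed
  then show ?thesis by (simp add: poly_below_def)
qed

lemma adjointable_bochner: "poly_adjointable u bochner"
  using diffop_linear[OF diffop_bochner] bochner_in_poly_below bochner_symmetric
  by (rule flag.adjointable_symmetric)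

lemma diag_coeff_bochner: "diag_coeff bochner n = bochner_eigenvalue \<rho> v n"
  using coeff_bochner[OF monom_in_poly_below[of n "Suc n" 1]] by (simp add: diag_coeff_def)

lemma has_symbol_bochner: "has_symbol bochner 2 \<rho>"
proof -
  have "has_symbol (\<lambda>f. \<rho> * (pderiv ^^ 2) f) 2 \<rho>"
    using has_symbol_mult[OF has_symbol_higher_pderiv, of \<rho> 2] by simp
  moreover have "has_symbol (\<lambda>f. v * pderiv f) 2 0"
    by (rule has_symbol_raise[OF has_symbol_mult[OF has_symbol_pderiv]]) simp
  ultimately show ?thesis
    using has_symbol_add[of "\<lambda>f. \<rho> * (pderiv ^^ 2) f" 2 \<rho> "\<lambda>f. v * pderiv f" 0]
    by (simp add: bochner_def[abs_def] numeral_2_eq_2)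
qed

lemma higher_pderiv_adjoint:
  assumes "j \<le> m"
  shows "\<exists>R. \<forall>f. u (h * (pderiv ^^ j) (\<rho> ^ m * f)) = u (f * R)"
  using assms
proof (induction j arbitrary: m)
  case 0
  then show ?case by (intro exI[of _ "h * \<rho> ^ m"]) (simp add: algebra_simps)
next
  case (Suc j)
  then obtain k where m: "m = Suc k" "j \<le> k" by (cases m) auto
  with Suc.IH obtain R where R: "\<And>f. u (h * (pderiv ^^ j) (\<rho> ^ k * f)) = u (f * R)" by blast
  have "u (h * (pderiv ^^ Suc j) (\<rho> ^ m * f)) =
    u (f * (smult (of_nat m) (pderiv \<rho>) * R - (v * R + \<rho> * pderiv R)))" for f
  proof -
    have "pderiv (\<rho> ^ m * f) = \<rho> ^ k * (smult (of_nat m) (pderiv \<rho>) * f + \<rho> * pderiv f)"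
      unfolding m pderiv_mult pderiv_power_Suc by (simp add: algebra_simps)
    then have "u (h * (pderiv ^^ Suc j) (\<rho> ^ m * f)) =
        u (smult (of_nat m) (pderiv \<rho>) * f * R) + u (\<rho> * pderiv f * R)"
      by (simp add: funpow_swap1 R distrib_right add)
    then show ?thesis
      using integration_by_parts[of f R] by (simp add: right_diff_distrib diff mult_ac)
  qed
  then show ?case by blast
qed

lemma diffop_adjoint:
  assumes "diffop L"
  obtains m where "\<And>g. \<exists>R. \<forall>f. u (L (\<rho> ^ m * f) * g) = u (f * R)"
proof -
  obtain k b where L: "\<And>f. L f = (\<Sum>j<k. b j * (pderiv ^^ j) f)"
    using diffopE[OF assms] by blast
  have "\<exists>R. \<forall>f. u (L (\<rho> ^ k * f) * g) = u (f * R)" for g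
  proof -
    have "\<exists>R. \<forall>f. u (g * b j * (pderiv ^^ j) (\<rho> ^ k * f)) = u (f * R)" if "j < k" for j
      using that by (intro higher_pderiv_adjoint) simp
    then obtain R where R: "\<And>j f. j < k \<Longrightarrow> u (g * b j * (pderiv ^^ j) (\<rho> ^ k * f)) = u (f * R j)"
      by metis
    have "u (L (\<rho> ^ k * f) * g) = u (f * (\<Sum>j<k. R j))" for f
      unfolding L sum_distrib_left sum_distrib_right sum
      by (intro sum.cong) (auto simp: R[symmetric] mult_ac)
    then show ?thesis by blast
  qed
  then show ?thesis by (rule that)
qed

end

definition wronskian :: "'a::idom poly \<Rightarrow> 'a poly \<Rightarrow> 'a poly" where
  "wronskian R S = R * pderiv S - S * pderiv R"

lemma pearson_proportional:
  assumes "pearson u \<rho> v" "pearson u' \<rho> v'" and eq: "\<And>f. u (f * R) = u' (f * S)"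
  shows "\<rho> * wronskian R S = R * S * (v - v')"
proof -
  interpret u: pearson u \<rho> v by fact
  interpret u': pearson u' \<rho> v' by fact
  let ?R = "v * R + \<rho> * pderiv R" and ?S = "v' * S + \<rho> * pderiv S"
  have parts: "u (f * ?R) = u' (f * ?S)" for f
    using eq[of "\<rho> * pderiv f"] by (simp add: u.integration_by_parts u'.integration_by_parts)
  have "u (f * (R * ?S - S * ?R)) = 0" for f
  proof -
    have "u (f * (R * ?S - S * ?R)) = u (f * ?S * R) - u (f * S * ?R)"
      by (simp add: right_diff_distrib u.diff mult_ac)
    then show ?thesis using eq[of "f * ?S"] parts[of "f * S"] by (simp add: mult_ac)
  qed
  then have "R * ?S - S * ?R = 0" by (rule u.eq_0_if_annihilates)
  then show ?thesis by (simp add: wronskian_def algebra_simps)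
qed

lemma wronskian_eq_smult_imp_0:
  fixes R S :: "'a::field_char_0 poly"
  assumes "wronskian R S = smult c (R * S)" "R \<noteq> 0" "S \<noteq> 0"
  shows "c = 0"
proof -
  have "coeff (P * pderiv Q) (degree P + degree Q) = 0" for P Q :: "'a poly"
  proof (cases "degree Q = 0")
    case True
    then have "pderiv Q = 0" by (simp add: pderiv_eq_0_iff)
    then show ?thesis by simp
  next
    case False
    have "degree (P * pderiv Q) \<le> degree P + (degree Q - 1)"
      using degree_mult_le[of P "pderiv Q"] by (simp add: degree_pderiv)
    with False show ?thesis by (intro coeff_eq_0) simp
  qed
  from this[of R S] this[of S R] have "coeff (wronskian R S) (degree R + degree S) = 0"
    by (simp add: wronskian_def add.commute)
  then have "c * (lead_coeff R * lead_coeff S) = 0"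
    unfolding assms(1) by (simp add: coeff_mult_degree_sum)
  with assms show ?thesis by simp
qed

lemma linear_mult_wronskian_powers:
  fixes R S :: "'a::field_char_0 poly"
  shows "[:- t, 1:] * wronskian ([:- t, 1:] ^ a * R) ([:- t, 1:] ^ b * S) =
    [:- t, 1:] ^ (a + b) * (smult (of_nat b - of_nat a) (R * S) + [:- t, 1:] * wronskian R S)"
proof -
  let ?x = "[:- t, 1:]"
  have euler: "?x * pderiv (?x ^ n * F) = ?x ^ n * (smult (of_nat n) F + ?x * pderiv F)" for n F
  proof (cases n)
    case (Suc m)
    then show ?thesis
      unfolding Suc pderiv_linear_power_mult
      by (simp add: algebra_simps del: mult_pCons_left mult_pCons_right of_nat_Suc)
  qed simp
  have "?x * wronskian (?x ^ a * R) (?x ^ b * S) =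
      ?x ^ a * R * (?x * pderiv (?x ^ b * S)) - ?x ^ b * S * (?x * pderiv (?x ^ a * R))"
    by (simp add: wronskian_def algebra_simps del: mult_pCons_left mult_pCons_right)
  then show ?thesis
    unfolding euler
    by (simp add: wronskian_def power_add algebra_simps smult_diff_left
        del: mult_pCons_left mult_pCons_right)
qed

lemma log_derivative_residue:
  fixes R S :: "'a::field_char_0 poly"
  assumes eq: "[:- t, 1:] * \<sigma> * wronskian R S = R * S * \<tau>" and nz: "R \<noteq> 0" "S \<noteq> 0"
  shows "poly \<tau> t = poly \<sigma> t * (of_nat (Polynomial.order t S) - of_nat (Polynomial.order t R))"
proof -
  let ?x = "[:- t, 1:]"
  define a b where "a = Polynomial.order t R" and "b = Polynomial.order t S"
  obtain R\<^sub>1 where R: "R = ?x ^ a * R\<^sub>1" "\<not> ?x dvd R\<^sub>1"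
    using order_decomp[OF nz(1)] unfolding a_def by blast
  obtain S\<^sub>1 where S: "S = ?x ^ b * S\<^sub>1" "\<not> ?x dvd S\<^sub>1"
    using order_decomp[OF nz(2)] unfolding b_def by blast
  have "?x ^ (a + b) * (\<sigma> * (smult (of_nat b - of_nat a) (R\<^sub>1 * S\<^sub>1) + ?x * wronskian R\<^sub>1 S\<^sub>1)) =
      \<sigma> * (?x * wronskian R S)"
    unfolding R(1) S(1) linear_mult_wronskian_powers
    by (simp only: mult.left_commute)
  also have "\<dots> = ?x ^ (a + b) * (R\<^sub>1 * S\<^sub>1 * \<tau>)"
    using eq by (simp add: R(1) S(1) power_add mult_ac del: mult_pCons_left mult_pCons_right)
  finally have "\<sigma> * (smult (of_nat b - of_nat a) (R\<^sub>1 * S\<^sub>1) + ?x * wronskian R\<^sub>1 S\<^sub>1) = R\<^sub>1 * S\<^sub>1 * \<tau>"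
    by (simp del: mult_pCons_left mult_pCons_right)
  from arg_cong[OF this, of "\<lambda>p. poly p t"]
  have "poly R\<^sub>1 t * poly S\<^sub>1 t * (poly \<sigma> t * (of_nat b - of_nat a)) =
      poly R\<^sub>1 t * poly S\<^sub>1 t * poly \<tau> t"
    by (simp add: algebra_simps)
  moreover have "poly R\<^sub>1 t \<noteq> 0" "poly S\<^sub>1 t \<noteq> 0"
    using R(2) S(2) by (simp_all add: poly_eq_0_iff_dvd)
  ultimately show ?thesis by (simp add: a_def b_def)
qed

section \<open>Eigenvalues of operators commuting with Bochner's operator\<close>

lemma poly_reflection_decomp:
  fixes P :: "'a::field_char_0 poly" and r c :: 'a
  assumes "r \<noteq> 0"
  obtains Q\<^sub>1 Q\<^sub>2 where
    "\<And>x. poly P x = poly Q\<^sub>1 (r * x * (x + c)) + (2 * x + c) * poly Q\<^sub>2 (r * x * (x + c))"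
proof -
  let ?y = "\<lambda>x. r * x * (x + c)"
  have "\<exists>Q\<^sub>1 Q\<^sub>2. \<forall>x. poly P x = poly Q\<^sub>1 (?y x) + (2 * x + c) * poly Q\<^sub>2 (?y x)"
  proof (induction P)
    case 0
    then show ?case by (intro exI[of _ 0]) simp
  next
    case (pCons a P)
    then obtain Q\<^sub>1 Q\<^sub>2 where Q: "\<And>x. poly P x = poly Q\<^sub>1 (?y x) + (2 * x + c) * poly Q\<^sub>2 (?y x)"
      by blast
    define R\<^sub>1 where "R\<^sub>1 = [:a:] - smult (c / 2) Q\<^sub>1 + smult (1 / 2) ([:c\<^sup>2, 4 / r:] * Q\<^sub>2)"
    define R\<^sub>2 where "R\<^sub>2 = smult (1 / 2) Q\<^sub>1 - smult (c / 2) Q\<^sub>2"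
    have "a + x * (q\<^sub>1 + (2 * x + c) * q\<^sub>2) = a - c / 2 * q\<^sub>1 + 1 / 2 * ((c\<^sup>2 + 4 / r * ?y x) * q\<^sub>2)
        + (2 * x + c) * (1 / 2 * q\<^sub>1 - c / 2 * q\<^sub>2)" for x q\<^sub>1 q\<^sub>2
      using assms by (simp add: field_simps power2_eq_square)
    then have "poly (pCons a P) x = poly R\<^sub>1 (?y x) + (2 * x + c) * poly R\<^sub>2 (?y x)" for x
      unfolding poly_pCons Q
      by (simp only: R\<^sub>1_def R\<^sub>2_def poly_add poly_diff poly_smult poly_mult poly_pCons poly_0)
        (simp add: mult_ac)
    then show ?case by blast
  qed
  then show ?thesis using that by blast
qed

context pearson
begin

lemma coeff_v_neq_0:
  assumes "\<rho> \<noteq> 0" "coeff \<rho> 2 = 0"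
  shows "coeff v 1 \<noteq> 0"
proof
  assume "coeff v 1 = 0"
  then have bochner_0: "bochner f = 0" for f
    using assms(2) by (intro adjointable_eq_0[OF adjointable_bochner])
        (simp add: diag_coeff_bochner bochner_eigenvalue_def)
  have "v = 0" using bochner_0[of "[:0, 1:]"] by (simp add: bochner_def pderiv_pCons)
  moreover have "smult 2 \<rho> + v * [:0, 2:] = 0"
    using bochner_0[of "[:0, 0, 1:]"] by (simp add: bochner_def pderiv_pCons)
  ultimately show False using assms(1) by simp
qed

lemma odd_diag_coeff_eq_0:
  assumes C: "diffop C" "poly_adjointable u C"
    and diag: "\<And>n. diag_coeff C n = (2 * of_nat n + c) * poly Q (diag_coeff bochner n)"
    and discriminant: "\<And>n. (2 * of_nat n + c)\<^sup>2 = poly [:e, d:] (diag_coeff bochner n)"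
    and "d \<noteq> 0" and t: "odd (Polynomial.order t \<rho>)" "\<rho> \<noteq> 0"
  shows "Q = 0"
proof (rule ccontr)
  assume "Q \<noteq> 0"
  define G where "G = [:e, d:] * Q\<^sup>2"
  have "degree G = 2 * degree Q + 1"
    using \<open>Q \<noteq> 0\<close> \<open>d \<noteq> 0\<close>
    by (simp add: G_def degree_mult_eq degree_power_eq del: mult_pCons_left)
  then have "odd (degree G)" by simp
  then have "(\<lambda>f. C (C f)) \<noteq> poly_op smult G bochner"
    by (intro no_diffop_square_root[OF C(1) has_symbol_bochner _ _ t(2,1)]
        diffop_linear diffop_bochner) simp_all
  moreover have "(\<lambda>f. C (C f)) = poly_op smult G bochner"
  proof (rule adjointable_eqI)
    show "poly_adjointable u (\<lambda>f. C (C f))" by (rule flag.adjointable_comp[OF C(2) C(2)])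
    show "poly_adjointable u (poly_op smult G bochner)"
      by (rule flag.adjointable_poly_op[OF adjointable_bochner])
    show "diag_coeff (\<lambda>f. C (C f)) n = diag_coeff (poly_op smult G bochner) n" for n
    proof -
      let ?y = "diag_coeff bochner n"
      have "diag_coeff (\<lambda>f. C (C f)) n = (2 * of_nat n + c)\<^sup>2 * (poly Q ?y)\<^sup>2"
        unfolding diag_coeff_comp[OF C(2) C(2)] diag by (simp add: power2_eq_square mult_ac)
      also have "\<dots> = poly G ?y" unfolding discriminant G_def by (simp add: algebra_simps)
      finally show ?thesis by (simp add: diag_coeff_poly_op[OF adjointable_bochner])
    qed
  qed
  ultimately show False by contradiction
qed

text \<open>
  The reflection \<open>n \<mapsto> - n - c\<close> fixes the eigenvalues of \<open>bochner\<close>; the part of the eigenvalues of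
  \<open>L\<close> that is odd under it belongs to an operator whose square is a polynomial of odd degree in
  \<open>bochner\<close>.
\<close>

lemma diag_coeff_eq_poly_bochner_quadratic:
  assumes L: "diffop L" "poly_adjointable u L" and "coeff \<rho> 2 \<noteq> 0" and t: "odd (Polynomial.order t \<rho>)"
  obtains Q where "\<And>n. diag_coeff L n = poly Q (diag_coeff bochner n)"
proof -
  define r c where "r = coeff \<rho> 2" and "c = coeff v 1 / r - 1"
  have "r \<noteq> 0" using assms(3) by (simp add: r_def)
  have "\<rho> \<noteq> 0" using assms(3) by auto
  have diag: "diag_coeff bochner n = r * of_nat n * (of_nat n + c)" for n
    using \<open>r \<noteq> 0\<close> unfolding diag_coeff_bochner bochner_eigenvalue_def r_def[symmetric] c_def
    by (simp add: field_simps)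
  obtain P where P: "\<And>n. diag_coeff L n = poly P (of_nat n)"
    using diffop_diag_coeff[OF L(1)] by blast
  obtain Q\<^sub>1 Q\<^sub>2 where
    Q: "\<And>x. poly P x = poly Q\<^sub>1 (r * x * (x + c)) + (2 * x + c) * poly Q\<^sub>2 (r * x * (x + c))"
    using poly_reflection_decomp[OF \<open>r \<noteq> 0\<close>] by blast
  define C where "C = (\<lambda>f. L f + smult (- 1) (poly_op smult Q\<^sub>1 bochner f))"
  have "Q\<^sub>2 = 0"
  proof (rule odd_diag_coeff_eq_0[where C = C and c = c and e = "c\<^sup>2" and d = "4 / r"])
    show "diffop C"
      unfolding C_def by (intro diffop_add diffop_smult diffop_poly_op diffop_bochner L)
    show "poly_adjointable u C"
      unfolding C_def
      by (intro flag.adjointable_add flag.adjointable_scale flag.adjointable_poly_op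
          adjointable_bochner L)
    have "diag_coeff C n = diag_coeff L n - diag_coeff (poly_op smult Q\<^sub>1 bochner) n" for n
      by (simp add: C_def diag_coeff_def)
    then show "diag_coeff C n = (2 * of_nat n + c) * poly Q\<^sub>2 (diag_coeff bochner n)" for n
      by (simp add: diag_coeff_poly_op[OF adjointable_bochner] P Q diag)
    show "(2 * of_nat n + c)\<^sup>2 = poly [:c\<^sup>2, 4 / r:] (diag_coeff bochner n)" for n
      using \<open>r \<noteq> 0\<close> by (simp add: diag power2_eq_square field_simps)
  qed (use \<open>r \<noteq> 0\<close> \<open>\<rho> \<noteq> 0\<close> t in auto)
  then show ?thesis using that[of Q\<^sub>1] by (simp add: P Q diag)
qed

lemma diag_coeff_eq_poly_bochner:
  assumes L: "diffop L" "poly_adjointable u L" and \<rho>: "rsquarefree \<rho>"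
  obtains Q where "\<And>n. diag_coeff L n = poly Q (diag_coeff bochner n)"
proof (cases "coeff \<rho> 2 = 0")
  case True
  have "\<rho> \<noteq> 0" using \<rho> by (simp add: rsquarefree_def)
  then have v: "coeff v 1 \<noteq> 0" using True by (rule coeff_v_neq_0)
  obtain P where P: "\<And>n. diag_coeff L n = poly P (of_nat n)"
    using diffop_diag_coeff[OF L(1)] by blast
  show ?thesis
    using that[of "P \<circ>\<^sub>p [:0, 1 / coeff v 1:]"] v True
    by (simp add: P poly_pcompose diag_coeff_bochner bochner_eigenvalue_def)
next
  case False
  then have "degree \<rho> > 0" by (metis coeff_eq_0 gr0I zero_less_numeral)
  then obtain t where "poly \<rho> t = 0"
    using alg_closed_imp_poly_has_root by blast
  then have "Polynomial.order t \<rho> = 1"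
    using \<rho> unfolding rsquarefree_def by (metis order_root)
  then show ?thesis
    using diag_coeff_eq_poly_bochner_quadratic[OF L False, of t] that by auto
qed

end

section \<open>Rows of polynomials\<close>

type_synonym poly_row = "nat \<Rightarrow> complex poly"

definition row_smult :: "complex \<Rightarrow> poly_row \<Rightarrow> poly_row" (infixr "\<cdot>\<^sub>r" 75) where
  "c \<cdot>\<^sub>r p = (\<lambda>k. smult c (p k))"

definition cnj_row :: "poly_row \<Rightarrow> poly_row" where
  "cnj_row p = (\<lambda>k. cnj_poly (p k))"

definition unit_row :: "nat \<Rightarrow> complex poly \<Rightarrow> poly_row" where
  "unit_row i f = (\<lambda>k. if k = i then f else 0)"

definition supported_rows :: "(nat \<times> nat) set \<Rightarrow> poly_row set" where
  "supported_rows I = {p. \<forall>k m. coeff (p k) m \<noteq> 0 \<longrightarrow> (k, m) \<in> I}"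

abbreviation rows_below :: "nat \<Rightarrow> nat \<Rightarrow> poly_row set" where
  "rows_below N n \<equiv> supported_rows ({..<N} \<times> {..<n})"

lemma row_smult_apply [simp]: "(c \<cdot>\<^sub>r p) k = smult c (p k)"
  by (simp add: row_smult_def)

lemma cnj_row_apply [simp]: "cnj_row p k = cnj_poly (p k)"
  by (simp add: cnj_row_def)

lemma sum_fun_apply [simp]: "(\<Sum>i\<in>I. f i) x = (\<Sum>i\<in>I. f i x)"
  by (induction I rule: infinite_finite_induct) simp_all

interpretation row_module: Modules.module row_smult
  by unfold_locales (simp_all add: fun_eq_iff smult_add_right smult_add_left)

abbreviation row_linear :: "(poly_row \<Rightarrow> poly_row) \<Rightarrow> bool" where
  "row_linear \<equiv> module_hom row_smult row_smult"

abbreviation row_functional :: "(poly_row \<Rightarrow> complex) \<Rightarrow> bool" where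
  "row_functional \<equiv> module_hom row_smult (*)"

lemma cnj_row_cnj_row [simp]: "cnj_row (cnj_row p) = p"
  by (simp add: fun_eq_iff)

lemma cnj_row_0 [simp]: "cnj_row 0 = 0"
  and cnj_row_add: "cnj_row (p + q) = cnj_row p + cnj_row q"
  and cnj_row_diff: "cnj_row (p - q) = cnj_row p - cnj_row q"
  and cnj_row_smult: "cnj_row (c \<cdot>\<^sub>r p) = cnj c \<cdot>\<^sub>r cnj_row p"
  and cnj_row_unit_monom [simp]: "cnj_row (unit_row i (monom 1 n)) = unit_row i (monom 1 n)"
  by (simp_all add: fun_eq_iff poly_eq_iff unit_row_def)

lemma subspace_supported_rows: "row_module.subspace (supported_rows I)"
  by (rule row_module.subspaceI) (auto simp: supported_rows_def, metis add.right_neutral)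

lemmas zero_in_supported_rows [simp] = row_module.subspace_0[OF subspace_supported_rows]
  and supported_rows_add = row_module.subspace_add[OF subspace_supported_rows]
  and supported_rows_diff = row_module.subspace_diff[OF subspace_supported_rows]
  and supported_rows_smult = row_module.subspace_scale[OF subspace_supported_rows]
  and supported_rows_sum = row_module.subspace_sum[OF subspace_supported_rows]

lemma supported_rows_mono: "I \<subseteq> J \<Longrightarrow> supported_rows I \<subseteq> supported_rows J"
  by (auto simp: supported_rows_def)

lemma cnj_row_in_supported_rows [simp]: "cnj_row p \<in> supported_rows I \<longleftrightarrow> p \<in> supported_rows I"
  by (simp add: supported_rows_def)

lemma unit_monom_in_supported_rows: "(i, n) \<in> I \<Longrightarrow> unit_row i (monom 1 n) \<in> supported_rows I"
  by (auto simp: supported_rows_def unit_row_def split: if_splits)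

lemma supported_rows_insertD:
  "p \<in> supported_rows (insert (i, m) I) \<Longrightarrow>
    p - coeff (p i) m \<cdot>\<^sub>r unit_row i (monom 1 m) \<in> supported_rows I"
  by (auto simp: supported_rows_def unit_row_def split: if_splits)

lemma in_rows_below_iff: "p \<in> rows_below N n \<longleftrightarrow> (\<forall>k<N. p k \<in> poly_below n) \<and> (\<forall>k\<ge>N. p k = 0)"
  by (auto simp: supported_rows_def poly_below_def poly_eq_iff) (metis not_le)+

lemma rows_below_0 [simp]: "rows_below N 0 = {0}"
  by (auto simp: supported_rows_def poly_eq_iff fun_eq_iff)

lemma rows_below_mono: "m \<le> n \<Longrightarrow> rows_below N m \<subseteq> rows_below N n"
  by (intro supported_rows_mono) auto

lemma unit_row_in_rows_below: "i < N \<Longrightarrow> f \<in> poly_below n \<Longrightarrow> unit_row i f \<in> rows_below N n"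
  by (auto simp: in_rows_below_iff unit_row_def)

lemma rows_below_outside: "p \<in> rows_below N n \<Longrightarrow> N \<le> k \<Longrightarrow> p k = 0"
  by (simp add: in_rows_below_iff)

lemma ex_rows_below:
  assumes "\<And>k. N \<le> k \<Longrightarrow> p k = 0"
  shows "\<exists>n. p \<in> rows_below N n"
proof -
  define n where "n k = Suc (degree (p k))" for k
  have n: "p k \<in> poly_below (n k)" for k by (simp add: n_def poly_below_Suc_iff)
  have "p k \<in> poly_below (Max (n ` {..<N}))" if "k < N" for k
    using poly_below_mono[of "n k" "Max (n ` {..<N})"] n[of k] that by auto
  with assms show ?thesis by (auto simp: in_rows_below_iff)
qed

lemma row_eq_sum_unit_row:
  assumes "\<And>k. N \<le> k \<Longrightarrow> p k = 0"
  shows "p = (\<Sum>i<N. unit_row i (p i))"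
  using assms by (auto simp: fun_eq_iff unit_row_def)

definition row_of :: "pmat \<Rightarrow> nat \<Rightarrow> poly_row" where
  "row_of P i = (\<lambda>k. if k < dim_col P then P $$ (i, k) else 0)"

lemma row_of_apply: "P \<in> carrier_mat n m \<Longrightarrow> row_of P i k = (if k < m then P $$ (i, k) else 0)"
  by (auto simp: row_of_def)

lemma eq_mat_rowsI:
  assumes "P \<in> carrier_mat n m" "Q \<in> carrier_mat n m" and "\<And>i. i < n \<Longrightarrow> row_of P i = row_of Q i"
  shows "P = Q"
proof (rule eq_matI)
  fix i j assume "i < dim_row Q" "j < dim_col Q"
  then show "P $$ (i, j) = Q $$ (i, j)"
    using fun_cong[OF assms(3)[of i], of j] assms(1,2) by (simp add: row_of_apply)
qed (use assms in auto)

lemma row_of_add: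
  assumes "P \<in> carrier_mat n m" "Q \<in> carrier_mat n m" "i < n"
  shows "row_of (P + Q) i = row_of P i + row_of Q i"
  using assms by (auto simp: row_of_def fun_eq_iff)

lemma row_of_const_pmat_mult:
  assumes "\<Lambda> \<in> carrier_mat n m" "P \<in> carrier_mat m l" "i < n"
  shows "row_of (const_pmat \<Lambda> * P) i = (\<Sum>j<m. \<Lambda> $$ (i, j) \<cdot>\<^sub>r row_of P j)"
  using assms by (auto simp: row_of_def fun_eq_iff const_pmat_def scalar_prod_def atLeast0LessThan)

lemma foldr_add_mat_carrier:
  assumes "\<And>j. j \<in> set js \<Longrightarrow> F j \<in> carrier_mat n m"
  shows "foldr (\<lambda>j acc. F j + acc) js (0\<^sub>m n m) \<in> carrier_mat n m"
  using assms by (induction js) auto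

lemma row_of_foldr_add:
  assumes "\<And>j. j < l \<Longrightarrow> F j \<in> carrier_mat n m" "i < n"
  shows "row_of (foldr (\<lambda>j acc. F j + acc) [0..<l] (0\<^sub>m n m)) i = (\<Sum>j<l. row_of (F j) i)"
proof -
  have "row_of (foldr (\<lambda>j acc. F j + acc) js (0\<^sub>m n m)) i = (\<Sum>j\<leftarrow>js. row_of (F j) i)"
    if "set js \<subseteq> {..<l}" for js
    using that
  proof (induction js)
    case Nil
    show ?case using assms(2) by (auto simp: row_of_def)
  next
    case (Cons j js)
    then have "row_of (F j + foldr (\<lambda>j acc. F j + acc) js (0\<^sub>m n m)) i =
        row_of (F j) i + row_of (foldr (\<lambda>j acc. F j + acc) js (0\<^sub>m n m)) i"
      using assms by (intro row_of_add[where n = n and m = m] foldr_add_mat_carrier) auto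
    with Cons show ?case by simp
  qed
  from this[of "[0..<l]"] show ?thesis
    by (simp add: interv_sum_list_conv_sum_set_nat atLeast0LessThan)
qed

section \<open>The row action of a matrix differential operator\<close>

definition row_act :: "nat \<Rightarrow> (nat \<Rightarrow> nat \<Rightarrow> complex poly \<Rightarrow> complex poly) \<Rightarrow> poly_row \<Rightarrow> poly_row" where
  "row_act N E p = (\<lambda>j. if j < N then \<Sum>i<N. E i j (p i) else 0)"

definition dop_entry :: "dop \<Rightarrow> nat \<Rightarrow> nat \<Rightarrow> complex poly \<Rightarrow> complex poly" where
  "dop_entry D i j f = (\<Sum>l<length D. (D ! l) $$ (i, j) * (pderiv ^^ l) f)"

abbreviation dop_row_act :: "nat \<Rightarrow> dop \<Rightarrow> poly_row \<Rightarrow> poly_row" where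
  "dop_row_act N D \<equiv> row_act N (dop_entry D)"

lemma diffop_dop_entry: "diffop (dop_entry D i j)"
  by (rule diffopI) (rule dop_entry_def)

lemma row_act_linear:
  assumes "\<And>i j. i < N \<Longrightarrow> j < N \<Longrightarrow> poly_linear (E i j)"
  shows "row_linear (row_act N E)"
proof -
  have "row_act N E (p + q) = row_act N E p + row_act N E q" for p q
    by (rule ext) (simp add: row_act_def module_hom.add[OF assms] sum.distrib)
  moreover have "row_act N E (c \<cdot>\<^sub>r p) = c \<cdot>\<^sub>r row_act N E p" for c p
    by (rule ext) (simp add: row_act_def module_hom.scale[OF assms] smult_sum2)
  ultimately show ?thesis by (simp add: module_hom_iff row_module.module_axioms)
qed

lemma dop_row_act_linear: "row_linear (dop_row_act N D)"
  by (intro row_act_linear diffop_linear diffop_dop_entry)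

context
  fixes N :: nat and D :: dop
  assumes wf: "wf_dop N D"
begin

lemma dop_act_carrier:
  assumes "P \<in> carrier_mat N N"
  shows "dop_act D P \<in> carrier_mat N N"
proof -
  have "pderiv_mat l P * D ! l \<in> carrier_mat N N" if "l < length D" for l
    using wf assms that by (intro mult_carrier_mat[where n = N]) (auto simp: wf_dop_def pderiv_mat_def)
  then show ?thesis
    unfolding dop_act_def using assms by (simp only: carrier_matD) (intro foldr_add_mat_carrier, simp)
qed

lemma row_of_dop_act:
  assumes P: "P \<in> carrier_mat N N" and i: "i < N"
  shows "row_of (dop_act D P) i = dop_row_act N D (row_of P i)"
proof -
  have D: "D ! l \<in> carrier_mat N N" if "l < length D" for l
    using wf that by (simp add: wf_dop_def)
  have "row_of (dop_act D P) i = (\<Sum>l<length D. row_of (pderiv_mat l P * D ! l) i)"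
    unfolding dop_act_def carrier_matD[OF P] using P i
    by (intro row_of_foldr_add mult_carrier_mat[where n = N] D) (auto simp: pderiv_mat_def)
  also have "\<dots> = dop_row_act N D (row_of P i)"
  proof
    fix k
    have "row_of (pderiv_mat l P * D ! l) i k =
        (if k < N then \<Sum>r<N. (D ! l) $$ (r, k) * (pderiv ^^ l) (row_of P i r) else 0)"
      if "l < length D" for l
      using D[OF that] P i
      by (auto simp: row_of_def pderiv_mat_def scalar_prod_def atLeast0LessThan mult.commute)
    then show "(\<Sum>l<length D. row_of (pderiv_mat l P * D ! l) i) k = dop_row_act N D (row_of P i) k"
      by (auto simp: row_act_def dop_entry_def intro: sum.swap)
  qed
  finally show ?thesis .
qed

lemma funpow_dop_act:
  assumes "P \<in> carrier_mat N N"
  shows "(dop_act D ^^ m) P \<in> carrier_mat N N"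
    and "i < N \<Longrightarrow> row_of ((dop_act D ^^ m) P) i = (dop_row_act N D ^^ m) (row_of P i)"
proof -
  show carrier: "(dop_act D ^^ m) P \<in> carrier_mat N N" for m
    by (induction m) (simp_all add: assms dop_act_carrier)
  show "row_of ((dop_act D ^^ m) P) i = (dop_row_act N D ^^ m) (row_of P i)" if "i < N"
    by (induction m) (simp_all add: row_of_dop_act carrier that)
qed

lemma poly_dop_act_carrier:
  "P \<in> carrier_mat N N \<Longrightarrow> poly_dop_act Q D P \<in> carrier_mat N N"
  unfolding poly_dop_act_def
  by (simp only: carrier_matD) (intro foldr_add_mat_carrier smult_carrier_mat funpow_dop_act)

lemma row_of_poly_dop_act:
  assumes P: "P \<in> carrier_mat N N" and i: "i < N"
  shows "row_of (poly_dop_act Q D P) i = poly_op row_smult Q (dop_row_act N D) (row_of P i)"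
proof -
  have smult: "row_of ([:c:] \<cdot>\<^sub>m R) i = c \<cdot>\<^sub>r row_of R i" if "R \<in> carrier_mat N N" for c R
    using that i by (auto simp: row_of_def fun_eq_iff)
  have "row_of (poly_dop_act Q D P) i =
      (\<Sum>k<Suc (degree Q). row_of ([:coeff Q k:] \<cdot>\<^sub>m (dop_act D ^^ k) P) i)"
    unfolding poly_dop_act_def carrier_matD[OF P]
    by (intro row_of_foldr_add smult_carrier_mat funpow_dop_act P i)
  then show ?thesis
    by (simp add: poly_op_def lessThan_Suc_atMost smult funpow_dop_act P i)
qed

end

lemma poly_algebra_iff:
  assumes "wf_dop N D" "N > 0"
  shows "E \<in> poly_algebra N D \<longleftrightarrow> wf_dop N E \<and>
    (\<exists>Q. \<forall>n. \<forall>p\<in>rows_below N n. dop_row_act N E p = poly_op row_smult Q (dop_row_act N D) p)"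
proof (cases "wf_dop N E")
  case wf: True
  have "(\<forall>P\<in>carrier_mat N N. dop_act E P = poly_dop_act Q D P) \<longleftrightarrow>
    (\<forall>n. \<forall>p\<in>rows_below N n. dop_row_act N E p = poly_op row_smult Q (dop_row_act N D) p)" for Q
  proof (intro iffI allI ballI)
    fix n p
    assume eq: "\<forall>P\<in>carrier_mat N N. dop_act E P = poly_dop_act Q D P" and p: "p \<in> rows_below N n"
    define P where "P = mat N N (\<lambda>(i :: nat, k). p k)"
    have P: "P \<in> carrier_mat N N" by (simp add: P_def)
    have row: "row_of P 0 = p"
      using rows_below_outside[OF p] \<open>N > 0\<close> by (auto simp: row_of_def P_def)
    show "dop_row_act N E p = poly_op row_smult Q (dop_row_act N D) p"
      using row_of_dop_act[OF wf P \<open>N > 0\<close>] row_of_poly_dop_act[OF assms(1) P \<open>N > 0\<close>] eq P row by simp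
  next
    fix P :: pmat
    assume eq: "\<forall>n. \<forall>p\<in>rows_below N n. dop_row_act N E p = poly_op row_smult Q (dop_row_act N D) p"
      and P: "P \<in> carrier_mat N N"
    have "\<exists>n. row_of P i \<in> rows_below N n" for i
      using P by (intro ex_rows_below) (simp add: row_of_def)
    then have "row_of (dop_act E P) i = row_of (poly_dop_act Q D P) i" if "i < N" for i
      using eq P that wf assms(1) by (auto simp: row_of_dop_act row_of_poly_dop_act)
    then show "dop_act E P = poly_dop_act Q D P"
      by (rule eq_mat_rowsI[OF dop_act_carrier[OF wf P] poly_dop_act_carrier[OF assms(1) P]])
  qed
  then show ?thesis by (simp add: poly_algebra_def wf)
qed (simp add: poly_algebra_def)

section \<open>Operators with matrix orthogonal eigenpolynomials\<close>

lemma monic_deg_carrier: "monic_deg N n P \<Longrightarrow> P \<in> carrier_mat N N"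
  by (simp add: monic_deg_def)

lemma coeff_monic_deg:
  assumes "monic_deg N n P" "i < N" "k < N"
  shows "coeff (P $$ (i, k)) n = (if i = k then 1 else 0)"
proof -
  have "coeff (P $$ (i, k)) n = coeff_mat P n $$ (i, k)"
    using monic_deg_carrier[OF assms(1)] assms(2,3) by (simp add: coeff_mat_def)
  also have "coeff_mat P n = 1\<^sub>m N" using assms(1) by (simp add: monic_deg_def)
  finally show ?thesis using assms(2,3) by simp
qed

lemma row_of_monic_deg:
  assumes "monic_deg N n P" "i < N"
  shows "row_of P i \<in> rows_below N (Suc n)"
  using assms by (auto simp: in_rows_below_iff row_of_def monic_deg_def poly_below_Suc_iff)

lemma monic_deg_reduce:
  assumes P: "monic_deg N n P" and p: "p \<in> rows_below N (Suc n)"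
  shows "p - (\<Sum>i<N. coeff (p i) n \<cdot>\<^sub>r row_of P i) \<in> rows_below N n"
proof -
  define r where "r = p - (\<Sum>i<N. coeff (p i) n \<cdot>\<^sub>r row_of P i)"
  have r: "r \<in> rows_below N (Suc n)"
    unfolding r_def using p row_of_monic_deg[OF P]
    by (intro supported_rows_diff supported_rows_sum supported_rows_smult) auto
  have "coeff (r k) n = 0" if k: "k < N" for k
  proof -
    have "coeff (row_of P i k) n = (if i = k then 1 else 0)" if "i < N" for i
      using coeff_monic_deg[OF P that k] monic_deg_carrier[OF P] k by (simp add: row_of_apply)
    then have "(\<Sum>i<N. coeff (p i) n * coeff (row_of P i k) n) =
        (\<Sum>i<N. if i = k then coeff (p k) n else 0)"
      by (intro sum.cong) auto
    then show ?thesis using k by (simp add: r_def coeff_sum)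
  qed
  with r have "r \<in> rows_below N n" by (simp add: in_rows_below_iff poly_below_SucD)
  then show ?thesis by (simp only: r_def)
qed

lemma monic_deg_induct [consumes 3, case_names base add row]:
  assumes monic: "\<And>l. monic_deg N l (Ps l)" and p: "p \<in> rows_below N m" and "n \<le> m"
    and base: "\<And>p. p \<in> rows_below N n \<Longrightarrow> X p"
    and add: "\<And>p q. X p \<Longrightarrow> X q \<Longrightarrow> X (p + q)"
    and row: "\<And>l i c. n \<le> l \<Longrightarrow> l < m \<Longrightarrow> i < N \<Longrightarrow> X (c \<cdot>\<^sub>r row_of (Ps l) i)"
  shows "X p"
proof -
  have sum: "X (\<Sum>i\<in>I. f i)" if "\<And>i. i \<in> I \<Longrightarrow> X (f i)" for I :: "nat set" and f
    using that by (induction I rule: infinite_finite_induct) (auto intro: base add)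
  have "p \<in> rows_below N l \<Longrightarrow> l \<le> m \<Longrightarrow> X p" if "n \<le> l" for l
    using that
  proof (induction l arbitrary: p rule: dec_induct)
    case base
    then show ?case using assms(4) by simp
  next
    case (step l)
    let ?s = "\<Sum>i<N. coeff (p i) l \<cdot>\<^sub>r row_of (Ps l) i"
    have "X (p - ?s)"
      by (rule step.IH[OF monic_deg_reduce[OF monic step.prems(1)]]) (use step.prems(2) in simp)
    moreover have "X ?s" using step by (intro sum row) auto
    ultimately have "X ((p - ?s) + ?s)" by (rule add)
    then show ?case by simp
  qed
  with p \<open>n \<le> m\<close> show ?thesis by blast
qed

locale matrix_weight =
  fixes N :: nat and W :: "real \<Rightarrow> complex mat" and S :: "real set"
    and form :: "poly_row \<Rightarrow> poly_row \<Rightarrow> complex"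
  assumes form_linear_left: "row_functional (\<lambda>p. form p q)"
    and form_linear_right: "row_functional (form p)"
    and form_hermitian: "form p q = cnj (form (cnj_row q) (cnj_row p))"
    and form_definite: "p \<in> rows_below N n \<Longrightarrow> form p (cnj_row p) = 0 \<Longrightarrow> p = 0"
    and mip_eq_form: "P \<in> carrier_mat N N \<Longrightarrow> Q \<in> carrier_mat N N \<Longrightarrow>
      mip N W S P Q = mat N N (\<lambda>(i, j). form (row_of P i) (cnj_row (row_of Q j)))"
begin

sublocale row_flag: flagged_module row_smult "rows_below N" form
  by (intro flagged_module.intro flagged_module_axioms.intro row_module.module_axioms
      subspace_supported_rows form_linear_left form_linear_right)

lemmas form_simps =
  module_hom.zero[OF form_linear_left] module_hom.zero[OF form_linear_right]
  module_hom.add[OF form_linear_left] module_hom.add[OF form_linear_right]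
  module_hom.diff[OF form_linear_left] module_hom.diff[OF form_linear_right]
  module_hom.scale[OF form_linear_left] module_hom.scale[OF form_linear_right]
  module_hom.sum[OF form_linear_left] module_hom.sum[OF form_linear_right]

lemma form_unit_row_complement_neq_0:
  fixes i m :: nat
  defines "e \<equiv> unit_row i (monom 1 m)"
  assumes "insert (i, m) I \<subseteq> {..<N} \<times> {..<n}" "(i, m) \<notin> I"
    and t: "t \<in> supported_rows I" "\<And>p. p \<in> supported_rows I \<Longrightarrow> form p (e - t) = 0"
  shows "form e (e - t) \<noteq> 0"
proof -
  have e: "cnj_row e = e" by (simp add: e_def)
  have "e - t \<in> rows_below N n"
    using assms(2) t(1) supported_rows_mono[of I "{..<N} \<times> {..<n}"]
    unfolding e_def by (intro supported_rows_diff unit_monom_in_supported_rows) auto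
  then have "cnj_row (e - t) \<in> rows_below N n" by simp
  moreover have "coeff ((e - t) i) m = 1"
    using t(1) assms(3) by (auto simp: e_def unit_row_def supported_rows_def)
  then have "e - t \<noteq> 0" by (metis coeff_0 zero_fun_apply zero_neq_one)
  then have "cnj_row (e - t) \<noteq> 0" by (metis cnj_row_0 cnj_row_cnj_row)
  ultimately have "form (cnj_row (e - t)) (e - t) \<noteq> 0"
    using form_definite[of "cnj_row (e - t)" n] by (metis cnj_row_cnj_row)
  moreover have "form (cnj_row t) (e - t) = 0" using t by simp
  ultimately show ?thesis
    by (simp only: cnj_row_diff e module_hom.diff[OF form_linear_left] diff_zero) simp
qed

lemma functional_eq_form_insert:
  fixes i m :: nat
  defines "e \<equiv> unit_row i (monom 1 m)"
  assumes "row_functional \<phi>" "p \<in> supported_rows (insert (i, m) I)"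
    and s: "\<And>r. r \<in> supported_rows I \<Longrightarrow> \<phi> r = form r s"
    and d: "\<And>r. r \<in> supported_rows I \<Longrightarrow> form r d = 0" "form e d \<noteq> 0"
  shows "\<phi> p = form p (s + ((\<phi> e - form e s) / form e d) \<cdot>\<^sub>r d)" (is "_ = form p (s + ?c \<cdot>\<^sub>r d)")
proof -
  define a where "a = coeff (p i) m"
  define r where "r = p - a \<cdot>\<^sub>r e"
  have r: "r \<in> supported_rows I" "p = r + a \<cdot>\<^sub>r e"
    using supported_rows_insertD assms(3) by (simp_all add: a_def r_def e_def)
  have "\<phi> p = \<phi> r + a * \<phi> e"
    by (simp only: r(2) module_hom.add[OF assms(2)] module_hom.scale[OF assms(2)])
  also have "\<dots> = form r s + a * form e (s + ?c \<cdot>\<^sub>r d)"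
    using d(2) s[OF r(1)] by (simp add: form_simps)
  also have "\<dots> = form (r + a \<cdot>\<^sub>r e) (s + ?c \<cdot>\<^sub>r d)"
    using d(1)[OF r(1)] by (simp add: form_simps algebra_simps)
  finally show ?thesis using r(2) by simp
qed

lemma riesz_supported_rows:
  assumes "finite I" "I \<subseteq> {..<N} \<times> {..<n}" "row_functional \<phi>"
  shows "\<exists>s\<in>supported_rows I. \<forall>p\<in>supported_rows I. \<phi> p = form p s"
  using assms
proof (induction I arbitrary: \<phi> rule: finite_induct)
  case empty
  show ?case
  proof (intro bexI[of _ 0] ballI)
    fix p assume "p \<in> supported_rows {}"
    then have "p = 0" by (auto simp: supported_rows_def poly_eq_iff fun_eq_iff)
    then show "\<phi> p = form p 0"
      by (simp only: module_hom.zero[OF empty(2)] form_simps)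
  qed simp
next
  case (insert x I)
  obtain i m where x: "x = (i, m)" by (cases x)
  define e where "e = unit_row i (monom 1 m)"
  obtain s where s: "s \<in> supported_rows I" "\<And>p. p \<in> supported_rows I \<Longrightarrow> \<phi> p = form p s"
    using insert by blast
  obtain t where t: "t \<in> supported_rows I" "\<And>p. p \<in> supported_rows I \<Longrightarrow> form p e = form p t"
    using insert.IH[OF _ form_linear_left] insert.prems(1) by blast
  define d where "d = e - t"
  have orth: "form p d = 0" if "p \<in> supported_rows I" for p
    using t(2)[OF that] by (simp add: d_def form_simps)
  then have "form e d \<noteq> 0"
    using form_unit_row_complement_neq_0[of i m I n t] insert.prems(1) insert.hyps(2) t(1)
    by (simp add: x d_def e_def)
  define c where "c = (\<phi> e - form e s) / form e d"
  have "\<phi> p = form p (s + c \<cdot>\<^sub>r d)" if "p \<in> supported_rows (insert x I)" for p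
    unfolding c_def e_def
    by (rule functional_eq_form_insert[OF insert.prems(2) that[unfolded x] s(2) orth
          \<open>form e d \<noteq> 0\<close>[unfolded e_def]])
  moreover have "s + c \<cdot>\<^sub>r d \<in> supported_rows (insert x I)"
    unfolding d_def e_def using s(1) t(1) supported_rows_mono[of I "insert x I"]
    by (intro supported_rows_add supported_rows_smult supported_rows_diff unit_monom_in_supported_rows)
      (auto simp: x)
  ultimately show ?case by blast
qed

lemma ex_monic_OPS: "\<exists>Ps. monic_OPS N W S Ps"
proof -
  have "\<exists>s\<in>rows_below N n. \<forall>p\<in>rows_below N n. form p (unit_row i (monom 1 n)) = form p s" for n i
    by (rule riesz_supported_rows[OF _ _ form_linear_left]) auto
  then obtain s where s: "\<And>n i. s n i \<in> rows_below N n"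
    "\<And>n i p. p \<in> rows_below N n \<Longrightarrow> form p (unit_row i (monom 1 n)) = form p (s n i)"
    by metis
  define R where "R n i = unit_row i (monom 1 n) - cnj_row (s n i)" for n i
  have R_below: "R n i \<in> rows_below N (Suc n)" if "i < N" for n i
    unfolding R_def using s(1)[of n i] rows_below_mono[of n "Suc n" N] that
    by (intro supported_rows_diff unit_monom_in_supported_rows) auto
  have orth: "form p (cnj_row (R n i)) = 0" if "p \<in> rows_below N n" for p n i
    using s(2)[OF that] by (simp add: R_def cnj_row_diff form_simps)
  have orth_R: "form (R n i) (cnj_row (R m j)) = 0" if "n < m" "i < N" for n m i j
    using that(1) by (intro orth subsetD[OF rows_below_mono R_below[OF that(2)]]) simp
  define Ps where "Ps n = mat N N (\<lambda>(i, k). R n i k)" for n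
  have row: "row_of (Ps n) i = R n i" if "i < N" for n i
    using rows_below_outside[OF R_below[OF that]] that by (auto simp: row_of_def Ps_def)
  have "monic_deg N n (Ps n)" for n
  proof -
    have "coeff (R n i k) n = (if i = k then 1 else 0)" for i k
      using s(1)[of n i] by (auto simp: R_def unit_row_def supported_rows_def)
    then show ?thesis
      using R_below[of _ n]
      by (auto simp: monic_deg_def Ps_def coeff_mat_def in_rows_below_iff poly_below_Suc_iff
          intro!: eq_matI)
  qed
  moreover have "mip N W S (Ps n) (Ps m) = 0\<^sub>m N N" if "n \<noteq> m" for n m
  proof -
    have "form (R n i) (cnj_row (R m j)) = 0" if "i < N" "j < N" for i j
      using \<open>n \<noteq> m\<close> orth_R[of n m i j] orth_R[of m n j i]
        form_hermitian[of "R n i" "cnj_row (R m j)"] that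
      by (cases "n < m") auto
    then show ?thesis
      by (subst mip_eq_form) (auto simp: Ps_def row[unfolded Ps_def] intro!: eq_matI)
  qed
  ultimately show ?thesis by (auto simp: monic_OPS_def)
qed

lemma monic_OPS_orthogonal:
  assumes Ps: "monic_OPS N W S Ps" and i: "i < N" and q: "q \<in> rows_below N m"
  shows "form (row_of (Ps m) i) q = 0"
proof -
  have monic: "monic_deg N l (Ps l)" for l using Ps by (simp add: monic_OPS_def)
  note carrier = monic_deg_carrier[OF monic]
  have "cnj_row q \<in> rows_below N m" using q by simp
  from monic this le0 have "form (row_of (Ps m) i) (cnj_row (cnj_row q)) = 0"
  proof (induction rule: monic_deg_induct)
    case (row l j c)
    have "mip N W S (Ps m) (Ps l) $$ (i, j) = 0"
      using Ps row i by (simp add: monic_OPS_def)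
    then have "form (row_of (Ps m) i) (cnj_row (row_of (Ps l) j)) = 0"
      using i row(3) by (simp add: mip_eq_form[OF carrier carrier])
    then show ?case by (simp only: cnj_row_smult form_simps mult_zero_right)
  qed (simp_all only: rows_below_0 singleton_iff cnj_row_0 cnj_row_add form_simps add_0_right)
  then show ?thesis by simp
qed

lemma adjointable_monic_OPS_eigenrow:
  fixes n :: nat
  assumes adj: "row_flag.adjointable (dop_row_act N E)" and Ps: "monic_OPS N W S Ps" and i: "i < N"
  defines "z \<equiv> dop_row_act N E (row_of (Ps n) i)"
  shows "z = (\<Sum>l<N. coeff (z l) n \<cdot>\<^sub>r row_of (Ps n) l)"
proof -
  have monic: "monic_deg N n (Ps n)" using Ps by (simp add: monic_OPS_def)
  define x where "x = z - (\<Sum>l<N. coeff (z l) n \<cdot>\<^sub>r row_of (Ps n) l)"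
  have "z \<in> rows_below N (Suc n)"
    unfolding z_def by (rule row_flag.adjointable_flag[OF adj row_of_monic_deg[OF monic i]])
  then have x: "x \<in> rows_below N n" unfolding x_def by (rule monic_deg_reduce[OF monic])
  then have cnj_x: "cnj_row x \<in> rows_below N n" by simp
  with adj obtain y where y: "y \<in> rows_below N n"
    "\<And>m p. p \<in> rows_below N m \<Longrightarrow> form (dop_row_act N E p) (cnj_row x) = form p y"
    by (rule row_flag.adjointable_adjointE) blast
  have "form z (cnj_row x) = 0"
    unfolding z_def y(2)[OF row_of_monic_deg[OF monic i]] by (rule monic_OPS_orthogonal[OF Ps i y(1)])
  moreover have "form (\<Sum>l<N. coeff (z l) n \<cdot>\<^sub>r row_of (Ps n) l) (cnj_row x) = 0"
    using monic_OPS_orthogonal[OF Ps _ cnj_x] by (simp only: form_simps) simp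
  ultimately have "form x (cnj_row x) = 0" by (simp only: x_def form_simps) simp
  with x have "x = 0" by (rule form_definite)
  then show ?thesis by (simp add: x_def)
qed

lemma adjointable_imp_DW:
  assumes wf: "wf_dop N E" and adj: "row_flag.adjointable (dop_row_act N E)"
  shows "E \<in> DW N W S"
proof -
  have "\<exists>\<Lambda>\<in>carrier_mat N N. dop_act E (Ps n) = const_pmat \<Lambda> * Ps n"
    if Ps: "monic_OPS N W S Ps" for Ps n
  proof -
    have "monic_deg N n (Ps n)" using Ps by (simp add: monic_OPS_def)
    then have carrier: "Ps n \<in> carrier_mat N N" by (rule monic_deg_carrier)
    define \<Lambda> where "\<Lambda> = mat N N (\<lambda>(i, l). coeff (dop_row_act N E (row_of (Ps n) i) l) n)"
    have "dop_act E (Ps n) = const_pmat \<Lambda> * Ps n"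
    proof (rule eq_mat_rowsI[OF dop_act_carrier[OF wf carrier]])
      show "const_pmat \<Lambda> * Ps n \<in> carrier_mat N N" using carrier by (auto simp: \<Lambda>_def const_pmat_def)
      show "row_of (dop_act E (Ps n)) i = row_of (const_pmat \<Lambda> * Ps n) i" if "i < N" for i
        using adjointable_monic_OPS_eigenrow[OF adj Ps that, of n] carrier that
        by (simp add: row_of_dop_act[OF wf] row_of_const_pmat_mult[where n = N and m = N and l = N]
            \<Lambda>_def)
    qed
    then show ?thesis by (intro bexI[of _ \<Lambda>]) (auto simp: \<Lambda>_def)
  qed
  with wf show ?thesis by (simp add: DW_def)
qed

lemma DW_eigenrowsE:
  assumes E: "E \<in> DW N W S"
  obtains Ps \<Lambda> where "monic_OPS N W S Ps"
    "\<And>n i. i < N \<Longrightarrow> dop_row_act N E (row_of (Ps n) i) = (\<Sum>l<N. \<Lambda> n $$ (i, l) \<cdot>\<^sub>r row_of (Ps n) l)"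
proof -
  obtain Ps where Ps: "monic_OPS N W S Ps" using ex_monic_OPS by blast
  have wf: "wf_dop N E" using E by (simp add: DW_def)
  have "\<forall>n. \<exists>\<Lambda>\<in>carrier_mat N N. dop_act E (Ps n) = const_pmat \<Lambda> * Ps n"
    using E Ps by (simp add: DW_def)
  then obtain \<Lambda> where \<Lambda>: "\<And>n. \<Lambda> n \<in> carrier_mat N N" "\<And>n. dop_act E (Ps n) = const_pmat (\<Lambda> n) * Ps n"
    by metis
  have carrier: "Ps n \<in> carrier_mat N N" for n
    using Ps by (auto simp: monic_OPS_def intro: monic_deg_carrier)
  have "dop_row_act N E (row_of (Ps n) i) = (\<Sum>l<N. \<Lambda> n $$ (i, l) \<cdot>\<^sub>r row_of (Ps n) l)" if "i < N" for n i
    using row_of_dop_act[OF wf carrier that] row_of_const_pmat_mult[OF \<Lambda>(1) carrier that]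
    by (simp add: \<Lambda>(2))
  with Ps show ?thesis by (rule that)
qed

lemma DW_row_act_below:
  assumes E: "E \<in> DW N W S" and p: "p \<in> rows_below N n"
  shows "dop_row_act N E p \<in> rows_below N n"
proof -
  note linear = module_hom.add[OF dop_row_act_linear[of N E]]
    module_hom.scale[OF dop_row_act_linear[of N E]] module_hom.zero[OF dop_row_act_linear[of N E]]
  obtain Ps \<Lambda> where Ps: "monic_OPS N W S Ps" and eigen: "\<And>n i. i < N \<Longrightarrow>
      dop_row_act N E (row_of (Ps n) i) = (\<Sum>l<N. \<Lambda> n $$ (i, l) \<cdot>\<^sub>r row_of (Ps n) l)"
    using DW_eigenrowsE[OF E] by blast
  have monic: "monic_deg N l (Ps l)" for l using Ps by (simp add: monic_OPS_def)
  show ?thesis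
    using monic p le0
  proof (induction rule: monic_deg_induct)
    case (row l i c)
    have "row_of (Ps l) j \<in> rows_below N n" if "j < N" for j
      using row_of_monic_deg[OF monic that] rows_below_mono[of "Suc l" n N] row(2) by auto
    then show ?case
      unfolding linear eigen[OF row(3)]
      by (intro supported_rows_smult supported_rows_sum) auto
  qed (simp_all only: linear rows_below_0 singleton_iff zero_in_supported_rows supported_rows_add)
qed

lemma DW_row_act_adjointE:
  assumes E: "E \<in> DW N W S" and q: "q \<in> rows_below N n"
  obtains s where "s \<in> rows_below N n"
    "\<forall>m. \<forall>p\<in>rows_below N m. form (dop_row_act N E p) q = form p s"
proof -
  let ?E = "dop_row_act N E"
  note linear = module_hom.add[OF dop_row_act_linear[of N E]]
    module_hom.scale[OF dop_row_act_linear[of N E]]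
  obtain Ps \<Lambda> where Ps: "monic_OPS N W S Ps"
    and eigen: "\<And>n i. i < N \<Longrightarrow> ?E (row_of (Ps n) i) = (\<Sum>l<N. \<Lambda> n $$ (i, l) \<cdot>\<^sub>r row_of (Ps n) l)"
    using DW_eigenrowsE[OF E] by blast
  have monic: "monic_deg N l (Ps l)" for l using Ps by (simp add: monic_OPS_def)
  have "row_functional (\<lambda>p. form (?E p) q)"
    using module_hom_compose[OF dop_row_act_linear[of N E] form_linear_left[of q]]
    by (simp add: o_def)
  then obtain s where s: "s \<in> rows_below N n" "\<And>p. p \<in> rows_below N n \<Longrightarrow> form (?E p) q = form p s"
    using riesz_supported_rows[of "{..<N} \<times> {..<n}" n] by blast
  have "form (?E p) q = form p s" if "p \<in> rows_below N m" "n \<le> m" for p m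
    using monic that
  proof (induction rule: monic_deg_induct)
    case (row l i c)
    have "form (row_of (Ps l) j) r = 0" if "j < N" "r \<in> rows_below N n" for j r
      using monic_OPS_orthogonal[OF Ps that(1)] that(2) rows_below_mono[OF row(1), of N] by blast
    then show ?case
      using q s(1) row(3) unfolding linear eigen[OF row(3)] by (simp only: form_simps) simp
  qed (simp_all only: linear form_simps s(2))
  moreover have "rows_below N m \<subseteq> rows_below N (max m n)" for m
    by (intro rows_below_mono) simp
  ultimately have "form (?E p) q = form p s" if "p \<in> rows_below N m" for m p
    using that by (meson max.cobounded2 subsetD)
  then show ?thesis using that[OF s(1)] by blast
qed

lemma DW_imp_adjointable:
  assumes E: "E \<in> DW N W S"
  shows "row_flag.adjointable (dop_row_act N E)"
  using dop_row_act_linear DW_row_act_below[OF E]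
proof (rule row_flag.adjointableI)
  show "\<exists>s\<in>rows_below N n. \<forall>m. \<forall>p\<in>rows_below N m. form (dop_row_act N E p) q = form p s"
    if q: "q \<in> rows_below N n" for n q
    by (rule DW_row_act_adjointE[OF E q]) (rule bexI)
qed

theorem DW_iff_adjointable:
  "E \<in> DW N W S \<longleftrightarrow> wf_dop N E \<and> row_flag.adjointable (dop_row_act N E)"
  using adjointable_imp_DW DW_imp_adjointable by (auto simp: DW_def)

end

section \<open>Darboux transforms of a diagonal weight\<close>

text \<open>
  The adjoint relation makes polynomial multiples of \<open>u\<close> and \<open>u'\<close> coincide, after the derivatives
  have been moved off a multiple of a high power of \<open>\<rho>\<close>.
\<close>

lemma diffop_between_separated_eq_0:
  assumes "pearson u \<rho> v" "pearson u' \<rho> v'" and "diffop L" "\<rho> \<noteq> 0"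
    and separated: "\<And>R S. \<rho> * wronskian R S = R * S * (v - v') \<Longrightarrow> R = 0 \<or> S = 0"
    and adjoint: "\<And>f. \<exists>g. \<forall>h. u (L h * f) = u' (h * g)"
  shows "L h = 0"
proof -
  interpret u: pearson u \<rho> v by fact
  interpret u': pearson u' \<rho> v' by fact
  have "u (f * L h) = 0" for f
  proof -
    obtain g where g: "\<And>h. u (L h * f) = u' (h * g)" using adjoint by blast
    obtain m where "\<And>f. \<exists>R. \<forall>h. u (L (\<rho> ^ m * h) * f) = u (h * R)"
      using u.diffop_adjoint[OF \<open>diffop L\<close>] by blast
    then obtain R where R: "\<And>h. u (L (\<rho> ^ m * h) * f) = u (h * R)" by blast
    have eq: "u (h * R) = u' (h * (\<rho> ^ m * g))" for h
      using R[of h] g[of "\<rho> ^ m * h"] by (simp add: mult_ac)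
    have "\<rho> ^ m * g = 0" if "R = 0"
      using that eq by (intro u'.eq_0_if_annihilates) (simp flip: eq)
    then have "\<rho> ^ m * g = 0"
      using separated[OF pearson_proportional[OF assms(1,2) eq]] by blast
    then have "g = 0" using \<open>\<rho> \<noteq> 0\<close> by simp
    then show ?thesis using g[of h] by (simp add: mult.commute)
  qed
  then show ?thesis by (rule u.eq_0_if_annihilates)
qed

lemma diffop_diag_coeff_eqI:
  assumes "diffop L" "diffop M" and eq: "\<And>n. m \<le> n \<Longrightarrow> diag_coeff L n = diag_coeff M n"
  shows "diag_coeff L n = diag_coeff M n"
proof -
  obtain P where P: "\<And>n. diag_coeff L n = poly P (of_nat n)"
    using diffop_diag_coeff[OF assms(1)] by blast
  obtain Q where Q: "\<And>n. diag_coeff M n = poly Q (of_nat n)"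
    using diffop_diag_coeff[OF assms(2)] by blast
  have "infinite (of_nat ` {m..} :: 'a set)"
    by (subst finite_image_iff) (auto simp: inj_on_def infinite_Ici)
  moreover have "of_nat ` {m..} \<subseteq> {x. poly (P - Q) x = 0}"
    using eq by (auto simp: P Q)
  ultimately have "P - Q = 0"
    using poly_roots_finite[of "P - Q"] finite_subset by blast
  then show ?thesis by (simp add: P Q)
qed

definition diag_op :: "nat \<Rightarrow> (nat \<Rightarrow> complex poly \<Rightarrow> complex poly) \<Rightarrow> poly_row \<Rightarrow> poly_row" where
  "diag_op N L p = (\<lambda>k. if k < N then L k (p k) else 0)"

lemma diag_op_linear:
  assumes "\<And>k. k < N \<Longrightarrow> poly_linear (L k)"
  shows "row_linear (diag_op N L)"
proof -
  have "diag_op N L (p + q) = diag_op N L p + diag_op N L q" for p q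
    by (rule ext) (simp add: diag_op_def module_hom.add[OF assms])
  moreover have "diag_op N L (c \<cdot>\<^sub>r p) = c \<cdot>\<^sub>r diag_op N L p" for c p
    by (rule ext) (simp add: diag_op_def module_hom.scale[OF assms])
  ultimately show ?thesis by (simp add: module_hom_iff row_module.module_axioms)
qed

lemma poly_op_diag_op:
  assumes "\<And>k. N \<le> k \<Longrightarrow> p k = 0"
  shows "poly_op row_smult Q (diag_op N L) p = diag_op N (\<lambda>k. poly_op smult Q (L k)) p"
proof -
  have "(diag_op N L ^^ m) p = diag_op N (\<lambda>k. L k ^^ m) p" for m
    by (induction m) (auto simp: diag_op_def fun_eq_iff assms)
  then show ?thesis by (auto simp: poly_op_def diag_op_def fun_eq_iff)
qed

lemma poly_op_conjugate:
  assumes "module_hom s s F" and inverse: "\<And>x. G (F x) = x"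
  shows "poly_op s Q (\<lambda>x. F (L (G x))) (F x) = F (poly_op s Q L x)"
proof -
  have "((\<lambda>x. F (L (G x))) ^^ m) (F x) = F ((L ^^ m) x)" for m
    by (induction m) (simp_all add: inverse)
  then show ?thesis
    by (simp add: poly_op_def module_hom.sum[OF assms(1)] module_hom.scale[OF assms(1)])
qed

locale darboux =
  fixes N :: nat and u :: "nat \<Rightarrow> complex poly \<Rightarrow> complex" and \<rho> :: "complex poly"
    and v :: "nat \<Rightarrow> complex poly" and A :: "nat \<Rightarrow> nat \<Rightarrow> complex" and \<kappa> :: "nat \<Rightarrow> complex"
  assumes N_pos: "0 < N"
    and pearson_u: "k < N \<Longrightarrow> pearson (u k) \<rho> (v k)"
    and \<rho>_squarefree: "rsquarefree \<rho>"
    and u_nonneg: "k < N \<Longrightarrow> Re (u k (f * cnj_poly f)) \<ge> 0"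
    and u_cnj: "k < N \<Longrightarrow> u k (cnj_poly f) = cnj (u k f)"
    and A_support: "A i j \<noteq> 0 \<Longrightarrow> even i \<and> odd j \<and> i < N \<and> j < N"
    and A_real: "cnj (A i j) = A i j"
    and A_chain_even: "Suc i < N \<Longrightarrow> even i \<Longrightarrow> A i (Suc i) \<noteq> 0"
    and A_chain_odd: "Suc i < N \<Longrightarrow> odd i \<Longrightarrow> A (Suc i) i \<noteq> 0"
    and intertwine: "A r c \<noteq> 0 \<Longrightarrow>
      bochner_eigenvalue \<rho> (v c) (Suc n) + \<kappa> c = bochner_eigenvalue \<rho> (v r) n + \<kappa> r"
    and separated: "i < N \<Longrightarrow> j < N \<Longrightarrow> i \<noteq> j \<Longrightarrow>
      \<rho> * wronskian R S = R * S * (v i - v j) \<Longrightarrow> R = 0 \<or> S = 0"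
begin

definition X :: "nat \<Rightarrow> nat \<Rightarrow> complex poly" where
  "X i j = [:0, A i j:]"

definition X_act :: "poly_row \<Rightarrow> poly_row" where
  "X_act p = (\<lambda>k. \<Sum>r<N. X r k * p r)"

definition T :: "poly_row \<Rightarrow> poly_row" where
  "T p = p + X_act p"

definition T_inv :: "poly_row \<Rightarrow> poly_row" where
  "T_inv p = p - X_act p"

definition form :: "poly_row \<Rightarrow> poly_row \<Rightarrow> complex" where
  "form p q = (\<Sum>k<N. u k (T p k * T q k))"

definition \<delta> :: "nat \<Rightarrow> complex poly \<Rightarrow> complex poly" where
  "\<delta> k f = pearson.bochner \<rho> (v k) f + smult (\<kappa> k) f"

definition D :: "poly_row \<Rightarrow> poly_row" where
  "D p = T_inv (diag_op N \<delta> (T p))"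

lemma \<rho>_neq_0: "\<rho> \<noteq> 0"
  using \<rho>_squarefree by (simp add: rsquarefree_def)

lemma X_eq_0: "odd i \<or> even j \<or> N \<le> i \<or> N \<le> j \<Longrightarrow> X i j = 0"
  using A_support[of i j] by (cases "A i j = 0") (auto simp: X_def)

lemma X_act_outside: "N \<le> k \<Longrightarrow> X_act p k = 0"
  by (simp add: X_act_def X_eq_0)

lemma X_act_even: "even k \<Longrightarrow> X_act p k = 0"
  by (simp add: X_act_def X_eq_0)

lemma X_act_cong: "(\<And>r. even r \<Longrightarrow> r < N \<Longrightarrow> p r = q r) \<Longrightarrow> X_act p = X_act q"
  unfolding X_act_def by (intro ext sum.cong refl) (metis X_eq_0 lessThan_iff mult_eq_0_iff)

lemma X_act_X_act: "X_act (X_act p) = 0"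
proof -
  have "X_act (X_act p) = X_act 0" by (rule X_act_cong) (simp add: X_act_even)
  then show ?thesis by (simp add: X_act_def fun_eq_iff)
qed

lemma X_act_linear: "row_linear X_act"
proof -
  have "X_act (p + q) = X_act p + X_act q" "X_act (c \<cdot>\<^sub>r p) = c \<cdot>\<^sub>r X_act p" for p q c
    by (simp_all add: X_act_def fun_eq_iff distrib_left sum.distrib smult_sum2)
  then show ?thesis by (simp add: module_hom_iff row_module.module_axioms)
qed

lemma T_linear: "row_linear T"
  by (simp add: module_hom_iff row_module.module_axioms T_def module_hom.add[OF X_act_linear]
      module_hom.scale[OF X_act_linear] row_module.scale_right_distrib)

lemma T_inv_linear: "row_linear T_inv"
  by (simp add: module_hom_iff row_module.module_axioms T_inv_def module_hom.add[OF X_act_linear]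
      module_hom.scale[OF X_act_linear] row_module.scale_right_diff_distrib)

lemma T_inv_T: "T_inv (T p) = p"
  and T_T_inv: "T (T_inv p) = p"
  by (simp_all add: T_def T_inv_def X_act_X_act
      module_hom.add[OF X_act_linear] module_hom.diff[OF X_act_linear])

lemma T_outside: "N \<le> k \<Longrightarrow> T p k = p k"
  and T_inv_outside: "N \<le> k \<Longrightarrow> T_inv p k = p k"
  and T_even: "even k \<Longrightarrow> T p k = p k"
  by (simp_all add: T_def T_inv_def X_act_outside X_act_even)

lemma X_act_unit_row: "i < N \<Longrightarrow> X_act (unit_row i f) k = X i k * f"
  by (auto simp: X_act_def unit_row_def if_distrib[of "\<lambda>x. _ * x"] cong: if_cong)

lemma T_unit_row: "i < N \<Longrightarrow> T (unit_row i f) k = (if k = i then f else X i k * f)"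
  by (simp add: T_def X_act_unit_row) (auto simp: unit_row_def X_eq_0)

lemma T_cnj_row: "T (cnj_row p) = cnj_row (T p)"
proof
  fix k
  have "cnj_poly (X r k) = X r k" for r
    by (simp add: X_def A_real poly_eq_iff coeff_pCons split: nat.split)
  then show "T (cnj_row p) k = cnj_row (T p) k"
    by (simp add: T_def X_act_def cnj_poly.hom_add cnj_poly.hom_sum cnj_poly.hom_mult)
qed

lemma form_commute: "form p q = form q p"
  by (simp add: form_def mult.commute)

lemma functional_u: "k < N \<Longrightarrow> functional (u k)"
  using pearson_u by (simp add: pearson_def definite_functional_def)

lemmas u_0 = functional.zero[OF functional_u]

lemma form_linear_left: "row_functional (\<lambda>p. form p q)"
proof -
  have "form (p + p') q = form p q + form p' q" for p p'
    by (simp add: form_def module_hom.add[OF T_linear] functional.add[OF functional_u]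
        distrib_right sum.distrib)
  moreover have "form (c \<cdot>\<^sub>r p) q = c * form p q" for c p
    by (simp add: form_def module_hom.scale[OF T_linear] functional.scale[OF functional_u]
          sum_distrib_left)
  ultimately show ?thesis
    by (simp add: module_hom_iff row_module.module_axioms vector_space_over_itself.module_axioms)
qed

lemma form_linear_right: "row_functional (form p)"
  using form_linear_left[of p] by (simp only: form_commute[of _ p])

lemma form_hermitian: "form p q = cnj (form (cnj_row q) (cnj_row p))"
  by (simp add: form_def T_cnj_row u_cnj[symmetric] cnj_poly.hom_mult mult.commute)

lemma form_definite:
  assumes "p \<in> rows_below N n" "form p (cnj_row p) = 0"
  shows "p = 0"
proof -
  let ?u = "\<lambda>k. u k (T p k * cnj_poly (T p k))"
  have real: "cnj (?u k) = ?u k" if "k < N" for k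
    using u_cnj[OF that, of "T p k * cnj_poly (T p k)"]
    by (simp add: cnj_poly.hom_mult mult.commute)
  have "(\<Sum>k<N. Re (?u k)) = 0"
    using arg_cong[OF assms(2), of Re] by (simp add: form_def T_cnj_row)
  then have "Re (?u k) = 0" if "k < N" for k
    using that by (subst (asm) sum_nonneg_eq_0_iff) (auto intro: u_nonneg)
  then have "?u k = 0" if "k < N" for k
    using that real[OF that] by (simp add: complex_eq_iff)
  then have "T p k = 0" if "k < N" for k
    using definite_functional.definite[of "u k"] pearson_u[OF that] that by (simp add: pearson_def)
  moreover have "T p k = 0" if "N \<le> k" for k
    using rows_below_outside[OF assms(1) that] by (simp add: T_outside that)
  ultimately have "T p = 0" by (metis ext not_le zero_fun_apply)
  then show ?thesis using T_inv_T[of p] module_hom.zero[OF T_inv_linear] by simp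
qed

sublocale row_flag: flagged_module row_smult "rows_below N" form
  by (intro flagged_module.intro flagged_module_axioms.intro row_module.module_axioms
      subspace_supported_rows form_linear_left form_linear_right)

lemma diffop_\<delta>: "k < N \<Longrightarrow> diffop (\<delta> k)"
  using pearson.diffop_bochner[OF pearson_u] diffop_times[of "[:\<kappa> k:]"]
  by (auto simp: \<delta>_def[abs_def] intro!: diffop_add)

lemma \<delta>_linear: "k < N \<Longrightarrow> poly_linear (\<delta> k)"
  by (intro diffop_linear diffop_\<delta>)

lemma adjointable_\<delta>:
  assumes "k < N"
  shows "poly_adjointable (u k) (\<delta> k)"
proof -
  interpret pearson "u k" \<rho> "v k" using pearson_u[OF assms] .
  show ?thesis
    unfolding \<delta>_def[abs_def]
    by (intro flag.adjointable_add flag.adjointable_scale flag.adjointable_id adjointable_bochner)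
qed

lemma diag_coeff_\<delta>:
  assumes "k < N"
  shows "diag_coeff (\<delta> k) n = diag_coeff (pearson.bochner \<rho> (v k)) n + \<kappa> k"
    and "diag_coeff (\<delta> k) n = bochner_eigenvalue \<rho> (v k) n + \<kappa> k"
proof -
  interpret pearson "u k" \<rho> "v k" using pearson_u[OF assms] .
  show "diag_coeff (\<delta> k) n = diag_coeff bochner n + \<kappa> k"
    by (simp add: \<delta>_def[abs_def] diag_coeff_def)
  then show "diag_coeff (\<delta> k) n = bochner_eigenvalue \<rho> (v k) n + \<kappa> k"
    by (simp add: diag_coeff_bochner)
qed

lemma diag_coeff_\<delta>_shift:
  assumes "A r c \<noteq> 0"
  shows "diag_coeff (\<delta> c) (Suc n) = diag_coeff (\<delta> r) n"
  using intertwine[OF assms, of n] A_support[OF assms] by (simp add: diag_coeff_\<delta>(2))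

lemma \<delta>_symmetric:
  assumes "k < N"
  shows "u k (\<delta> k f * g) = u k (f * \<delta> k g)"
proof -
  interpret pearson "u k" \<rho> "v k" using pearson_u[OF assms] .
  show ?thesis by (simp add: \<delta>_def distrib_left distrib_right add scale bochner_symmetric)
qed

lemma D_linear: "row_linear D"
  using module_hom_compose[OF module_hom_compose[OF T_linear diag_op_linear[of N \<delta>]] T_inv_linear]
  by (simp add: D_def[abs_def] o_def \<delta>_linear)

lemma form_D: "form (D p) q = form p (D q)"
proof -
  have sum: "form (D p) q = (\<Sum>k<N. u k (\<delta> k (T p k) * T q k))" for p q
    by (simp add: form_def D_def T_T_inv diag_op_def)
  have "form (D p) q = form (D q) p"
    unfolding sum using \<delta>_symmetric by (intro sum.cong refl) (metis lessThan_iff mult.commute)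
  then show ?thesis by (simp only: form_commute[of p])
qed

lemma D_eq:
  assumes j: "j < N"
  shows "D p j = \<delta> j (p j) + (\<Sum>r<N. \<delta> j (X r j * p r) - X r j * \<delta> r (p r))"
proof -
  have "X_act (diag_op N \<delta> (T p)) = X_act (diag_op N \<delta> p)"
    by (rule X_act_cong) (simp add: diag_op_def T_even)
  then have "D p j = \<delta> j (T p j) - (\<Sum>r<N. X r j * \<delta> r (p r))"
    using j by (simp add: D_def T_inv_def) (simp add: X_act_def diag_op_def)
  then show ?thesis
    by (simp add: T_def X_act_def sum_subtractf
        module_hom.add[OF \<delta>_linear[OF j]] module_hom.sum[OF \<delta>_linear[OF j]])
qed

lemma \<delta>_intertwine_below:
  assumes r: "r < N" and c: "c < N" and f: "f \<in> poly_below n"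
  shows "\<delta> c (X r c * f) - X r c * \<delta> r f \<in> poly_below n"
proof (cases "A r c = 0 \<or> f = 0")
  case True
  then show ?thesis
    using module_hom.zero[OF \<delta>_linear] r c by (auto simp: X_def)
next
  case False
  then obtain m where n: "n = Suc m" using f by (cases n) auto
  interpret r: pearson "u r" \<rho> "v r" using pearson_u[OF r] .
  interpret c: pearson "u c" \<rho> "v c" using pearson_u[OF c] .
  have Xf: "X r c * g \<in> poly_below (Suc n)" if "g \<in> poly_below n" for g
    using that by (auto simp: X_def intro: pCons_in_poly_below poly_below_smult)
  have "coeff (\<delta> c (X r c * f)) n = diag_coeff (\<delta> c) n * coeff (X r c * f) n"
    by (rule c.coeff_adjointable[OF adjointable_\<delta>[OF c] Xf[OF f]])
  also have "\<dots> = A r c * (diag_coeff (\<delta> r) m * coeff f m)"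
    using False diag_coeff_\<delta>_shift[of r c m] by (simp add: n X_def)
  also have "\<dots> = A r c * coeff (\<delta> r f) m"
    using r.coeff_adjointable[OF adjointable_\<delta>[OF r] f[unfolded n]] by simp
  also have "\<dots> = coeff (X r c * \<delta> r f) n" by (simp add: n X_def)
  finally have "coeff (\<delta> c (X r c * f) - X r c * \<delta> r f) n = 0" by simp
  with poly_below_diff[OF c.flag.adjointable_flag[OF adjointable_\<delta>[OF c] Xf[OF f]]
      Xf[OF r.flag.adjointable_flag[OF adjointable_\<delta>[OF r] f]]]
  show ?thesis by (rule poly_below_SucD)
qed

lemma D_in_rows_below:
  assumes p: "p \<in> rows_below N n"
  shows "D p \<in> rows_below N n"
proof -
  have "D p j \<in> poly_below n" if j: "j < N" for j
  proof -
    interpret pearson "u j" \<rho> "v j" using pearson_u[OF j] .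
    have p_below: "p r \<in> poly_below n" if "r < N" for r using p that by (simp add: in_rows_below_iff)
    show ?thesis
      unfolding D_eq[OF j] using flag.adjointable_flag[OF adjointable_\<delta>[OF j]]
      by (intro poly_below_add poly_below_sum \<delta>_intertwine_below) (auto simp: p_below j)
  qed
  moreover have "D p j = 0" if "N \<le> j" for j using that by (simp add: D_def T_inv_outside diag_op_def)
  ultimately show ?thesis by (simp add: in_rows_below_iff)
qed

lemma adjointable_D: "row_flag.adjointable D"
  using D_linear D_in_rows_below form_D by (rule row_flag.adjointable_symmetric)

lemma poly_op_D:
  assumes "\<And>k. N \<le> k \<Longrightarrow> p k = 0"
  shows "poly_op row_smult Q D p = T_inv (diag_op N (\<lambda>k. poly_op smult Q (\<delta> k)) (T p))"
proof -
  have "poly_op row_smult Q D p = poly_op row_smult Q (\<lambda>p. T_inv (diag_op N \<delta> (T p))) (T_inv (T p))"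
    by (simp add: D_def[abs_def] T_inv_T)
  also have "\<dots> = T_inv (poly_op row_smult Q (diag_op N \<delta>) (T p))"
    using T_inv_linear T_T_inv by (rule poly_op_conjugate)
  also have "poly_op row_smult Q (diag_op N \<delta>) (T p) = diag_op N (\<lambda>k. poly_op smult Q (\<delta> k)) (T p)"
    by (rule poly_op_diag_op) (simp add: T_outside assms)
  finally show ?thesis .
qed

definition D_coeffs :: dop where
  "D_coeffs =
     [mat N N (\<lambda>(i, j). (if i = j then [:\<kappa> j:] else 0) + smult (A i j) (v j) + X i j * [:\<kappa> j - \<kappa> i:]),
      mat N N (\<lambda>(i, j). (if i = j then v j else 0) + smult (2 * A i j) \<rho> + X i j * (v j - v i)),
      mat N N (\<lambda>(i, j). if i = j then \<rho> else 0)]"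

lemma wf_D_coeffs: "wf_dop N D_coeffs"
  by (auto simp: wf_dop_def D_coeffs_def)

lemma \<delta>_eq: "k < N \<Longrightarrow> \<delta> k f = \<rho> * pderiv (pderiv f) + v k * pderiv f + smult (\<kappa> k) f"
  using pearson.bochner_def[OF pearson_u] by (simp add: \<delta>_def)

lemma dop_entry_D_coeffs:
  assumes i: "i < N" and j: "j < N"
  shows "dop_entry D_coeffs i j f = (if i = j then \<delta> j f else 0) + (\<delta> j (X i j * f) - X i j * \<delta> i f)"
proof -
  have pderiv_X: "pderiv (X i j * f) = smult (A i j) f + X i j * pderiv f" for f
    by (simp add: X_def pderiv_pCons pderiv_smult)
  have double: "smult (A i j * 2) (\<rho> * pderiv f) = smult (A i j) (\<rho> * (pderiv f * 2))"
    by (simp only: mult_2_right distrib_left smult_add_right smult_add_left)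
  have "dop_entry D_coeffs i j f =
    ((if i = j then [:\<kappa> j:] else 0) + smult (A i j) (v j) + X i j * [:\<kappa> j - \<kappa> i:]) * f
    + ((if i = j then v j else 0) + smult (2 * A i j) \<rho> + X i j * (v j - v i)) * pderiv f
    + (if i = j then \<rho> else 0) * pderiv (pderiv f)"
    using i j by (simp add: dop_entry_def D_coeffs_def eval_nat_numeral lessThan_Suc)
  also have "\<dots> = (if i = j then \<delta> j f else 0) + (\<delta> j (X i j * f) - X i j * \<delta> i f)"
    unfolding \<delta>_eq[OF i] \<delta>_eq[OF j] pderiv_X pderiv_add pderiv_smult
    by (simp add: algebra_simps smult_add_left smult_diff_left double)
  finally show ?thesis .
qed

lemma dop_row_act_D_coeffs: "dop_row_act N D_coeffs = D"
proof (intro ext)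
  fix p j
  show "dop_row_act N D_coeffs p j = D p j"
  proof (cases "j < N")
    case True
    have "dop_row_act N D_coeffs p j =
        (\<Sum>i<N. (if i = j then \<delta> j (p j) else 0) + (\<delta> j (X i j * p i) - X i j * \<delta> i (p i)))"
      using True unfolding row_act_def by (auto simp: dop_entry_D_coeffs intro!: sum.cong)
    then show ?thesis using True by (simp add: D_eq sum.distrib)
  next
    case False
    then show ?thesis by (simp add: row_act_def D_def T_inv_outside diag_op_def)
  qed
qed

context
  fixes E :: "nat \<Rightarrow> nat \<Rightarrow> complex poly \<Rightarrow> complex poly"
  assumes diffop_E: "\<And>i j. diffop (E i j)"
    and adjointable_E: "row_flag.adjointable (row_act N E)"
begin

definition transformed_entry :: "nat \<Rightarrow> nat \<Rightarrow> complex poly \<Rightarrow> complex poly" where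
  "transformed_entry i j f = T (row_act N E (T_inv (unit_row i f))) j"

abbreviation transformed_diag :: "nat \<Rightarrow> complex poly \<Rightarrow> complex poly" where
  "transformed_diag i \<equiv> transformed_entry i i"

lemma diffop_transformed_entry:
  assumes i: "i < N"
  shows "diffop (transformed_entry i j)"
proof -
  have T_inv: "diffop (\<lambda>f. T_inv (unit_row i f) k)" for k
  proof -
    have "T_inv (unit_row i f) k = ((if k = i then 1 else 0) - X i k) * f" for f
      using i by (simp add: T_inv_def X_act_unit_row) (simp add: unit_row_def left_diff_distrib)
    then show ?thesis by (simp only: diffop_times)
  qed
  have "diffop (\<lambda>f. row_act N E (T_inv (unit_row i f)) k)" for k
    by (cases "k < N")
      (auto simp: row_act_def diffop_0 intro!: diffop_sum diffop_comp[OF diffop_E T_inv])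
  then show ?thesis
    unfolding transformed_entry_def[abs_def] T_def plus_fun_apply X_act_def
    by (intro diffop_add diffop_sum diffop_mult)
qed

lemma transformed_eq_sum:
  assumes "\<And>k. N \<le> k \<Longrightarrow> p k = 0"
  shows "T (row_act N E (T_inv p)) j = (\<Sum>i<N. transformed_entry i j (p i))"
proof -
  let ?C = "\<lambda>p. T (row_act N E (T_inv p))"
  have "row_linear ?C"
    using module_hom_compose[OF module_hom_compose[OF T_inv_linear
          row_flag.adjointable_linear[OF adjointable_E]] T_linear]
    by (simp add: o_def)
  then have "?C (\<Sum>i<N. unit_row i (p i)) = (\<Sum>i<N. ?C (unit_row i (p i)))"
    by (rule module_hom.sum)
  then show ?thesis
    by (simp only: row_eq_sum_unit_row[of N p, OF assms, symmetric] sum_fun_apply transformed_entry_def)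
qed

lemma transformed_adjointE:
  assumes q: "q \<in> rows_below N n"
  obtains s where "s \<in> rows_below N n"
    "\<forall>i<N. \<forall>f. (\<Sum>k<N. u k (transformed_entry i k f * T q k)) = u i (f * T s i)"
proof -
  obtain s where s: "s \<in> rows_below N n" "\<And>m p. p \<in> rows_below N m \<Longrightarrow> form (row_act N E p) q = form p s"
    using row_flag.adjointable_adjointE[OF adjointable_E q] by blast
  have "(\<Sum>k<N. u k (transformed_entry i k f * T q k)) = u i (f * T s i)" if i: "i < N" for i f
  proof -
    obtain m where "T_inv (unit_row i f) \<in> rows_below N m"
      using ex_rows_below[of N "T_inv (unit_row i f)"] i by (auto simp: T_inv_outside unit_row_def)
    then have "form (row_act N E (T_inv (unit_row i f))) q = form (T_inv (unit_row i f)) s"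
      by (rule s(2))
    then have "(\<Sum>k<N. u k (transformed_entry i k f * T q k)) = (\<Sum>k<N. u k (unit_row i f k * T s k))"
      by (simp add: form_def transformed_entry_def T_T_inv)
    also have "\<dots> = (\<Sum>k<N. if k = i then u i (f * T s i) else 0)"
      using u_0 by (intro sum.cong refl) (auto simp: unit_row_def)
    finally show ?thesis using i by simp
  qed
  with s(1) show ?thesis by (intro that) auto
qed

lemma transformed_entry_offdiag_eq_0:
  assumes i: "i < N" and j: "j < N" and "i \<noteq> j"
  shows "transformed_entry i j f = 0"
proof (rule diffop_between_separated_eq_0[where L = "transformed_entry i j",
      OF pearson_u[OF j] pearson_u[OF i] _ \<rho>_neq_0])
  show "diffop (transformed_entry i j)" using i by (rule diffop_transformed_entry)
  show "R = 0 \<or> S = 0" if "\<rho> * wronskian R S = R * S * (v j - v i)" for R S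
    using separated[OF j i _ that] \<open>i \<noteq> j\<close> by blast
  show "\<exists>g. \<forall>h. u j (transformed_entry i j h * f) = u i (h * g)" for f
  proof -
    obtain n where n: "T_inv (unit_row j f) \<in> rows_below N n"
      using ex_rows_below[of N "T_inv (unit_row j f)"] j by (auto simp: T_inv_outside unit_row_def)
    obtain s where "s \<in> rows_below N n"
      and s: "\<forall>l<N. \<forall>h. (\<Sum>k<N. u k (transformed_entry l k h * T (T_inv (unit_row j f)) k)) =
        u l (h * T s l)"
      using n by (rule transformed_adjointE)
    have "(\<Sum>k<N. u k (transformed_entry i k h * T (T_inv (unit_row j f)) k)) =
        (\<Sum>k<N. if k = j then u j (transformed_entry i j h * f) else 0)" for h
      unfolding T_T_inv using u_0 by (intro sum.cong refl) (auto simp: unit_row_def)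
    then show ?thesis using s i j by (intro exI[of _ "T s i"]) simp
  qed
qed

lemma row_act_eq_transformed_diag:
  assumes "\<And>k. N \<le> k \<Longrightarrow> p k = 0"
  shows "row_act N E p = T_inv (diag_op N transformed_diag (T p))"
proof -
  have "T (row_act N E p) k = diag_op N transformed_diag (T p) k" for k
  proof (cases "k < N")
    case True
    have "T (row_act N E (T_inv (T p))) k = (\<Sum>i<N. transformed_entry i k (T p i))"
      by (rule transformed_eq_sum) (simp add: T_outside assms)
    also have "\<dots> = (\<Sum>i<N. if i = k then transformed_diag k (T p k) else 0)"
      by (intro sum.cong refl) (auto simp: transformed_entry_offdiag_eq_0 True)
    finally show ?thesis using True by (simp add: T_inv_T diag_op_def)
  qed (simp add: T_outside row_act_def diag_op_def)
  then have "T (row_act N E p) = diag_op N transformed_diag (T p)" by blast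
  then show ?thesis using T_inv_T[of "row_act N E p"] by simp
qed

lemma transformed_diag_0: "i < N \<Longrightarrow> transformed_diag i 0 = 0"
  using module_hom.zero[OF diffop_linear[OF diffop_transformed_entry]] .

lemma row_act_unit_row:
  assumes "i < N" "j < N"
  shows "row_act N E (unit_row i f) j =
    (if i = j then transformed_diag i f
      else transformed_diag j (X i j * f) - X i j * transformed_diag i f)"
proof -
  have "X r j * transformed_diag r (T (unit_row i f) r) =
      (if r = i then X i j * transformed_diag i f else 0)" if "r < N" for r
    using assms that by (cases "even r") (auto simp: T_unit_row X_eq_0 transformed_diag_0)
  then have "X_act (diag_op N transformed_diag (T (unit_row i f))) j = X i j * transformed_diag i f"
    using assms by (simp add: X_act_def diag_op_def)
  moreover have "row_act N E (unit_row i f) = T_inv (diag_op N transformed_diag (T (unit_row i f)))"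
    using assms by (intro row_act_eq_transformed_diag) (auto simp: unit_row_def)
  ultimately show ?thesis
    using assms by (auto simp: T_inv_def T_unit_row X_eq_0)
        (simp_all add: diag_op_def T_unit_row X_eq_0)
qed

lemma row_act_unit_row_below:
  assumes "i < N" "j < N" "f \<in> poly_below n"
  shows "row_act N E (unit_row i f) j \<in> poly_below n"
  using row_flag.adjointable_flag[OF adjointable_E unit_row_in_rows_below[OF assms(1,3)]] assms(2)
  by (simp add: in_rows_below_iff)

lemma transformed_diag_below: "i < N \<Longrightarrow> f \<in> poly_below n \<Longrightarrow> transformed_diag i f \<in> poly_below n"
  using row_act_unit_row_below[of i i f n] row_act_unit_row[of i i f] by simp

lemma diag_coeff_transformed_diag_shift:
  assumes A: "A r c \<noteq> 0"
  shows "diag_coeff (transformed_diag c) (Suc n) = diag_coeff (transformed_diag r) n"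
proof -
  have rc: "r < N" "c < N" "r \<noteq> c" using A_support[OF A] by auto
  have X: "X r c * f = smult (A r c) (pCons 0 f)" for f by (simp add: X_def)
  have "row_act N E (unit_row r (monom 1 n)) c =
      smult (A r c) (transformed_diag c (monom 1 (Suc n)) - pCons 0 (transformed_diag r (monom 1 n)))"
    using rc module_hom.scale[OF diffop_linear[OF diffop_transformed_entry[OF rc(2)]],
        of c "A r c" "monom 1 (Suc n)"]
    by (simp add: row_act_unit_row X monom_Suc smult_diff_right)
  moreover have "row_act N E (unit_row r (monom 1 n)) c \<in> poly_below (Suc n)"
    by (intro row_act_unit_row_below monom_in_poly_below rc) simp
  ultimately have "coeff (smult (A r c)
      (transformed_diag c (monom 1 (Suc n)) - pCons 0 (transformed_diag r (monom 1 n)))) (Suc n) = 0"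
    using poly_belowD by (metis order_refl)
  then show ?thesis using A by (simp add: diag_coeff_def)
qed

lemma transformed_diag_adjointE:
  assumes i: "i < N" and g: "g \<in> poly_below n"
  obtains s where "s \<in> rows_below N n"
    "\<forall>l<N. \<forall>f. u l (transformed_diag l f * T (unit_row i g) l) = u l (f * T s l)"
proof -
  obtain s where s: "s \<in> rows_below N n"
    "\<forall>l<N. \<forall>f. (\<Sum>k<N. u k (transformed_entry l k f * T (unit_row i g) k)) = u l (f * T s l)"
    using unit_row_in_rows_below[OF i g] by (rule transformed_adjointE)
  have "u l (transformed_diag l f * T (unit_row i g) l) = u l (f * T s l)" if l: "l < N" for l f
  proof -
    have "(\<Sum>k<N. u k (transformed_entry l k f * T (unit_row i g) k)) =
        (\<Sum>k<N. if k = l then u l (transformed_diag l f * T (unit_row i g) l) else 0)"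
      using u_0 by (intro sum.cong refl) (auto simp: transformed_entry_offdiag_eq_0 l)
    then show ?thesis using s(2) l by simp
  qed
  then show ?thesis using that[OF s(1)] by blast
qed

lemma adjointable_transformed_diag:
  assumes i: "i < N"
  shows "poly_adjointable (u i) (transformed_diag i)"
proof -
  interpret pearson "u i" \<rho> "v i" using pearson_u[OF i] .
  show ?thesis
  proof (rule flag.adjointableI)
    show "poly_linear (transformed_diag i)" by (intro diffop_linear diffop_transformed_entry i)
    show "transformed_diag i f \<in> poly_below n" if "f \<in> poly_below n" for f n
      using i that by (rule transformed_diag_below)
    fix n and g :: "complex poly"
    assume "g \<in> poly_below n"
    with i obtain s where s: "s \<in> rows_below N n"
      "\<forall>l<N. \<forall>f. u l (transformed_diag l f * T (unit_row i g) l) = u l (f * T s l)"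
      by (rule transformed_diag_adjointE)
    have "T s i = s i"
    proof (cases "even i")
      case False
      have "s r = 0" if "even r" "r < N" for r
      proof (rule definite_functional.eq_0_if_annihilates)
        show "definite_functional (u r)" using pearson_u[OF that(2)] by (simp add: pearson_def)
        have "T (unit_row i g) r = 0" using False that i by (auto simp: T_unit_row X_eq_0)
        then show "u r (f * s r) = 0" for f
          using s(2) u_0[OF that(2)] that by (metis T_even mult_zero_right)
      qed
      then have "X_act s = X_act 0" by (intro X_act_cong) simp
      then show ?thesis by (simp add: T_def X_act_def)
    qed (simp add: T_even)
    then have "u i (transformed_diag i f * g) = u i (f * s i)" for f
      using s(2)[rule_format, OF i, of f] by (simp add: T_unit_row[OF i])
    with s(1) i show "\<exists>h\<in>poly_below n. \<forall>m. \<forall>f\<in>poly_below m.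
        u i (transformed_diag i f * g) = u i (f * h)"
      by (auto simp: in_rows_below_iff)
  qed
qed

lemma diag_coeff_transformed_diag:
  assumes base: "\<And>n. diag_coeff (transformed_diag 0) n = poly Q (diag_coeff (\<delta> 0) n)" and "i < N"
  shows "diag_coeff (transformed_diag i) n = poly Q (diag_coeff (\<delta> i) n)"
  using \<open>i < N\<close>
proof (induction i arbitrary: n)
  case 0
  then show ?case using base by simp
next
  case (Suc i)
  show ?case
  proof (cases "even i")
    case True
    then have A: "A i (Suc i) \<noteq> 0" using A_chain_even Suc.prems by blast
    interpret pearson "u (Suc i)" \<rho> "v (Suc i)" using pearson_u[OF Suc.prems] .
    have eigenvalues: "diag_coeff (poly_op smult Q (\<delta> (Suc i))) n =
        poly Q (diag_coeff (\<delta> (Suc i)) n)" for n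
      by (rule diag_coeff_poly_op[OF adjointable_\<delta>[OF Suc.prems]])
    have "diag_coeff (transformed_diag (Suc i)) n = diag_coeff (poly_op smult Q (\<delta> (Suc i))) n"
    proof (rule diffop_diag_coeff_eqI)
      show "diffop (transformed_diag (Suc i))" using Suc.prems by (rule diffop_transformed_entry)
      show "diffop (poly_op smult Q (\<delta> (Suc i)))" by (intro diffop_poly_op diffop_\<delta> Suc.prems)
      fix m :: nat assume "1 \<le> m"
      then obtain l where m: "m = Suc l" by (cases m) auto
      show "diag_coeff (transformed_diag (Suc i)) m = diag_coeff (poly_op smult Q (\<delta> (Suc i))) m"
        using diag_coeff_transformed_diag_shift[OF A, of l] diag_coeff_\<delta>_shift[OF A, of l] Suc
        by (simp add: eigenvalues m)
    qed
    then show ?thesis by (simp add: eigenvalues)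
  next
    case False
    then have A: "A (Suc i) i \<noteq> 0" using A_chain_odd Suc.prems by blast
    show ?thesis
      using diag_coeff_transformed_diag_shift[OF A, of n] diag_coeff_\<delta>_shift[OF A, of n] Suc by simp
  qed
qed

lemma row_act_eq_poly_op_D:
  "\<exists>Q. \<forall>p. (\<forall>k\<ge>N. p k = 0) \<longrightarrow> row_act N E p = poly_op row_smult Q D p"
proof -
  interpret base: pearson "u 0" \<rho> "v 0" using pearson_u[OF N_pos] .
  obtain P where "\<And>n. diag_coeff (transformed_diag 0) n = poly P (diag_coeff base.bochner n)"
    using base.diag_coeff_eq_poly_bochner[OF diffop_transformed_entry[OF N_pos]
        adjointable_transformed_diag[OF N_pos] \<rho>_squarefree]
    by blast
  then have "diag_coeff (transformed_diag 0) n = poly (P \<circ>\<^sub>p [:- \<kappa> 0, 1:]) (diag_coeff (\<delta> 0) n)" for n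
    by (simp add: poly_pcompose diag_coeff_\<delta>(1)[OF N_pos])
  then obtain Q where Q: "\<And>n. diag_coeff (transformed_diag 0) n = poly Q (diag_coeff (\<delta> 0) n)" by blast
  have "transformed_diag i = poly_op smult Q (\<delta> i)" if i: "i < N" for i
  proof -
    interpret pearson "u i" \<rho> "v i" using pearson_u[OF i] .
    show ?thesis
      using diag_coeff_transformed_diag[OF Q i] diag_coeff_poly_op[OF adjointable_\<delta>[OF i]]
      by (intro adjointable_eqI adjointable_transformed_diag i flag.adjointable_poly_op
          adjointable_\<delta>) simp
  qed
  then have "diag_op N transformed_diag = diag_op N (\<lambda>k. poly_op smult Q (\<delta> k))"
    by (auto simp: diag_op_def fun_eq_iff)
  then show ?thesis
    using row_act_eq_transformed_diag poly_op_D by (intro exI[of _ Q]) simp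
qed

end

end

locale darboux_weight = darboux +
  fixes W :: "real \<Rightarrow> complex mat" and S :: "real set"
  assumes mip_eq_form: "P \<in> carrier_mat N N \<Longrightarrow> Q \<in> carrier_mat N N \<Longrightarrow>
    mip N W S P Q = mat N N (\<lambda>(i, j). form (row_of P i) (cnj_row (row_of Q j)))"
begin

sublocale matrix_weight N W S form
  by (rule matrix_weight.intro)
    (fact form_linear_left form_linear_right form_hermitian form_definite mip_eq_form)+

lemma D_coeffs_in_DW: "D_coeffs \<in> DW N W S"
  by (simp add: DW_iff_adjointable wf_D_coeffs dop_row_act_D_coeffs adjointable_D)

theorem DW_eq_poly_algebra: "DW N W S = poly_algebra N D_coeffs"
proof (rule Set.set_eqI)
  fix E
  have "row_flag.adjointable (dop_row_act N E) \<longleftrightarrow>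
    (\<exists>Q. \<forall>n. \<forall>p\<in>rows_below N n. dop_row_act N E p = poly_op row_smult Q D p)"
  proof
    assume "row_flag.adjointable (dop_row_act N E)"
    then show "\<exists>Q. \<forall>n. \<forall>p\<in>rows_below N n. dop_row_act N E p = poly_op row_smult Q D p"
      using row_act_eq_poly_op_D[OF diffop_dop_entry] rows_below_outside by meson
  next
    assume "\<exists>Q. \<forall>n. \<forall>p\<in>rows_below N n. dop_row_act N E p = poly_op row_smult Q D p"
    then obtain Q where "\<And>n p. p \<in> rows_below N n \<Longrightarrow> poly_op row_smult Q D p = dop_row_act N E p"
      by metis
    then show "row_flag.adjointable (dop_row_act N E)"
      by (rule row_flag.adjointable_cong[OF row_flag.adjointable_poly_op[OF adjointable_D]
            dop_row_act_linear])
  qed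
  then show "E \<in> DW N W S \<longleftrightarrow> E \<in> poly_algebra N D_coeffs"
    by (simp add: DW_iff_adjointable poly_algebra_iff[OF wf_D_coeffs N_pos] dop_row_act_D_coeffs)
qed

end

section \<open>Weights on an interval\<close>

abbreviation weighted :: "complex poly \<Rightarrow> (real \<Rightarrow> real) \<Rightarrow> real \<Rightarrow> complex" where
  "weighted f w \<equiv> (\<lambda>x. poly f (complex_of_real x) * complex_of_real (w x))"

lemma poly_eq_sum_shifted_powers:
  "poly f (complex_of_real x) =
    (\<Sum>k\<le>degree f. coeff (f \<circ>\<^sub>p [:complex_of_real t, 1:]) k * complex_of_real ((x - t) ^ k))"
proof -
  have "poly f (complex_of_real x) = poly (f \<circ>\<^sub>p [:complex_of_real t, 1:]) (complex_of_real (x - t))"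
    by (simp add: poly_pcompose)
  then show ?thesis by (simp add: poly_altdef)
qed

lemma set_integrable_poly_mult:
  assumes "\<And>n. set_integrable lborel S (\<lambda>x. (x - t) ^ n * w x)"
  shows "set_integrable lborel S (weighted f w)"
proof -
  have "integrable lborel (\<lambda>x. \<Sum>k\<le>degree f. coeff (f \<circ>\<^sub>p [:complex_of_real t, 1:]) k *
      complex_of_real (indicator S x * ((x - t) ^ k * w x)))"
    using assms unfolding set_integrable_def
    by (intro Bochner_Integration.integrable_sum integrable_mult_right integrable_of_real) simp
  moreover have "(\<Sum>k\<le>degree f. coeff (f \<circ>\<^sub>p [:complex_of_real t, 1:]) k *
      complex_of_real (indicator S x * ((x - t) ^ k * w x))) =
      indicator S x *\<^sub>R (poly f (complex_of_real x) * complex_of_real (w x))" for x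
    unfolding poly_eq_sum_shifted_powers[of f x t] sum_distrib_right scaleR_sum_right
    by (intro sum.cong refl) (simp add: scaleR_conv_of_real mult_ac)
  ultimately show ?thesis unfolding set_integrable_def by simp
qed

lemma tendsto_poly_mult_0:
  assumes "\<And>n. ((\<lambda>x. (x - t) ^ n * g x) \<longlongrightarrow> 0) F"
  shows "(weighted f g \<longlongrightarrow> 0) F"
proof -
  have "((\<lambda>x. \<Sum>k\<le>degree f. coeff (f \<circ>\<^sub>p [:complex_of_real t, 1:]) k *
      complex_of_real ((x - t) ^ k * g x)) \<longlongrightarrow>
      (\<Sum>k\<le>degree f. coeff (f \<circ>\<^sub>p [:complex_of_real t, 1:]) k * of_real 0)) F"
    by (intro tendsto_sum tendsto_mult_left tendsto_of_real assms)
  then show ?thesis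
    by (simp add: poly_eq_sum_shifted_powers[of f _ t] sum_distrib_right mult.assoc)
qed

definition weight_functional :: "real set \<Rightarrow> (real \<Rightarrow> real) \<Rightarrow> complex poly \<Rightarrow> complex" where
  "weight_functional S w f = integral S (weighted f w)"

text \<open>\<open>\<sigma>\<close> is a representation of \<open>\<rho> w\<close> that is convenient to differentiate.\<close>

locale pearson_weight =
  fixes a b :: ereal and w \<sigma> :: "real \<Rightarrow> real" and \<rho> v :: "complex poly"
  assumes a_less_b: "a < b"
    and set_integrable_w: "set_integrable lborel (einterval a b) (weighted f w)"
    and w_pos: "x \<in> einterval a b \<Longrightarrow> w x > 0"
    and isCont_w: "x \<in> einterval a b \<Longrightarrow> isCont w x"
    and \<rho>_mult_w: "x \<in> einterval a b \<Longrightarrow> weighted \<rho> w x = complex_of_real (\<sigma> x)"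
    and has_derivative_\<sigma>: "x \<in> einterval a b \<Longrightarrow>
      ((\<lambda>x. complex_of_real (\<sigma> x)) has_vector_derivative weighted v w x) (at x)"
    and boundary_a: "((weighted f \<sigma> \<circ> real_of_ereal) \<longlongrightarrow> 0) (at_right a)"
    and boundary_b: "((weighted f \<sigma> \<circ> real_of_ereal) \<longlongrightarrow> 0) (at_left b)"
    and degree_\<rho>: "degree \<rho> \<le> 2" and degree_v: "degree v \<le> 1"
begin

abbreviation "U \<equiv> weight_functional (einterval a b) w"

lemma integrable: "weighted f w integrable_on einterval a b"
  using set_integrable_w by (rule set_borel_integral_eq_integral)

lemma U_linear: "poly_functional U"
proof (rule poly_functionalI)
  show "U (f + g) = U f + U g" for f g
    unfolding weight_functional_def
    by (subst integral_add[OF integrable integrable, symmetric]) (simp add: distrib_right)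
  show "U (smult c f) = c * U f" for c f
    by (simp add: weight_functional_def mult.assoc)
qed

lemma U_cnj: "U (cnj_poly f) = cnj (U f)"
  by (simp add: weight_functional_def integral_cnj)

lemma U_norm:
  shows "U (f * cnj_poly f) =
      complex_of_real (integral (einterval a b) (\<lambda>x. (cmod (poly f (complex_of_real x)))\<^sup>2 * w x))"
      (is "_ = complex_of_real (integral _ ?g)")
    and integrable_norm: "(\<lambda>x. (cmod (poly f (complex_of_real x)))\<^sup>2 * w x) integrable_on einterval a b"
proof -
  have eq: "poly (f * cnj_poly f) (complex_of_real x) * complex_of_real (w x) =
      complex_of_real (?g x)" for x
    by (simp add: of_real_mult complex_norm_square[symmetric])
  have "(\<lambda>x. complex_of_real (?g x)) integrable_on einterval a b"
    using integrable[of "f * cnj_poly f"] unfolding eq .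
  from integrable_linear[OF this bounded_linear_Re] show g: "?g integrable_on einterval a b"
    by (simp add: o_def)
  show "U (f * cnj_poly f) = complex_of_real (integral (einterval a b) ?g)"
    unfolding weight_functional_def eq
    using has_integral_of_real[OF integrable_integral[OF g], where 'b = complex]
    by (rule integral_unique)
qed

lemma U_nonneg: "Re (U (f * cnj_poly f)) \<ge> 0"
  unfolding U_norm using w_pos by (auto intro!: integral_nonneg integrable_norm simp: less_imp_le)

lemma U_definite:
  assumes "U (f * cnj_poly f) = 0"
  shows "f = 0"
proof -
  let ?g = "\<lambda>x. (cmod (poly f (complex_of_real x)))\<^sup>2 * w x"
  obtain c where "a < ereal c" "ereal c < b" using ereal_dense2[OF a_less_b] by blast
  moreover obtain d where "ereal c < ereal d" "ereal d < b"
    using ereal_dense2[OF \<open>ereal c < b\<close>] by blast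
  ultimately have cd: "c < d" "{c..d} \<subseteq> einterval a b"
    by (auto simp: einterval_def) (metis ereal_less_eq(3) less_le_trans le_less_trans)+
  have cont: "continuous_on {c..d} ?g"
    using isCont_w cd(2) by (intro continuous_intros continuous_at_imp_continuous_on) auto
  have nonneg: "?g x \<ge> 0" if "x \<in> einterval a b" for x using w_pos[OF that] by simp
  have "integral {c..d} ?g \<le> integral (einterval a b) ?g"
    using cd nonneg cont by (intro integral_subset_le integrable_norm integrable_continuous_real) auto
  moreover have "integral (einterval a b) ?g = 0" using assms by (simp add: U_norm)
  moreover have "integral {c..d} ?g \<ge> 0"
    using cd nonneg cont by (intro integral_nonneg integrable_continuous_real) auto
  ultimately have "integral {c..d} ?g = 0" by simp
  then have "\<forall>x\<in>{c..d}. ?g x = 0"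
    using cd nonneg by (subst (asm) integral_eq_0_iff[OF cont cd(1)]) auto
  then have "poly f (complex_of_real x) = 0" if "x \<in> {c..d}" for x
    using w_pos[of x] that cd(2) by force
  then have "complex_of_real ` {c..d} \<subseteq> {x. poly f x = 0}" by auto
  moreover have "infinite (complex_of_real ` {c..d})"
    using cd(1) by (subst finite_image_iff) (auto intro: inj_onI)
  ultimately show "f = 0" using poly_roots_finite finite_subset by blast
qed

lemma U_pearson: "U (\<rho> * pderiv f + v * f) = 0"
proof -
  let ?F = "weighted f \<sigma>" and ?F' = "weighted (\<rho> * pderiv f + v * f) w"
  have "(LBINT x=a..b. ?F' x) = 0 - 0"
  proof (rule interval_integral_FTC_integrable[OF a_less_b _ _ set_integrable_w boundary_a boundary_b])
    fix x assume "a < ereal x" "ereal x < b"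
    then have x: "x \<in> einterval a b" by (simp add: einterval_def)
    have "((\<lambda>x. poly f (complex_of_real x)) has_vector_derivative
        poly (pderiv f) (complex_of_real x)) (at x)"
      by (rule has_vector_derivative_real_field) (rule poly_DERIV)
    from has_vector_derivative_mult[OF this has_derivative_\<sigma>[OF x]]
    show "(?F has_vector_derivative ?F' x) (at x)"
      by (simp add: \<rho>_mult_w[OF x, symmetric] algebra_simps)
    show "isCont ?F' x" by (intro continuous_intros isCont_w x)
  qed
  then show ?thesis
    unfolding weight_functional_def
    by (subst (asm) interval_integral_eq_integral'[OF less_imp_le[OF a_less_b] set_integrable_w]) simp
qed

sublocale pearson U \<rho> v
  using U_linear U_definite U_pearson degree_\<rho> degree_v
  by (intro pearson.intro definite_functional.intro functional.intro
      definite_functional_axioms.intro pearson_axioms.intro)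

end

section \<open>The classical weights\<close>

fun rho_poly :: "family \<Rightarrow> complex poly" where
  "rho_poly Hermite = 1"
| "rho_poly Laguerre = [:0, 1:]"
| "rho_poly Jacobi = [:1, 0, -1:]"

fun drift_poly :: "family \<Rightarrow> real \<Rightarrow> real \<Rightarrow> complex poly" where
  "drift_poly Hermite b _ = [:complex_of_real (2 * b), - 2:]"
| "drift_poly Laguerre \<alpha> _ = [:complex_of_real (\<alpha> + 1), - 1:]"
| "drift_poly Jacobi \<alpha> \<beta> = [:complex_of_real (\<beta> - \<alpha>), - complex_of_real (\<alpha> + \<beta> + 2):]"

fun valid_parameter :: "family \<Rightarrow> real \<Rightarrow> real \<Rightarrow> bool" where
  "valid_parameter Hermite _ _ \<longleftrightarrow> True"
| "valid_parameter Laguerre \<alpha> _ \<longleftrightarrow> \<alpha> > -1"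
| "valid_parameter Jacobi \<alpha> \<beta> \<longleftrightarrow> \<alpha> > -1 \<and> \<beta> > -1"

fun left_end :: "family \<Rightarrow> ereal" where
  "left_end Hermite = -\<infinity>"
| "left_end Laguerre = ereal 0"
| "left_end Jacobi = ereal (-1)"

fun right_end :: "family \<Rightarrow> ereal" where
  "right_end Hermite = \<infinity>"
| "right_end Laguerre = \<infinity>"
| "right_end Jacobi = ereal 1"

fun rho_mult_weight :: "family \<Rightarrow> real \<Rightarrow> real \<Rightarrow> real \<Rightarrow> real" where
  "rho_mult_weight Hermite b c = scalar_weight Hermite b c"
| "rho_mult_weight Laguerre \<alpha> \<beta> = scalar_weight Laguerre (\<alpha> + 1) \<beta>"
| "rho_mult_weight Jacobi \<alpha> \<beta> = scalar_weight Jacobi (\<alpha> + 1) (\<beta> + 1)"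

lemma support_eq_einterval: "support fam = einterval (left_end fam) (right_end fam)"
  by (cases fam) (simp_all add: einterval_eq)

lemma poly_rho_poly: "poly (rho_poly fam) (complex_of_real x) = complex_of_real (rho fam x)"
  by (cases fam) (simp_all add: power2_eq_square)

lemma scalar_weight_pos: "x \<in> support fam \<Longrightarrow> scalar_weight fam \<alpha> \<beta> x > 0"
  by (cases fam) auto

lemma isCont_scalar_weight: "x \<in> support fam \<Longrightarrow> isCont (scalar_weight fam \<alpha> \<beta>) x"
  by (cases fam) (auto intro!: continuous_intros simp: scalar_weight.simps[abs_def])

lemma rho_mult_weight_eq:
  assumes "x \<in> support fam"
  shows "rho fam x * scalar_weight fam \<alpha> \<beta> x = rho_mult_weight fam \<alpha> \<beta> x"
proof (cases fam)
  case Jacobi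
  have "1 - x\<^sup>2 = (1 - x) * (1 + x)" by (simp add: power2_eq_square algebra_simps)
  then show ?thesis using Jacobi assms by (simp add: powr_add)
qed (use assms in \<open>simp_all add: powr_add\<close>)

lemma has_real_derivative_rho_mult_weight:
  assumes "x \<in> support fam"
  shows "(rho_mult_weight fam \<alpha> \<beta> has_real_derivative
    Re (poly (drift_poly fam \<alpha> \<beta>) (complex_of_real x)) * scalar_weight fam \<alpha> \<beta> x) (at x)"
proof (cases fam)
  case Hermite
  show ?thesis
    unfolding Hermite rho_mult_weight.simps scalar_weight.simps[abs_def]
    by (auto intro!: derivative_eq_intros simp: algebra_simps)
next
  case Laguerre
  then have "x > 0" using assms by simp
  then have "x powr (\<alpha> + 1) = x * x powr \<alpha>" by (simp add: powr_add)
  then show ?thesis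
    using \<open>x > 0\<close> unfolding Laguerre rho_mult_weight.simps scalar_weight.simps[abs_def]
    by (auto intro!: derivative_eq_intros simp: algebra_simps)
next
  case Jacobi
  then have "1 - x > 0" "1 + x > 0" using assms by auto
  then have "((\<lambda>x. (1 - x) powr (\<alpha> + 1)) has_real_derivative - ((\<alpha> + 1) * (1 - x) powr \<alpha>)) (at x)"
    "((\<lambda>x. (1 + x) powr (\<beta> + 1)) has_real_derivative (\<beta> + 1) * (1 + x) powr \<beta>) (at x)"
    by (auto intro!: derivative_eq_intros)
  note derivative = DERIV_mult[OF this]
  have powers: "(1 - x) powr (\<alpha> + 1) = (1 - x) * (1 - x) powr \<alpha>"
    "(1 + x) powr (\<beta> + 1) = (1 + x) * (1 + x) powr \<beta>"
    using \<open>1 - x > 0\<close> \<open>1 + x > 0\<close> by (simp_all add: powr_add)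
  show ?thesis
    unfolding Jacobi rho_mult_weight.simps scalar_weight.simps[abs_def]
    by (rule DERIV_cong[OF derivative]) (unfold powers, simp add: algebra_simps)
qed

lemma drift_poly_real:
  "poly (drift_poly fam \<alpha> \<beta>) (complex_of_real x) =
    complex_of_real (Re (poly (drift_poly fam \<alpha> \<beta>) (complex_of_real x)))"
  by (cases fam) (simp_all add: complex_eq_iff)

lemma has_vector_derivative_rho_mult_weight:
  assumes "x \<in> support fam"
  shows "((\<lambda>x. complex_of_real (rho_mult_weight fam \<alpha> \<beta> x)) has_vector_derivative
    weighted (drift_poly fam \<alpha> \<beta>) (scalar_weight fam \<alpha> \<beta>) x) (at x)"
  using has_vector_derivative_of_real[OF has_real_derivative_rho_mult_weight[OF assms]]
  by (subst drift_poly_real) simp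

lemma set_integrable_hermite:
  "set_integrable lborel UNIV (\<lambda>x. (x - b) ^ n * scalar_weight Hermite b c x)"
proof -
  have "(x - b) ^ n * scalar_weight Hermite b c x =
      exp (b\<^sup>2) * sqrt pi * (normal_density b (1 / sqrt 2) x * (x - b) ^ n)" for x
  proof -
    have "normal_density b (1 / sqrt 2) x = 1 / sqrt pi * exp (- (x - b)\<^sup>2)"
      by (simp add: normal_density_def power_divide)
    moreover have "exp (- x\<^sup>2 + 2 * b * x) = exp (b\<^sup>2) * exp (- (x - b)\<^sup>2)"
      by (simp add: power2_diff flip: exp_add)
    ultimately show ?thesis by simp
  qed
  then have "(\<lambda>x. (x - b) ^ n * scalar_weight Hermite b c x) =
      (\<lambda>x. exp (b\<^sup>2) * sqrt pi * (normal_density b (1 / sqrt 2) x * (x - b) ^ n))" ..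
  moreover have "integrable lborel
      (\<lambda>x. exp (b\<^sup>2) * sqrt pi * (normal_density b (1 / sqrt 2) x * (x - b) ^ n))"
    by (intro integrable_mult_right integrable_normal_moment) simp
  ultimately show ?thesis by (simp only: set_integrable_def indicator_UNIV scaleR_one)
qed

lemma set_integrable_lborel_nonneg:
  fixes f :: "real \<Rightarrow> real"
  assumes "f integrable_on S" "\<And>x. x \<in> S \<Longrightarrow> 0 \<le> f x" "f \<in> borel_measurable borel" "S \<in> sets borel"
  shows "set_integrable lborel S f"
proof -
  have "set_integrable lebesgue S f"
    using assms(1,2) by (rule nonnegative_absolutely_integrable_1)
  then show ?thesis
    using assms(3,4) unfolding set_integrable_def by (subst (asm) integrable_completion) auto
qed

lemma set_integrable_laguerre:
  assumes "\<alpha> > -1"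
  shows "set_integrable lborel {0<..} (scalar_weight Laguerre \<alpha> \<beta>)"
proof (rule set_integrable_lborel_nonneg)
  have "((\<lambda>t. t powr \<alpha> / exp t) has_integral Gamma (\<alpha> + 1)) {0..}"
    using Gamma_integral_real[of "\<alpha> + 1"] assms by simp
  then have "(\<lambda>t. t powr \<alpha> / exp t) integrable_on {0<..}"
    by (subst integrable_spike_set_eq[where T = "{0..}"])
      (auto intro: negligible_subset[of "{0}"] simp: has_integral_integrable)
  then show "scalar_weight Laguerre \<alpha> \<beta> integrable_on {0<..}"
    by (rule integrable_eq) (simp add: exp_minus field_simps)
qed (auto simp: scalar_weight.simps[abs_def])

lemma set_integrable_jacobi:
  assumes "\<alpha> > -1" "\<beta> > -1"
  shows "set_integrable lborel {-1<..<1} (scalar_weight Jacobi \<alpha> \<beta>)"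
proof (rule set_integrable_lborel_nonneg)
  let ?f = "\<lambda>t::real. t powr \<beta> * (1 - t) powr \<alpha>"
  have "(?f has_integral Beta (\<beta> + 1) (\<alpha> + 1)) (cbox 0 1)"
    using has_integral_Beta_real[of "\<beta> + 1" "\<alpha> + 1"] assms by simp
  from has_integral_affinity'[OF this, of "1 / 2" "1 / 2"]
  have "(\<lambda>x. ?f ((x + 1) / 2)) integrable_on {-1..1}"
    by (auto simp: field_simps integrable_on_def)
  then have "(\<lambda>x. 2 powr \<beta> * 2 powr \<alpha> * ?f ((x + 1) / 2)) integrable_on {-1<..<1}"
    by (intro integrable_on_mult_right) (simp add: integrable_on_Icc_iff_Ioo)
  then show "scalar_weight Jacobi \<alpha> \<beta> integrable_on {-1<..<1}"
  proof (rule integrable_eq)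
    fix x :: real assume x: "x \<in> {-1<..<1}"
    have reflect: "1 - (x + 1) / 2 = (1 - x) / 2" by (simp add: field_simps)
    show "2 powr \<beta> * 2 powr \<alpha> * ?f ((x + 1) / 2) = scalar_weight Jacobi \<alpha> \<beta> x"
      unfolding reflect using x by (simp add: powr_divide add.commute)
  qed
qed (auto simp: scalar_weight.simps[abs_def])

lemma set_integrable_poly_mult_weight:
  assumes "valid_parameter fam \<alpha> \<beta>"
  shows "set_integrable lborel (support fam) (weighted f (scalar_weight fam \<alpha> \<beta>))"
proof (cases fam)
  case Hermite
  then show ?thesis using set_integrable_hermite by (auto intro!: set_integrable_poly_mult[where t = \<alpha>])
next
  case Laguerre
  have "(x - 0) ^ n * scalar_weight Laguerre \<alpha> \<beta> x = scalar_weight Laguerre (\<alpha> + of_nat n) \<beta> x"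
    if "x \<in> {0<..}" for n and x :: real
    using that by (simp add: powr_add powr_realpow mult_ac)
  then have "set_integrable lborel {0<..} (\<lambda>x. (x - 0) ^ n * scalar_weight Laguerre \<alpha> \<beta> x)" for n
    using set_integrable_laguerre[of "\<alpha> + of_nat n" \<beta>] assms Laguerre
    by (subst set_integrable_cong) auto
  then show ?thesis unfolding Laguerre support.simps by (rule set_integrable_poly_mult)
next
  case Jacobi
  have "(x - (- 1)) ^ n * scalar_weight Jacobi \<alpha> \<beta> x = scalar_weight Jacobi \<alpha> (\<beta> + of_nat n) x"
    if "x \<in> {-1<..<1}" for n and x :: real
    using that by (simp add: powr_add powr_realpow mult_ac add.commute)
  then have "set_integrable lborel {-1<..<1} (\<lambda>x. (x - (- 1)) ^ n * scalar_weight Jacobi \<alpha> \<beta> x)" for n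
    using set_integrable_jacobi[of \<alpha> "\<beta> + of_nat n"] assms Jacobi
    by (subst set_integrable_cong) auto
  then show ?thesis unfolding Jacobi support.simps by (rule set_integrable_poly_mult)
qed

lemma rho_mult_weight_boundary:
  assumes "valid_parameter fam \<alpha> \<beta>"
  obtains t where
    "\<forall>n. (((\<lambda>x. (x - t) ^ n * rho_mult_weight fam \<alpha> \<beta> x) \<circ> real_of_ereal) \<longlongrightarrow> 0) (at_right (left_end fam))"
    "\<forall>n. (((\<lambda>x. (x - t) ^ n * rho_mult_weight fam \<alpha> \<beta> x) \<circ> real_of_ereal) \<longlongrightarrow> 0) (at_left (right_end fam))"
proof (cases fam)
  case Hermite
  have "((\<lambda>x. (x - \<alpha>) ^ n * exp (- x\<^sup>2 + 2 * \<alpha> * x)) \<longlongrightarrow> 0) at_bot"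
    "((\<lambda>x. (x - \<alpha>) ^ n * exp (- x\<^sup>2 + 2 * \<alpha> * x)) \<longlongrightarrow> 0) at_top" for n
    by real_asymp+
  then show ?thesis using Hermite by (intro that[of \<alpha>]) (simp_all add: ereal_tendsto_simps)
next
  case Laguerre
  then have "\<alpha> > -1" using assms by simp
  then have "((\<lambda>x. (x - 0) ^ n * (exp (- x) * x powr (\<alpha> + 1))) \<longlongrightarrow> 0) (at_right 0)"
    "((\<lambda>x. (x - 0) ^ n * (exp (- x) * x powr (\<alpha> + 1))) \<longlongrightarrow> 0) at_top" for n
    by real_asymp+
  then show ?thesis using Laguerre by (intro that[of 0]) (simp_all add: ereal_tendsto_simps)
next
  case Jacobi
  then have "\<alpha> > -1" "\<beta> > -1" using assms by simp_all
  then have "((\<lambda>x. (x - 0) ^ n * ((1 - x) powr (\<alpha> + 1) * (1 + x) powr (\<beta> + 1))) \<longlongrightarrow> 0) (at_right (- 1))"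
    "((\<lambda>x. (x - 0) ^ n * ((1 - x) powr (\<alpha> + 1) * (1 + x) powr (\<beta> + 1))) \<longlongrightarrow> 0) (at_left 1)" for n
    by real_asymp+
  then show ?thesis using Jacobi by (intro that[of 0]) (simp_all add: ereal_tendsto_simps)
qed

lemma pearson_weight_classical:
  assumes "valid_parameter fam \<alpha> \<beta>"
  shows "pearson_weight (left_end fam) (right_end fam) (scalar_weight fam \<alpha> \<beta>)
    (rho_mult_weight fam \<alpha> \<beta>) (rho_poly fam) (drift_poly fam \<alpha> \<beta>)"
proof (rule pearson_weight.intro)
  show "left_end fam < right_end fam" by (cases fam) auto
  show "((\<lambda>x. complex_of_real (rho_mult_weight fam \<alpha> \<beta> x)) has_vector_derivative
      weighted (drift_poly fam \<alpha> \<beta>) (scalar_weight fam \<alpha> \<beta>) x) (at x)"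
    if "x \<in> einterval (left_end fam) (right_end fam)" for x
    using that by (intro has_vector_derivative_rho_mult_weight) (simp add: support_eq_einterval)
  obtain t where t:
    "\<forall>n. (((\<lambda>x. (x - t) ^ n * rho_mult_weight fam \<alpha> \<beta> x) \<circ> real_of_ereal) \<longlongrightarrow> 0) (at_right (left_end fam))"
    "\<forall>n. (((\<lambda>x. (x - t) ^ n * rho_mult_weight fam \<alpha> \<beta> x) \<circ> real_of_ereal) \<longlongrightarrow> 0) (at_left (right_end fam))"
    using assms by (rule rho_mult_weight_boundary)
  show "((weighted f (rho_mult_weight fam \<alpha> \<beta>) \<circ> real_of_ereal) \<longlongrightarrow> 0)
      (at_right (left_end fam))"
    and "((weighted f (rho_mult_weight fam \<alpha> \<beta>) \<circ> real_of_ereal) \<longlongrightarrow> 0)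
      (at_left (right_end fam))" for f
    using t unfolding tendsto_compose_filtermap by (auto intro: tendsto_poly_mult_0)
  show "degree (rho_poly fam) \<le> 2" "degree (drift_poly fam \<alpha> \<beta>) \<le> 1" by (cases fam; simp)+
qed (use assms set_integrable_poly_mult_weight in
    \<open>auto simp: poly_rho_poly rho_mult_weight_eq scalar_weight_pos isCont_scalar_weight
      simp flip: support_eq_einterval of_real_mult\<close>)

lemma
  assumes "valid_parameter fam \<alpha> \<beta>"
  defines "u \<equiv> weight_functional (support fam) (scalar_weight fam \<alpha> \<beta>)"
  shows pearson_classical: "pearson u (rho_poly fam) (drift_poly fam \<alpha> \<beta>)"
    and classical_functional_nonneg: "Re (u (f * cnj_poly f)) \<ge> 0"
    and classical_functional_cnj: "u (cnj_poly f) = cnj (u f)"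
    and integrable_poly_mult_weight:
      "weighted f (scalar_weight fam \<alpha> \<beta>) integrable_on support fam"
proof -
  interpret pearson_weight "left_end fam" "right_end fam" "scalar_weight fam \<alpha> \<beta>"
    "rho_mult_weight fam \<alpha> \<beta>" "rho_poly fam" "drift_poly fam \<alpha> \<beta>"
    using assms(1) by (rule pearson_weight_classical)
  show "pearson u (rho_poly fam) (drift_poly fam \<alpha> \<beta>)" "Re (u (f * cnj_poly f)) \<ge> 0"
    "u (cnj_poly f) = cnj (u f)"
    "weighted f (scalar_weight fam \<alpha> \<beta>) integrable_on support fam"
    unfolding u_def support_eq_einterval using pearson_axioms U_nonneg U_cnj integrable by blast+
qed

lemma has_vector_derivative_rho_mult_scalar_weight:
  assumes "x \<in> support fam"
  shows "((\<lambda>x. complex_of_real (rho fam x * scalar_weight fam \<alpha> \<beta> x)) has_vector_derivative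
    weighted (drift_poly fam \<alpha> \<beta>) (scalar_weight fam \<alpha> \<beta>) x) (at x)"
proof -
  have "open (support fam)" by (simp add: support_eq_einterval)
  with has_vector_derivative_rho_mult_weight[OF assms]
  show ?thesis
    using assms by (rule has_vector_derivative_transform_within_open) (simp add: rho_mult_weight_eq)
qed

lemma rsquarefree_rho_poly: "rsquarefree (rho_poly fam)"
  unfolding rsquarefree_roots by (cases fam) (auto simp: pderiv_pCons)

section \<open>Separation of the classical weights\<close>

lemma log_derivative_residue_int:
  fixes R S \<sigma> \<tau> :: "complex poly"
  assumes "[:- t, 1:] * \<sigma> * wronskian R S = R * S * \<tau>" "R \<noteq> 0" "S \<noteq> 0"
    and "poly \<sigma> t \<noteq> 0" "poly \<tau> t = poly \<sigma> t * complex_of_real y"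
  shows "y \<in> \<int>"
proof -
  have "complex_of_real y =
      complex_of_real (of_nat (Polynomial.order t S) - of_nat (Polynomial.order t R))"
    using log_derivative_residue[OF assms(1-3)] assms(4,5) by simp
  then have "y = of_nat (Polynomial.order t S) - of_nat (Polynomial.order t R)"
    by (simp only: of_real_eq_iff)
  then show ?thesis by simp
qed

lemma hermite_separated:
  assumes "rho_poly Hermite * wronskian R S =
      R * S * (drift_poly Hermite b c - drift_poly Hermite b' c')"
    and "R \<noteq> 0" "S \<noteq> 0"
  shows "b = b'"
proof -
  have "wronskian R S = smult (complex_of_real (2 * b - 2 * b')) (R * S)"
    using assms(1) by (simp add: mult.commute)
  then have "complex_of_real (2 * b - 2 * b') = 0" using assms(2,3) by (rule wronskian_eq_smult_imp_0)
  then show ?thesis by (simp only: of_real_eq_0_iff)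
qed

lemma laguerre_separated:
  assumes "rho_poly Laguerre * wronskian R S =
      R * S * (drift_poly Laguerre \<alpha> \<beta> - drift_poly Laguerre \<alpha>' \<beta>')"
    and "R \<noteq> 0" "S \<noteq> 0"
  shows "\<alpha> - \<alpha>' \<in> \<int>"
proof -
  have "[:- 0, 1:] * 1 * wronskian R S = R * S * [:complex_of_real (\<alpha> - \<alpha>'):]"
    using assms(1) by simp
  then show ?thesis using assms(2,3) by (rule log_derivative_residue_int) simp_all
qed

lemma jacobi_separated:
  assumes eq: "rho_poly Jacobi * wronskian R S =
      R * S * (drift_poly Jacobi \<alpha> \<beta> - drift_poly Jacobi \<alpha>' \<beta>')"
      (is "_ = _ * ?\<tau>")
    and nz: "R \<noteq> 0" "S \<noteq> 0"
  shows "\<alpha> - \<alpha>' \<in> \<int>" "\<beta> - \<beta>' \<in> \<int>"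
proof -
  have "rho_poly Jacobi = [:- 1, 1:] * [:- 1, - 1:]" by simp
  then have "[:- 1, 1:] * [:- 1, - 1:] * wronskian R S = R * S * ?\<tau>" using eq by (simp only:)
  then show "\<alpha> - \<alpha>' \<in> \<int>"
    using nz by (rule log_derivative_residue_int) (simp_all add: algebra_simps)
  have "rho_poly Jacobi = [:- (- 1), 1:] * [:1, - 1:]" by simp
  then have "[:- (- 1), 1:] * [:1, - 1:] * wronskian R S = R * S * ?\<tau>" using eq by (simp only:)
  then show "\<beta> - \<beta>' \<in> \<int>"
    using nz by (rule log_derivative_residue_int) (simp_all add: algebra_simps)
qed

section \<open>Matrix bookkeeping\<close>

lemma eval_pmat_carrier: "P \<in> carrier_mat n m \<Longrightarrow> eval_pmat P x \<in> carrier_mat n m"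
  by (simp add: eval_pmat_def)

lemma eval_pmat_index: "P \<in> carrier_mat n m \<Longrightarrow> i < n \<Longrightarrow> j < m \<Longrightarrow>
    eval_pmat P x $$ (i, j) = poly (P $$ (i, j)) (complex_of_real x)"
  by (simp add: eval_pmat_def)

lemma eval_pmat_mult:
  assumes "P \<in> carrier_mat n m" "Q \<in> carrier_mat m l"
  shows "eval_pmat (P * Q) x = eval_pmat P x * eval_pmat Q x"
  using assms by (intro eq_matI) (auto simp: eval_pmat_def scalar_prod_def poly_sum)

lemma mat_adjoint_carrier: "P \<in> carrier_mat n m \<Longrightarrow> mat_adjoint P \<in> carrier_mat m n"
  by (auto simp: mat_adjoint_def)

lemma mat_adjoint_index:
  "P \<in> carrier_mat n m \<Longrightarrow> i < m \<Longrightarrow> j < n \<Longrightarrow> mat_adjoint P $$ (i, j) = cnj (P $$ (j, i))"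
  by (simp add: mat_adjoint_def mat_of_rows_index)

lemma mat_adjoint_mult:
  fixes P Q :: "complex mat"
  assumes P: "P \<in> carrier_mat n m" and Q: "Q \<in> carrier_mat m l"
  shows "mat_adjoint (P * Q) = mat_adjoint Q * mat_adjoint P"
proof (rule eq_matI)
  note carriers = mat_adjoint_carrier[OF P] mat_adjoint_carrier[OF Q]
    mat_adjoint_carrier[OF mult_carrier_mat[OF P Q]]
  show "dim_row (mat_adjoint (P * Q)) = dim_row (mat_adjoint Q * mat_adjoint P)"
    "dim_col (mat_adjoint (P * Q)) = dim_col (mat_adjoint Q * mat_adjoint P)"
    using carriers by simp_all
  fix i j
  assume "i < dim_row (mat_adjoint Q * mat_adjoint P)" "j < dim_col (mat_adjoint Q * mat_adjoint P)"
  then have "i < l" "j < n" using carriers by simp_all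
  then show "mat_adjoint (P * Q) $$ (i, j) = (mat_adjoint Q * mat_adjoint P) $$ (i, j)"
    using P Q carriers
    by (simp add: mat_adjoint_index[OF mult_carrier_mat[OF P Q]] scalar_prod_def
        mat_adjoint_index[OF P] mat_adjoint_index[OF Q] mult.commute)
qed

lemma mult_mat_diag_adjoint_index:
  fixes G H :: "complex mat"
  assumes G: "G \<in> carrier_mat n m" and H: "H \<in> carrier_mat l m" and "i < n" "j < l"
  shows "(G * mat_diag m d * mat_adjoint H) $$ (i, j) = (\<Sum>k<m. G $$ (i, k) * d k * cnj (H $$ (j, k)))"
  using assms mat_adjoint_carrier[OF H]
  by (simp add: mat_diag_mult_right[OF G] scalar_prod_def mat_adjoint_index[OF H] atLeast0LessThan)

lemma minv_eqI:
  assumes "M \<in> carrier_mat n n" "M' \<in> carrier_mat n n" "M * M' = 1\<^sub>m n"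
  shows "minv M = M'"
proof -
  have left: "M' * M = 1\<^sub>m n" using assms by (rule mat_mult_left_right_inverse)
  then have "mat_inverse M \<noteq> None"
    using mat_inverse(1)[OF assms(1)] assms by (auto simp: Units_def ring_mat_def)
  then obtain B where "mat_inverse M = Some B" by auto
  then have B: "M * B = 1\<^sub>m n" "B \<in> carrier_mat n n" "minv M = B"
    using mat_inverse(2)[OF assms(1)] by (auto simp: minv_def)
  have "B = (M' * M) * B" using B left by simp
  also have "\<dots> = M' * (M * B)" using B assms by (intro assoc_mult_mat) auto
  finally show ?thesis using B assms by simp
qed

lemma minv_one_plus_nilpotent:
  assumes Z: "Z \<in> carrier_mat n n" and "Z * Z = 0\<^sub>m n n"
  shows "minv (1\<^sub>m n + Z) = 1\<^sub>m n - Z" "(1\<^sub>m n + Z) * (1\<^sub>m n - Z) = 1\<^sub>m n"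
proof -
  have "(1\<^sub>m n + Z) * (1\<^sub>m n - Z) = 1\<^sub>m n * (1\<^sub>m n - Z) + Z * (1\<^sub>m n - Z)"
    using Z by (intro add_mult_distrib_mat) auto
  also have "Z * (1\<^sub>m n - Z) = Z * 1\<^sub>m n - Z * Z"
    using Z by (intro mult_minus_distrib_mat) auto
  finally show inverse: "(1\<^sub>m n + Z) * (1\<^sub>m n - Z) = 1\<^sub>m n"
    unfolding assms(2) using Z by (auto intro!: eq_matI)
  then show "minv (1\<^sub>m n + Z) = 1\<^sub>m n - Z" using Z by (intro minv_eqI) auto
qed

lemma Wtilde_eq_mat_diag:
  "Wtilde fam N p q x = mat_diag N (\<lambda>k. complex_of_real (scalar_weight fam (p (Suc k)) (q (Suc k)) x))"
  by (auto simp: Wtilde_def mat_diag_def intro!: eq_matI)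

lemma log_derivative_Wtilde:
  assumes x: "x \<in> support fam"
  shows "mat_vderiv N (\<lambda>t. complex_of_real (rho fam t) \<cdot>\<^sub>m Wtilde fam N p q t) x
      * minv (Wtilde fam N p q x) =
    mat_diag N (\<lambda>k. poly (drift_poly fam (p (Suc k)) (q (Suc k))) (complex_of_real x))"
proof -
  let ?w = "\<lambda>k t. complex_of_real (scalar_weight fam (p (Suc k)) (q (Suc k)) t)"
  let ?v = "\<lambda>k. poly (drift_poly fam (p (Suc k)) (q (Suc k))) (complex_of_real x)"
  have w: "scalar_weight fam (p (Suc k)) (q (Suc k)) x \<noteq> 0" for k
    using scalar_weight_pos[OF x, of "p (Suc k)" "q (Suc k)"] by simp
  have inverse: "minv (Wtilde fam N p q x) = mat_diag N (\<lambda>k. 1 / ?w k x)"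
    by (rule minv_eqI[where n = N]) (simp_all add: Wtilde_eq_mat_diag w)
  have "mat_vderiv N (\<lambda>t. complex_of_real (rho fam t) \<cdot>\<^sub>m Wtilde fam N p q t) x =
      mat_diag N (\<lambda>k. ?v k * ?w k x)"
    unfolding mat_vderiv_def mat_diag_def
  proof (intro cong_mat refl, clarify)
    fix i j assume "i < N" "j < N"
    then have "(\<lambda>t. (complex_of_real (rho fam t) \<cdot>\<^sub>m Wtilde fam N p q t) $$ (i, j)) =
        (\<lambda>t. if i = j then complex_of_real (rho fam t * scalar_weight fam (p (Suc j)) (q (Suc j)) t)
          else 0)"
      by (auto simp: Wtilde_def)
    then show "vector_derivative
        (\<lambda>t. (complex_of_real (rho fam t) \<cdot>\<^sub>m Wtilde fam N p q t) $$ (i, j)) (at x) =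
        (if i = j then ?v j * ?w j x else 0)"
      using vector_derivative_at[OF has_vector_derivative_rho_mult_scalar_weight[OF x,
          of "p (Suc j)" "q (Suc j)"]]
      by simp
  qed
  then show ?thesis by (simp add: inverse w)
qed

fun shift :: "family \<Rightarrow> (nat \<Rightarrow> real) \<Rightarrow> (nat \<Rightarrow> real) \<Rightarrow> complex" where
  "shift Hermite _ _ = 2"
| "shift Laguerre _ _ = 1"
| "shift Jacobi \<alpha> \<beta> = complex_of_real (\<alpha> 1 + \<beta> 1)"

lemma Ktilde_eq_mat_diag: "Ktilde fam N p q = mat_diag N (\<lambda>k. if odd k then shift fam p q else 0)"
  by (cases fam) (auto simp: Kmat_def mat_diag_def intro!: eq_matI)

lemma Amat_index:
  "i < N \<Longrightarrow> j < N \<Longrightarrow> Amat N a $$ (i, j) =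
    (if even i \<and> j = Suc i then complex_of_real (a (Suc i))
     else if odd j \<and> i = Suc j then complex_of_real (a (Suc j)) else 0)"
  by (auto simp: Amat_def Let_def)

lemma Amat_squared: "Amat N a * Amat N a = 0\<^sub>m N N"
proof (rule eq_matI)
  fix i j assume "i < dim_row (0\<^sub>m N N :: complex mat)" "j < dim_col (0\<^sub>m N N :: complex mat)"
  then have ij: "i < N" "j < N" by simp_all
  have "Amat N a $$ (i, k) * Amat N a $$ (k, j) = 0" if "k < N" for k
    using ij that by (auto simp: Amat_index)
  moreover have "Amat N a \<in> carrier_mat N N" by (simp add: Amat_def)
  ultimately show "(Amat N a * Amat N a) $$ (i, j) = 0\<^sub>m N N $$ (i, j)"
    using ij by (auto simp: scalar_prod_def intro!: sum.neutral)
qed (simp_all add: Amat_def)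

lemma Tpoly_carrier: "Tpoly N a \<in> carrier_mat N N"
  by (simp add: Tpoly_def Amat_def)

lemma Tpoly_index: "i < N \<Longrightarrow> j < N \<Longrightarrow>
    Tpoly N a $$ (i, j) = (if i = j then 1 else 0) + [:0, Amat N a $$ (i, j):]"
  by (simp add: Tpoly_def Amat_def)

lemma minv_eval_Tpoly:
  shows "minv (eval_pmat (Tpoly N a) x) \<in> carrier_mat N N"
    and "eval_pmat (Tpoly N a) x * minv (eval_pmat (Tpoly N a) x) = 1\<^sub>m N"
proof -
  let ?Z = "complex_of_real x \<cdot>\<^sub>m Amat N a"
  have A: "Amat N a \<in> carrier_mat N N" by (simp add: Amat_def)
  have "?Z * ?Z = 0\<^sub>m N N"
    using A
      by (simp add: mult_smult_assoc_mat[of _ N N _ N] mult_smult_distrib[of _ N N _ N] Amat_squared)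
  moreover have "eval_pmat (Tpoly N a) x = 1\<^sub>m N + ?Z"
    using A Tpoly_carrier[of N a] by (intro eq_matI) (auto simp: eval_pmat_def Tpoly_index)
  ultimately show "minv (eval_pmat (Tpoly N a) x) \<in> carrier_mat N N"
    "eval_pmat (Tpoly N a) x * minv (eval_pmat (Tpoly N a) x) = 1\<^sub>m N"
    using minv_one_plus_nilpotent[of ?Z N] A by auto
qed

section \<open>The Darboux transforms of the classical weights\<close>

locale classical_darboux =
  fixes fam :: family and N :: nat and a p q :: "nat \<Rightarrow> real"
  assumes N_ge_2: "N \<ge> 2"
    and a_neq_0: "\<forall>j\<in>{1..N-1}. a j \<noteq> 0"
    and admissible: "admissible fam N p q"
begin

definition u :: "nat \<Rightarrow> complex poly \<Rightarrow> complex" where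
  "u k = weight_functional (support fam) (scalar_weight fam (p (Suc k)) (q (Suc k)))"

definition v :: "nat \<Rightarrow> complex poly" where
  "v k = drift_poly fam (p (Suc k)) (q (Suc k))"

definition A :: "nat \<Rightarrow> nat \<Rightarrow> complex" where
  "A i j = (if i < N \<and> j < N then Amat N a $$ (i, j) else 0)"

definition \<kappa> :: "nat \<Rightarrow> complex" where
  "\<kappa> k = (if odd k then shift fam p q else 0)"

lemma valid: "k < N \<Longrightarrow> valid_parameter fam (p (Suc k)) (q (Suc k))"
  using admissible by (cases fam) auto

lemma weights_separated:
  assumes ij: "i < N" "j < N" "i \<noteq> j" and eq: "rho_poly fam * wronskian R S = R * S * (v i - v j)"
  shows "R = 0 \<or> S = 0"
proof (rule ccontr)
  assume "\<not> (R = 0 \<or> S = 0)"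
  then have nz: "R \<noteq> 0" "S \<noteq> 0" by auto
  have indices: "Suc i \<in> {1..N}" "Suc j \<in> {1..N}" "Suc i \<noteq> Suc j" using ij by auto
  note eq = eq[unfolded v_def]
  show False
  proof (cases fam)
    case Hermite
    then show False using hermite_separated[OF eq[unfolded Hermite] nz] admissible indices by simp
  next
    case Laguerre
    then show False using laguerre_separated[OF eq[unfolded Laguerre] nz] admissible indices by auto
  next
    case Jacobi
    then show False using jacobi_separated[OF eq[unfolded Jacobi] nz] admissible indices by auto
  qed
qed

lemma eigenvalues_intertwine:
  assumes "A r c \<noteq> 0"
  shows "bochner_eigenvalue (rho_poly fam) (v c) (Suc n) + \<kappa> c =
    bochner_eigenvalue (rho_poly fam) (v r) n + \<kappa> r"
proof -
  have parity: "even r" "odd c" and bound: "r < N" "c < N"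
    using assms by (auto simp: A_def Amat_index split: if_splits)
  show ?thesis
  proof (cases fam)
    case Jacobi
    have "p 1 + q 1 = p (Suc k) + q (Suc k) + 1 + (- 1) ^ Suc k" if "k < N" for k
    proof -
      have "Suc k \<in> {1..N}" using that by simp
      then show ?thesis using admissible unfolding Jacobi admissible.simps by blast
    qed
    from this[OF bound(1)] this[OF bound(2)]
    have "p (Suc c) + q (Suc c) + 2 = p 1 + q 1" "p (Suc r) + q (Suc r) + 2 = p 1 + q 1 + 2"
      using parity by simp_all
    moreover have "coeff (v k) 1 = - complex_of_real (p (Suc k) + q (Suc k) + 2)" for k
      unfolding v_def by (simp add: Jacobi)
    ultimately have drift: "coeff (v c) 1 = - complex_of_real (p 1 + q 1)"
      "coeff (v r) 1 = - complex_of_real (p 1 + q 1 + 2)"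
      by (simp_all only:)
    have "\<kappa> c = complex_of_real (p 1 + q 1)" "\<kappa> r = 0" "coeff (rho_poly fam) 2 = - 1"
      unfolding \<kappa>_def using parity by (simp_all add: Jacobi numeral_2_eq_2)
    then show ?thesis unfolding bochner_eigenvalue_def drift by (simp add: algebra_simps)
  qed (unfold bochner_eigenvalue_def v_def \<kappa>_def,
      use parity in \<open>auto simp: numeral_2_eq_2 algebra_simps\<close>)
qed

sublocale darboux N u "rho_poly fam" v A \<kappa>
proof (rule darboux.intro)
  show "0 < N" using N_ge_2 by simp
  show "pearson (u k) (rho_poly fam) (v k)" if "k < N" for k
    unfolding u_def v_def by (rule pearson_classical[OF valid[OF that]])
  show "0 \<le> Re (u k (f * cnj_poly f))" if "k < N" for k f
    unfolding u_def by (rule classical_functional_nonneg[OF valid[OF that]])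
  show "u k (cnj_poly f) = cnj (u k f)" if "k < N" for k f
    unfolding u_def by (rule classical_functional_cnj[OF valid[OF that]])
  show "even i \<and> odd j \<and> i < N \<and> j < N" if "A i j \<noteq> 0" for i j
    using that by (auto simp: A_def Amat_index split: if_splits)
  show "cnj (A i j) = A i j" for i j by (simp add: A_def Amat_index)
  show "A i (Suc i) \<noteq> 0" if "Suc i < N" "even i" for i
    using that a_neq_0 by (simp add: A_def Amat_index)
  show "A (Suc i) i \<noteq> 0" if "Suc i < N" "odd i" for i
    using that a_neq_0 by (simp add: A_def Amat_index)
qed (fact rsquarefree_rho_poly eigenvalues_intertwine weights_separated)+

lemma row_of_mult_Tpoly:
  assumes P: "P \<in> carrier_mat N N" and i: "i < N"
  shows "row_of (P * Tpoly N a) i = T (row_of P i)"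
proof
  fix k
  have "row_of (P * Tpoly N a) i k = T (row_of P i) k" if k: "k < N"
  proof -
    have "row_of (P * Tpoly N a) i k = (\<Sum>r<N. P $$ (i, r) * ((if r = k then 1 else 0) + X r k))"
      using P Tpoly_carrier[of N a] i k
      by (simp add: row_of_def scalar_prod_def Tpoly_index X_def A_def atLeast0LessThan)
    then show ?thesis
      using P i k by (simp add: T_def X_act_def row_of_def distrib_left sum.distrib
          if_distrib[of "\<lambda>x. _ * x"] mult.commute cong: if_cong)
  qed
  then show "row_of (P * Tpoly N a) i k = T (row_of P i) k"
    using P Tpoly_carrier[of N a] by (cases "k < N") (simp_all add: T_outside row_of_def)
qed

lemma eval_mult_Tpoly_index:
  assumes "P \<in> carrier_mat N N" "i < N" "k < N"
  shows "(eval_pmat P x * eval_pmat (Tpoly N a) x) $$ (i, k) =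
    poly (T (row_of P i) k) (complex_of_real x)"
proof -
  have carrier: "P * Tpoly N a \<in> carrier_mat N N"
    using assms(1) Tpoly_carrier by (rule mult_carrier_mat)
  then have "(P * Tpoly N a) $$ (i, k) = T (row_of P i) k"
    using row_of_apply[OF carrier, of i k] row_of_mult_Tpoly[OF assms(1,2)] assms(3)
    by (simp del: index_mult_mat(1))
  then show ?thesis
    using eval_pmat_index[OF carrier assms(2,3)]
    by (simp add: eval_pmat_mult[OF assms(1) Tpoly_carrier])
qed

lemma mip_index:
  assumes P: "P \<in> carrier_mat N N" and Q: "Q \<in> carrier_mat N N" and ij: "i < N" "j < N"
  shows "(eval_pmat P x * Wmat fam N a p q x * mat_adjoint (eval_pmat Q x)) $$ (i, j) =
    (\<Sum>k<N. weighted (T (row_of P i) k * T (cnj_row (row_of Q j)) k)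
      (scalar_weight fam (p (Suc k)) (q (Suc k))) x)"
proof -
  define E F Tx Wx where "E = eval_pmat P x" and "F = eval_pmat Q x" and "Tx = eval_pmat (Tpoly N a) x"
    and "Wx = Wtilde fam N p q x"
  have carrier: "E \<in> carrier_mat N N" "F \<in> carrier_mat N N"
    "Tx \<in> carrier_mat N N" "Wx \<in> carrier_mat N N"
    using P Q Tpoly_carrier
    by (auto simp: E_def F_def Tx_def Wx_def Wtilde_def intro: eval_pmat_carrier)
  note adjoint = mat_adjoint_carrier[OF carrier(2)] mat_adjoint_carrier[OF carrier(3)]
  have "E * (Tx * Wx * mat_adjoint Tx) * mat_adjoint F = (E * Tx) * Wx * mat_adjoint (F * Tx)"
    using carrier adjoint
    by (simp add: mat_adjoint_mult[of F N N Tx N] assoc_mult_mat[of _ N N _ N _ N])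
  then show ?thesis
    using carrier ij eval_mult_Tpoly_index[OF P ij(1)] eval_mult_Tpoly_index[OF Q ij(2)]
    by (simp add: Wmat_def E_def F_def Tx_def Wx_def Wtilde_eq_mat_diag
        mult_mat_diag_adjoint_index[where n = N and m = N and l = N] T_cnj_row mult_ac
        del: index_mult_mat(1))
qed

sublocale darboux_weight N u "rho_poly fam" v A \<kappa> "Wmat fam N a p q" "support fam"
proof
  fix P Q :: pmat assume P: "P \<in> carrier_mat N N" and Q: "Q \<in> carrier_mat N N"
  have "integral (support fam)
        (\<lambda>x. (eval_pmat P x * Wmat fam N a p q x * mat_adjoint (eval_pmat Q x)) $$ (i, j)) =
      form (row_of P i) (cnj_row (row_of Q j))" if "i < N" "j < N" for i j
    unfolding mip_index[OF P Q that] form_def u_def weight_functional_def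
    by (intro integral_sum integrable_poly_mult_weight valid) auto
  then show "mip N (Wmat fam N a p q) (support fam) P Q =
      mat N N (\<lambda>(i, j). form (row_of P i) (cnj_row (row_of Q j)))"
    unfolding mip_def by (intro cong_mat) auto
qed

lemma dop_act_D_coeffs_mult_Tpoly_index:
  assumes P: "P \<in> carrier_mat N N" and "i < N" "k < N"
  shows "T (row_of (dop_act D_coeffs P) i) k = \<delta> k ((P * Tpoly N a) $$ (i, k))"
proof -
  have "T (row_of (dop_act D_coeffs P) i) = diag_op N \<delta> (row_of (P * Tpoly N a) i)"
    using assms
    by (simp add: row_of_dop_act[OF wf_D_coeffs] dop_row_act_D_coeffs D_def T_T_inv row_of_mult_Tpoly)
  then show ?thesis
    using row_of_apply[OF mult_carrier_mat[OF P Tpoly_carrier[of N a]], of i k] assms(3)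
    by (simp add: diag_op_def del: index_mult_mat(1))
qed

lemma eval_dop_act_D_coeffs_mult_Tpoly:
  fixes x :: real
  assumes P: "P \<in> carrier_mat N N"
  defines "R \<equiv> P * Tpoly N a"
  shows "eval_pmat (dop_act D_coeffs P) x * eval_pmat (Tpoly N a) x =
    complex_of_real (rho fam x) \<cdot>\<^sub>m eval_pmat (pderiv_mat 2 R) x
      + eval_pmat (pderiv_mat 1 R) x * mat_diag N (\<lambda>k. poly (v k) (complex_of_real x))
      + eval_pmat R x * mat_diag N \<kappa>"
    (is "?DP * ?Tx = ?B")
proof (rule eq_matI)
  have R: "R \<in> carrier_mat N N" using P Tpoly_carrier by (auto simp: R_def)
  have derivs: "eval_pmat (pderiv_mat m R) x \<in> carrier_mat N N" for m
    using R by (simp add: eval_pmat_def pderiv_mat_def)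
  have DP: "dop_act D_coeffs P \<in> carrier_mat N N" using wf_D_coeffs P by (rule dop_act_carrier)
  show "(?DP * ?Tx) $$ (i, k) = ?B $$ (i, k)" if "i < dim_row ?B" "k < dim_col ?B" for i k
  proof -
    have ik: "i < N" "k < N" using that eval_pmat_carrier[OF R, of x] by (auto simp: mat_diag_def)
    have "(?DP * ?Tx) $$ (i, k) = poly (\<delta> k (R $$ (i, k))) (complex_of_real x)"
      unfolding eval_mult_Tpoly_index[OF DP ik] dop_act_D_coeffs_mult_Tpoly_index[OF P ik] R_def ..
    also have "\<dots> = ?B $$ (i, k)"
      unfolding mat_diag_mult_right[OF derivs] mat_diag_mult_right[OF eval_pmat_carrier[OF R]]
      using ik R by (simp add: \<delta>_eq poly_rho_poly eval_pmat_def pderiv_mat_def numeral_2_eq_2)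
    finally show ?thesis .
  qed
  show "dim_row (?DP * ?Tx) = dim_row ?B" "dim_col (?DP * ?Tx) = dim_col ?B"
    using eval_pmat_carrier[OF DP, of x] eval_pmat_carrier[OF R, of x] eval_pmat_carrier[OF Tpoly_carrier]
    by (auto simp: mat_diag_def)
qed

lemma eval_dop_act_D_coeffs:
  assumes P: "P \<in> carrier_mat N N" and x: "x \<in> support fam"
  shows "eval_pmat (dop_act D_coeffs P) x = paper_D_action fam N a p q P x"
proof -
  define Tx where "Tx = eval_pmat (Tpoly N a) x"
  have DP: "eval_pmat (dop_act D_coeffs P) x \<in> carrier_mat N N"
    using wf_D_coeffs P by (intro eval_pmat_carrier dop_act_carrier)
  have Tx: "Tx \<in> carrier_mat N N" using Tpoly_carrier by (simp add: Tx_def eval_pmat_carrier)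
  have inverse: "minv Tx \<in> carrier_mat N N" "Tx * minv Tx = 1\<^sub>m N"
    using minv_eval_Tpoly by (simp_all add: Tx_def)
  have "paper_D_action fam N a p q P x = eval_pmat (dop_act D_coeffs P) x * Tx * minv Tx"
    unfolding Tx_def eval_dop_act_D_coeffs_mult_Tpoly[OF P]
    using log_derivative_Wtilde[OF x, of N p q]
    by (simp add: paper_D_action_def Let_def v_def \<kappa>_def[abs_def] Ktilde_eq_mat_diag)
  also have "\<dots> = eval_pmat (dop_act D_coeffs P) x"
    unfolding assoc_mult_mat[OF DP Tx inverse(1)] inverse(2) using DP by (rule right_mult_one_mat)
  finally show ?thesis ..
qed

lemma D_coeffs_second_order: "length D_coeffs = 3" "D_coeffs ! 2 \<noteq> 0\<^sub>m N N"
proof -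
  show "length D_coeffs = 3" by (simp add: D_coeffs_def)
  have "(D_coeffs ! 2) $$ (0, 0) = rho_poly fam" using N_pos by (simp add: D_coeffs_def)
  then show "D_coeffs ! 2 \<noteq> 0\<^sub>m N N" using \<rho>_neq_0 N_pos by auto
qed

end

theorem theorem4p3:
  fixes fam :: family and N :: nat and a p q :: "nat \<Rightarrow> real"
  assumes "N \<ge> 2"
    and "\<forall>j\<in>{1..N-1}. a j \<noteq> 0"
    and "admissible fam N p q"
  shows "\<exists>D. wf_dop N D \<and> length D = 3 \<and> D ! 2 \<noteq> 0\<^sub>m N N
          \<and> (\<forall>P\<in>carrier_mat N N. \<forall>x\<in>support fam.
                eval_pmat (dop_act D P) x = paper_D_action fam N a p q P x)
          \<and> D \<in> DW N (Wmat fam N a p q) (support fam)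
          \<and> DW N (Wmat fam N a p q) (support fam) = poly_algebra N D"
proof -
  interpret classical_darboux fam N a p q using assms by (rule classical_darboux.intro)
  show ?thesis
    using wf_D_coeffs D_coeffs_second_order eval_dop_act_D_coeffs D_coeffs_in_DW DW_eq_poly_algebra
    by (intro exI[of _ D_coeffs]) blast
qed

end
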